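(* Let $E\subset\mathbb{R}^d$ be non-empty and bounded, and let $m$ be an integer with $1\le m\le d$. (i) For every $\theta\in(0,1]$ with $\dim_{qA}E\le\max\{m,\overline{\dim}_\theta E\}$, $$\overline{\dim}_\theta P_VE=\min\{m,\overline{\dim}_\theta E\}\quad\text{for }\gamma_{d,m}\text{-almost all }V\in G(d,m).$$ (ii) More generally (without the assumption in (i)), for all $\theta\in(0,1]$ and $\gamma_{d,m}$-almost all $V\in G(d,m)$, $$\overline{\dim}_\theta P_VE\ \ge\ \overline{\dim}_\theta E-\max\left\{0,\ \dim_{qA}E-m\right\}.$$ The same conclusions (i) and (ii) hold with $\overline{\dim}_\theta$ replaced throughout by $\underline{\dim}_\theta$.
   Context: $G(d,m)$ is the Grassmannian of all $m$-dimensional linear subspaces of $\mathbb{R}^d$, $\gamma_{d,m}$ is the Haar (rotation-invariant probability) measure on $G(d,m)$, and $P_V$ is the orthogonal projection of $\mathbb{R}^d$ onto $V$. $|U|$ denotes the diameter of a set $U$, and $B(x,R)$ the open ball with centre $x$ and radius $R$. Intermediate dimensions. For a non-empty bounded set $F\subset\mathbb{R}^d$ and $\theta\in(0,1]$, the lower $\theta$-intermediate dimension $\underline{\dim}_\theta F$ is the infimum of all $s\ge 0$ such that for all $\epsilon>0$ and all $\delta_0>0$ there exist $0<\delta\le\delta_0$ and a cover $\{U_i\}_{i\in I}$ of $F$ with $\delta^{1/\theta}\le|U_i|\le\delta$ for all $i$ and $\sum_{i}|U_i|^s\le\epsilon$. The upper $\theta$-intermediate dimension $\overline{\dim}_\theta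 F$ is the infimum of all $s\ge 0$ such that for all $\epsilon>0$ there exists $\delta_0>0$ such that for all $0<\delta\le\delta_0$ there is a cover $\{U_i\}_{i\in I}$ of $F$ with $\delta^{1/\theta}\le|U_i|\le\delta$ for all $i$ and $\sum_i|U_i|^s\le\epsilon$. Quasi-Assouad dimension. $N_r(F)$ is the minimum number of sets of diameter $r$ that can cover $F$. For $\alpha\in(0,1)$, the upper Assouad spectrum $\overline{\dim}_A^{\alpha}E$ is the infimum of all $s$ for which there is $C>0$ such that $N_r(B(x,R)\cap E)\le C(R/r)^s$ for all $0<r\le R^{1/\alpha}<R<1$ and all $x\in E$; it is non-decreasing in $\alpha$, and $\dim_{qA}E:=\lim_{\alpha\to1^-}\overline{\dim}_A^{\alpha}E$. *)

theory Defs
  imports "HOL-Probability.Probability_Measure"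
begin

section \<open>The Grassmannian and its invariant measure\<close>

definition grassmannian :: "nat \<Rightarrow> 'a::euclidean_space set set" where
  "grassmannian m = {V. subspace V \<and> dim V = m}"

definition orth_proj :: "'a::euclidean_space set \<Rightarrow> 'a \<Rightarrow> 'a" where
  "orth_proj V x = (THE p. p \<in> V \<and> (\<forall>v\<in>V. orthogonal (x - p) v))"

lemma orth_proj_eqI:
  assumes "subspace V" "p \<in> V" "\<And>v. v \<in> V \<Longrightarrow> orthogonal (x - p) v"
  shows "orth_proj V x = p"
  unfolding orth_proj_def
proof (rule the_equality)
  show "p \<in> V \<and> (\<forall>v\<in>V. orthogonal (x - p) v)" using assms by blast
next
  fix q assume q: "q \<in> V \<and> (\<forall>v\<in>V. orthogonal (x - q) v)"
  have "q - p \<in> V" using q assms by (simp add: subspace_diff)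
  then have "(x - p) \<bullet> (q - p) = 0" "(x - q) \<bullet> (q - p) = 0"
    using q assms by (auto simp: orthogonal_def)
  then have "(q - p) \<bullet> (q - p) = 0" by (simp add: inner_diff_left)
  then show "q = p" by simp
qed

lemma orth_proj:
  assumes "subspace V"
  shows "orth_proj V x \<in> V" "v \<in> V \<Longrightarrow> orthogonal (x - orth_proj V x) v"
proof -
  obtain y z where yz: "y \<in> span V" "\<And>w. w \<in> span V \<Longrightarrow> orthogonal z w" "x = y + z"
    using orthogonal_subspace_decomp_exists [of V x] by metis
  moreover have "span V = V" using assms by (simp add: span_eq_iff)
  ultimately have "orth_proj V x = y" using assms by (intro orth_proj_eqI) auto
  then show "orth_proj V x \<in> V" "v \<in> V \<Longrightarrow> orthogonal (x - orth_proj V x) v"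
    using yz \<open>span V = V\<close> by auto
qed

lemma linear_orth_proj:
  assumes "subspace V"
  shows "linear (orth_proj V)"
proof (rule linearI)
  fix x y
  show "orth_proj V (x + y) = orth_proj V x + orth_proj V y"
  proof (rule orth_proj_eqI [OF assms])
    show "orth_proj V x + orth_proj V y \<in> V"
      using assms by (simp add: orth_proj subspace_add)
    show "orthogonal (x + y - (orth_proj V x + orth_proj V y)) v" if "v \<in> V" for v
      using orth_proj(2)[OF assms that, of x] orth_proj(2)[OF assms that, of y]
      by (simp add: orthogonal_def inner_diff_left inner_add_left)
  qed
next
  fix c :: real and x
  show "orth_proj V (c *\<^sub>R x) = c *\<^sub>R orth_proj V x"
  proof (rule orth_proj_eqI [OF assms])
    show "c *\<^sub>R orth_proj V x \<in> V"
      using assms by (simp add: orth_proj subspace_scale)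
    show "orthogonal (c *\<^sub>R x - c *\<^sub>R orth_proj V x) v" if "v \<in> V" for v
      using orth_proj(2)[OF assms that, of x]
      by (simp add: orthogonal_def inner_diff_left)
  qed
qed

definition orth_proj_blinfun :: "'a::euclidean_space set \<Rightarrow> 'a \<Rightarrow>\<^sub>L 'a" where
  "orth_proj_blinfun V = Blinfun (orth_proj V)"

lemma blinfun_apply_orth_proj_blinfun:
  assumes "subspace V"
  shows "blinfun_apply (orth_proj_blinfun V) = orth_proj V"
  unfolding orth_proj_blinfun_def
  using assms by (simp add: bounded_linear_Blinfun_apply linear_linear linear_orth_proj)

lemma inj_on_orth_proj_blinfun:
  "inj_on orth_proj_blinfun (grassmannian m :: 'a::euclidean_space set set)"
proof (rule inj_onI)
  fix V W :: "'a set"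
  assume "V \<in> grassmannian m" "W \<in> grassmannian m"
    and eq: "orth_proj_blinfun V = orth_proj_blinfun W"
  then have VW: "subspace V" "subspace W" by (auto simp: grassmannian_def)
  have range_eq: "range (orth_proj U) = U" if "subspace U" for U :: "'a set"
  proof
    show "range (orth_proj U) \<subseteq> U" using that orth_proj(1) by blast
    show "U \<subseteq> range (orth_proj U)"
    proof
      fix x assume "x \<in> U"
      then have "orth_proj U x = x" using that by (intro orth_proj_eqI) (auto simp: orthogonal_def)
      then show "x \<in> range (orth_proj U)" by (metis rangeI)
    qed
  qed
  show "V = W" using range_eq VW eq blinfun_apply_orth_proj_blinfun by metis
qed

text \<open>
  The topology of the Grassmannian is that of the metric given by the operator norm of the
  difference of the orthogonal projections.  Its Borel sigma-algebra is therefore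
  the pullback of the Borel sigma-algebra of the space of bounded linear operators along the
  embedding of a subspace as its projection.  The invariant probability measure on it is unique;
  \<open>haar_grassmannian m \<gamma>\<close> says that \<open>\<gamma>\<close> is this measure.
\<close>

definition haar_grassmannian :: "nat \<Rightarrow> 'a::euclidean_space set measure \<Rightarrow> bool" where
  "haar_grassmannian m \<gamma> \<longleftrightarrow>
     prob_space \<gamma> \<and>
     space \<gamma> = grassmannian m \<and>
     sets \<gamma> = sets (vimage_algebra (grassmannian m) orth_proj_blinfun borel) \<and>
     (\<forall>g. orthogonal_transformation g \<longrightarrow>
        (\<forall>A\<in>sets \<gamma>. emeasure \<gamma> ((\<lambda>V. g ` V) ` A) = emeasure \<gamma> A))"

section \<open>Intermediate dimensions\<close>

text \<open>
  Boundedness of the covering sets is required explicitly because \<^const>\<open>diameter\<close> is a real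
  number, without meaning on unbounded sets.
\<close>

definition intermediate_cover ::
    "real \<Rightarrow> real \<Rightarrow> real \<Rightarrow> real \<Rightarrow> 'a::metric_space set \<Rightarrow> bool" where
  "intermediate_cover \<theta> s \<delta> \<epsilon> F \<longleftrightarrow>
     (\<exists>\<U>. F \<subseteq> \<Union>\<U> \<and>
          (\<forall>U\<in>\<U>. bounded U \<and> \<delta> powr (1 / \<theta>) \<le> diameter U \<and> diameter U \<le> \<delta>) \<and>
          (\<lambda>U. diameter U powr s) summable_on \<U> \<and>
          infsum (\<lambda>U. diameter U powr s) \<U> \<le> \<epsilon>)"

definition lower_intermediate_dim :: "real \<Rightarrow> 'a::metric_space set \<Rightarrow> real" where
  "lower_intermediate_dim \<theta> F =
     Inf {s. 0 \<le> s \<and> (\<forall>\<epsilon>>0. \<forall>\<delta>\<^sub>0>0. \<exists>\<delta>. 0 < \<delta> \<and> \<delta> \<le> \<delta>\<^sub>0 \<and> intermediate_cover \<theta> s \<delta> \<epsilon> F)}"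

definition upper_intermediate_dim :: "real \<Rightarrow> 'a::metric_space set \<Rightarrow> real" where
  "upper_intermediate_dim \<theta> F =
     Inf {s. 0 \<le> s \<and> (\<forall>\<epsilon>>0. \<exists>\<delta>\<^sub>0>0. \<forall>\<delta>. 0 < \<delta> \<and> \<delta> \<le> \<delta>\<^sub>0 \<longrightarrow> intermediate_cover \<theta> s \<delta> \<epsilon> F)}"

section \<open>Quasi-Assouad dimension\<close>

definition covering_number :: "real \<Rightarrow> 'a::metric_space set \<Rightarrow> nat" where
  "covering_number r F =
     (LEAST n. \<exists>\<U>. finite \<U> \<and> card \<U> = n \<and> F \<subseteq> \<Union>\<U> \<and> (\<forall>U\<in>\<U>. bounded U \<and> diameter U = r))"

definition upper_assouad_spectrum :: "real \<Rightarrow> 'a::metric_space set \<Rightarrow> real" where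
  "upper_assouad_spectrum \<alpha> E =
     Inf {s. \<exists>C>0. \<forall>r R. \<forall>x\<in>E. 0 < r \<and> r \<le> R powr (1 / \<alpha>) \<and> R powr (1 / \<alpha>) < R \<and> R < 1 \<longrightarrow>
               real (covering_number r (ball x R \<inter> E)) \<le> C * (R / r) powr s}"

definition quasi_assouad_dim :: "'a::metric_space set \<Rightarrow> real" where
  "quasi_assouad_dim E = Lim (at_left 1) (\<lambda>\<alpha>. upper_assouad_spectrum \<alpha> E)"

end

theory Submission
  imports Defs
begin

text \<open>
  Write \<open>Q\<close> for the quasi-Assouad dimension of \<open>E\<close> and \<open>D(F)\<close> for the upper (or lower)
  \<open>\<theta>\<close>-intermediate dimension of a set \<open>F\<close>.  Everything rests on the almost sure bound
  \<open>D(P\<^sub>V E) \<ge> D(E) - max 0 (Q - m)\<close>.  In the other direction \<open>D(P\<^sub>V E) \<le> min m (D(E))\<close> for every \<open>V\<close>,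
  because \<open>P\<^sub>V E\<close> is a bounded part of an \<open>m\<close>-dimensional space and \<open>P\<^sub>V\<close> is a contraction.  If
  \<open>Q \<le> m\<close>, the lower bound is \<open>D(E)\<close>; if \<open>m < Q \<le> D(E)\<close>, it is at least \<open>m\<close>; so under the hypothesis
  \<open>Q \<le> max m (D(E))\<close> the two bounds meet.

  The lower bound is a potential-theoretic argument at one pair of scales \<open>\<rho> = \<delta> powr (1 / \<theta>)\<close> and
  \<open>\<delta>\<close> at a time.  Let \<open>t < D(E)\<close>.  For suitable small \<open>\<delta>\<close> the set \<open>E\<close> has no cover by sets of
  diameter between \<open>\<rho>\<close> and \<open>\<delta>\<close> with small sum of \<open>t\<close>-th powers, and a discrete version of Frostman's
  lemma puts unit mass on a finite \<open>\<rho>\<close>-net of \<open>E\<close> such that balls of radius \<open>r\<close> between \<open>\<rho>\<close> and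
  \<open>\<delta>\<close> have mass at most a constant times \<open>r powr t\<close> (\<open>frostman_weights\<close>).  Covers of this kind say
  nothing about balls of radius \<open>R > \<delta>\<close>.  For these the quasi-Assouad dimension bounds the number of
  sets of diameter \<open>\<delta>\<close> needed to cover the part of \<open>E\<close> in the ball (\<open>quasi_assouad_cover\<close>).  With \<open>q\<close>
  slightly above \<open>max Q m\<close> and \<open>\<kappa>\<close> slightly below \<open>m\<close>, both regimes combine to a constant times
  \<open>R powr \<kappa> * r powr (\<tau> - \<kappa>)\<close> as a bound for the mass of a ball of any radius \<open>R \<ge> r \<ge> \<rho>\<close>, where \<open>\<tau>\<close> is close
  to \<open>t - (q - \<kappa>)\<close> and hence to \<open>D(E) - max 0 (Q - m)\<close> (\<open>frostman_weight_growth\<close>).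

  By rotation invariance, \<open>norm (P\<^sub>V z) \<le> r\<close> has probability at most a constant times
  \<open>(r / norm z) ^ m\<close> (\<open>prob_small_projection_le\<close>).  Since \<open>\<kappa> < m\<close>, summing over dyadic annuli shows that the
  pairs of points whose projections are within \<open>r\<close> of each other have expected mass of order
  \<open>r powr \<tau>\<close> (\<open>weighted_kernel_sum_le\<close>).  For \<open>a < \<tau>\<close> the \<open>a\<close>-energy of the projected mass, truncated to
  the scales between \<open>\<rho>\<close> and \<open>\<delta>\<close>, therefore has expectation of order \<open>\<delta> powr (\<tau> - a)\<close>
  (\<open>expected_energy_bound\<close>).  On the other hand the Cauchy-Schwarz inequality shows that a cover of
  \<open>P\<^sub>V E\<close> by sets with diameters in this range has a sum of \<open>a\<close>-th powers bounded below by a constant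
  over the energy (\<open>cover_sum_energy\<close>).  So the subspaces \<open>V\<close> for which \<open>P\<^sub>V E\<close> has a cheap cover
  lie in a set of measure of order \<open>\<delta> powr (\<tau> - a)\<close>, and along a sequence of scales decreasing
  geometrically the Borel-Cantelli lemma applies.
\<close>

section \<open>Covering balls by smaller balls\<close>

text \<open>
  A grid in the coordinates of an orthonormal basis of \<open>V\<close>.  The constant depends on \<open>V\<close> only through its
  dimension, and the exponent is \<open>dim V\<close> rather than the dimension of the ambient space.  Both matter: the
  first for an estimate uniform in a random subspace, the second for the bound of the dimension of a
  projection by \<open>m\<close>.
\<close>

lemma subspace_cball_cover:
  fixes V :: "'a::euclidean_space set"
  assumes V: "subspace V" and h: "0 < h" "h \<le> R"
  shows "\<exists>Y. finite Y \<and> real (card Y) \<le> (real (2 * dim V + 5) * (R / h)) ^ dim V \<and>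
             V \<inter> cball 0 R \<subseteq> (\<Union>y\<in>Y. cball y h)"
proof -
  obtain B where B: "B \<subseteq> V" "pairwise orthogonal B" "\<And>x. x \<in> B \<Longrightarrow> norm x = 1"
      "independent B" "card B = dim V" "span B = V"
    using orthonormal_basis_subspace [OF V] by metis
  then have finB: "finite B" by (simp add: independent_imp_finite)
  define m where "m = dim V"
  \<comment> \<open>Rounding errors of size \<open>k\<close> in each of the \<open>dim V\<close> coordinates add up to at most \<open>h\<close>.\<close>
  define k where "k = h / real (m + 1)"
  have k: "k > 0" using h by (simp add: k_def)
  define N where "N = \<lfloor>R / k\<rfloor> + 1"
  have "k \<le> h" using h by (simp add: k_def field_simps)
  then have Rk: "R / k \<ge> 1" using h k by simp
  define Y where "Y = (\<lambda>g. \<Sum>b\<in>B. (real_of_int (g b) * k) *\<^sub>R b) ` (PiE B (\<lambda>_. {-N..N}))"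
  have finP: "finite (PiE B (\<lambda>_. {-N..N}))" using finB by (intro finite_PiE) auto
  have N0: "N \<ge> 0" using Rk unfolding N_def by linarith
  have "card Y \<le> card (PiE B (\<lambda>_. {-N..N}))"
    unfolding Y_def by (rule card_image_le [OF finP])
  also have "\<dots> = nat (2 * N + 1) ^ m"
    using finB B(5) N0 by (simp add: card_PiE m_def)
  finally have "real (card Y) \<le> real (nat (2 * N + 1)) ^ m"
    by (metis of_nat_le_iff of_nat_power)
  also have "real (nat (2 * N + 1)) = 2 * real_of_int N + 1" using N0 by simp
  also have "(2 * real_of_int N + 1) ^ m \<le> (real (2 * m + 5) * (R / h)) ^ m"
  proof (rule power_mono)
    have "2 * real_of_int (\<lfloor>q\<rfloor> + 1) + 1 \<le> 2 * q + 3" for q :: real by simp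
    then have "2 * real_of_int N + 1 \<le> 2 * (R / k) + 3" unfolding N_def .
    also have "\<dots> = 2 * real (m + 1) * (R / h) + 3" by (simp add: k_def)
    also have "\<dots> \<le> 2 * real (m + 1) * (R / h) + 3 * (R / h)"
    proof -
      have "1 \<le> R / h" using h by simp
      then show ?thesis by linarith
    qed
    also have "\<dots> = real (2 * m + 5) * (R / h)" by (simp add: algebra_simps)
    finally show "2 * real_of_int N + 1 \<le> real (2 * m + 5) * (R / h)" .
  qed (use N0 in simp)
  finally have card: "real (card Y) \<le> (real (2 * m + 5) * (R / h)) ^ m" .
  have "x \<in> (\<Union>y\<in>Y. cball y h)" if x: "x \<in> V" "norm x \<le> R" for x
  proof -
    define g where "g = restrict (\<lambda>b. \<lfloor>(x \<bullet> b) / k\<rfloor>) B"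
    have "\<bar>x \<bullet> b\<bar> \<le> R" if "b \<in> B" for b
      using Cauchy_Schwarz_ineq2 [of x b] B(3)[OF that] x by simp
    then have "\<bar>(x \<bullet> b) / k\<bar> \<le> R / k" if "b \<in> B" for b
      using that k by (simp add: divide_right_mono)
    then have "\<bar>\<lfloor>(x \<bullet> b) / k\<rfloor>\<bar> \<le> N" if "b \<in> B" for b
      using that unfolding N_def by (smt (verit, ccfv_SIG) floor_le_iff floor_mono floor_less_iff le_floor_iff abs_le_iff of_int_minus of_int_floor_le)
    then have "g \<in> PiE B (\<lambda>_. {-N..N})" by (fastforce simp: g_def abs_le_iff)
    then have y: "(\<Sum>b\<in>B. (real_of_int (g b) * k) *\<^sub>R b) \<in> Y" by (auto simp: Y_def)
    have "x = (\<Sum>b\<in>B. (x \<bullet> b) *\<^sub>R b)"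
      using orthonormal_basis_expand [OF B(2,3) _ finB] B(6) x by simp
    then have "norm (x - (\<Sum>b\<in>B. (real_of_int (g b) * k) *\<^sub>R b))
             = norm (\<Sum>b\<in>B. (x \<bullet> b - real_of_int (g b) * k) *\<^sub>R b)"
      by (simp add: scaleR_diff_left sum_subtractf)
    also have "\<dots> \<le> (\<Sum>b\<in>B. k)"
    proof (rule sum_norm_le)
      fix b assume b: "b \<in> B"
      have "real_of_int (g b) \<le> (x \<bullet> b) / k" "(x \<bullet> b) / k < real_of_int (g b) + 1"
        using b by (auto simp: g_def)
      then have "real_of_int (g b) * k \<le> x \<bullet> b" "x \<bullet> b \<le> (real_of_int (g b) + 1) * k"
        using k by (auto simp: pos_le_divide_eq pos_divide_less_eq)
      then show "norm ((x \<bullet> b - real_of_int (g b) * k) *\<^sub>R b) \<le> k"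
        unfolding norm_scaleR B(3)[OF b] by (simp add: abs_le_iff algebra_simps)
    qed
    also have "\<dots> \<le> h" using B(5) h by (simp add: k_def m_def field_simps)
    finally show ?thesis using y by (auto simp: dist_norm norm_minus_commute)
  qed
  then show ?thesis
    using card finP by (intro exI [of _ Y]) (auto simp: Y_def m_def)
qed

text \<open>
  An upper bound, for \<open>K \<ge> 1\<close>, on the number of unit balls needed to cover a ball of radius \<open>K\<close>.
\<close>

definition cover_const :: "'a::euclidean_space itself \<Rightarrow> real \<Rightarrow> real" where
  "cover_const _ K = (real (2 * DIM('a) + 5) * K) ^ DIM('a)"

lemma cover_const_ge_1: "1 \<le> K \<Longrightarrow> 1 \<le> cover_const TYPE('a::euclidean_space) K"
  unfolding cover_const_def
  using mult_mono [of 1 "real (2 * DIM('a) + 5)" 1 K] by (intro one_le_power) simp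

lemma cover_const_mono:
  "0 \<le> K \<Longrightarrow> K \<le> L \<Longrightarrow> cover_const TYPE('a::euclidean_space) K \<le> cover_const TYPE('a) L"
  unfolding cover_const_def by (intro power_mono mult_left_mono) auto

lemma cball_cover:
  fixes x :: "'a::euclidean_space"
  assumes h: "0 < h" "h \<le> R"
  shows "\<exists>Y. finite Y \<and> real (card Y) \<le> cover_const TYPE('a) (R / h) \<and>
             cball x R \<subseteq> (\<Union>y\<in>Y. cball y h)"
proof -
  obtain Y where Y: "finite Y" "real (card Y) \<le> cover_const TYPE('a) (R / h)"
      "cball (0::'a) R \<subseteq> (\<Union>y\<in>Y. cball y h)"
    using subspace_cball_cover [OF subspace_UNIV h, where ?'a = 'a] by (auto simp: cover_const_def)
  have "cball x R \<subseteq> (\<Union>y\<in>(+) x ` Y. cball y h)"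
  proof
    fix z assume "z \<in> cball x R"
    then have "z - x \<in> cball 0 R" by (simp add: dist_norm norm_minus_commute)
    then obtain y where "y \<in> Y" "dist y (z - x) \<le> h" using Y(3) by auto
    then show "z \<in> (\<Union>y\<in>(+) x ` Y. cball y h)"
      by (auto simp: dist_norm algebra_simps intro!: bexI [of _ y])
  qed
  moreover have "real (card ((+) x ` Y)) \<le> cover_const TYPE('a) (R / h)"
    using Y(2) card_image_le [OF Y(1), of "(+) x"] by linarith
  ultimately show ?thesis using Y(1) by blast
qed

lemma bounded_finite_net:
  fixes E :: "'a::euclidean_space set"
  assumes "bounded E" "0 < e"
  shows "\<exists>X. finite X \<and> X \<subseteq> E \<and> E \<subseteq> (\<Union>x\<in>X. ball x e)"
proof -
  have "compact (closure E)" using assms(1) by (simp add: compact_closure)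
  moreover have "closure E \<subseteq> (\<Union>x\<in>E. ball x e)"
  proof
    fix z assume "z \<in> closure E"
    then obtain x where "x \<in> E" "dist x z < e"
      using assms(2) unfolding closure_approachable by blast
    then show "z \<in> (\<Union>x\<in>E. ball x e)" by auto
  qed
  ultimately obtain T where T: "T \<subseteq> E" "finite T" "closure E \<subseteq> (\<Union>x\<in>T. ball x e)"
    using compactE_image [of "closure E" E "\<lambda>x. ball x e"] open_ball by metis
  have "E \<subseteq> (\<Union>x\<in>T. ball x e)" using closure_subset T(3) by (rule order_trans)
  with T(1,2) show ?thesis by (intro exI [of _ T] conjI)
qed

section \<open>Covers with restricted diameters\<close>

text \<open>
  The diameters in a cover are bounded away from \<open>0\<close>, so a finite sum of their powers forces the cover to be
  finite.
\<close>

lemma intermediate_cover_finiteD: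
  assumes "intermediate_cover \<theta> s \<delta> \<epsilon> F" and \<delta>: "0 < \<delta>" and s: "0 \<le> s"
  obtains \<U> where "finite \<U>" "F \<subseteq> \<Union>\<U>"
    "\<And>U. U \<in> \<U> \<Longrightarrow> bounded U \<and> \<delta> powr (1 / \<theta>) \<le> diameter U \<and> diameter U \<le> \<delta>"
    "(\<Sum>U\<in>\<U>. diameter U powr s) \<le> \<epsilon>"
proof -
  obtain \<U> where U: "F \<subseteq> \<Union>\<U>"
      "\<And>U. U \<in> \<U> \<Longrightarrow> bounded U \<and> \<delta> powr (1 / \<theta>) \<le> diameter U \<and> diameter U \<le> \<delta>"
      "(\<lambda>U. diameter U powr s) summable_on \<U>"
      "infsum (\<lambda>U. diameter U powr s) \<U> \<le> \<epsilon>"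
    using assms(1) unfolding intermediate_cover_def by blast
  define c where "c = (\<delta> powr (1 / \<theta>)) powr s"
  have c: "c > 0" using \<delta> by (simp add: c_def)
  have "finite \<U>"
  proof (rule ccontr)
    assume "infinite \<U>"
    obtain n where n: "\<epsilon> / c < real n" using reals_Archimedean2 by blast
    obtain A where A: "A \<subseteq> \<U>" "finite A" "card A = n"
      using infinite_arbitrarily_large [OF \<open>infinite \<U>\<close>] by blast
    have "c * real n = (\<Sum>U\<in>A. c)" using A by simp
    also have "\<dots> \<le> (\<Sum>U\<in>A. diameter U powr s)"
      using A(1) U(2) s unfolding c_def by (intro sum_mono powr_mono2) auto
    also have "\<dots> \<le> infsum (\<lambda>U. diameter U powr s) \<U>"
      by (rule finite_sum_le_infsum [OF U(3) A(2,1)]) simp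
    also have "\<dots> \<le> \<epsilon>" by (rule U(4))
    finally show False using n c by (simp add: field_simps)
  qed
  then show ?thesis using U by (intro that [of \<U>]) auto
qed

lemma intermediate_coverI:
  assumes "finite \<U>" "F \<subseteq> \<Union>\<U>"
    "\<And>U. U \<in> \<U> \<Longrightarrow> bounded U \<and> \<delta> powr (1 / \<theta>) \<le> diameter U \<and> diameter U \<le> \<delta>"
    "(\<Sum>U\<in>\<U>. diameter U powr s) \<le> \<epsilon>"
  shows "intermediate_cover \<theta> s \<delta> \<epsilon> F"
  unfolding intermediate_cover_def using assms by (intro exI [of _ \<U>]) auto

lemma intermediate_cover_weaken:
  assumes "intermediate_cover \<theta> s \<delta> \<epsilon> F" "0 < \<delta>" "\<delta> \<le> 1" "0 \<le> s" "s \<le> s'" "\<epsilon> \<le> \<epsilon>'"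
  shows "intermediate_cover \<theta> s' \<delta> \<epsilon>' F"
proof -
  obtain \<U> where U: "finite \<U>" "F \<subseteq> \<Union>\<U>"
    "\<And>U. U \<in> \<U> \<Longrightarrow> bounded U \<and> \<delta> powr (1 / \<theta>) \<le> diameter U \<and> diameter U \<le> \<delta>"
    "(\<Sum>U\<in>\<U>. diameter U powr s) \<le> \<epsilon>"
    using intermediate_cover_finiteD [OF assms(1,2,4)] by metis
  have "(\<Sum>U\<in>\<U>. diameter U powr s') \<le> (\<Sum>U\<in>\<U>. diameter U powr s)"
  proof (rule sum_mono)
    fix U assume "U \<in> \<U>"
    then have "0 < diameter U" "diameter U \<le> 1"
      using U(3) assms(2,3) by (smt (verit) powr_gt_zero)+
    then show "diameter U powr s' \<le> diameter U powr s"
      using assms(5) by (intro powr_mono') auto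
  qed
  then show ?thesis using U assms(6) by (intro intermediate_coverI [of \<U>]) auto
qed

text \<open>
  Constants in the radii and in the admissible range of scales do not matter: a ball that is too large by a
  bounded factor is split into boundedly many balls whose diameters are exactly admissible.  Covers that
  arise with the wrong diameters, from a Vitali covering or as images under a contraction, are
  repaired in this way.
\<close>

lemma intermediate_cover_from_cballs:
  fixes F :: "'a::euclidean_space set" and x :: "'i \<Rightarrow> 'a"
  assumes I: "finite I" and F: "F \<subseteq> (\<Union>i\<in>I. cball (x i) (K * u i))" and K: "1 \<le> K"
    and u: "\<And>i. i \<in> I \<Longrightarrow> \<delta> powr (1 / \<theta>) \<le> u i \<and> u i \<le> K * \<delta>"
    and \<delta>: "0 < \<delta>" "\<delta> powr (1 / \<theta>) \<le> \<delta>" and s: "0 \<le> s"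
    and \<epsilon>: "cover_const TYPE('a) (2 * K\<^sup>2) * (\<Sum>i\<in>I. u i powr s) \<le> \<epsilon>"
  shows "intermediate_cover \<theta> s \<delta> \<epsilon> F"
proof -
  define v where "v i = min (u i) \<delta>" for i
  have u0: "0 < u i" if "i \<in> I" for i using u[OF that] \<delta> by (smt (verit) powr_gt_zero)
  have v: "0 < v i" "\<delta> powr (1 / \<theta>) \<le> v i" "v i \<le> \<delta>" "v i \<le> u i" "u i \<le> K * v i" if "i \<in> I" for i
    using u[OF that] u0[OF that] \<delta> K mult_right_mono[of 1 K "u i"] by (auto simp: v_def min_def)
  have "\<exists>Y. finite Y \<and> real (card Y) \<le> cover_const TYPE('a) (2 * K\<^sup>2) \<and>
          cball (x i) (K * u i) \<subseteq> (\<Union>y\<in>Y. cball y (v i / 2))" if i: "i \<in> I" for i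
  proof -
    have "1 * u i \<le> K * u i" using u0[OF i] K by (intro mult_right_mono) auto
    then have "v i / 2 \<le> K * u i" using v(1,4)[OF i] by linarith
    then obtain Y where Y: "finite Y" "real (card Y) \<le> cover_const TYPE('a) (K * u i / (v i / 2))"
        "cball (x i) (K * u i) \<subseteq> (\<Union>y\<in>Y. cball y (v i / 2))"
      using cball_cover[of "v i / 2" "K * u i" "x i"] v[OF i] by auto
    have "K * u i / (v i / 2) \<le> 2 * K\<^sup>2"
      using v[OF i] K mult_left_mono[OF v(5)[OF i], of K]
      by (simp add: divide_simps power2_eq_square)
    then have "cover_const TYPE('a) (K * u i / (v i / 2)) \<le> cover_const TYPE('a) (2 * K\<^sup>2)"
      using v[OF i] K by (intro cover_const_mono) auto
    with Y show ?thesis by (intro exI[of _ Y]) auto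
  qed
  then obtain Y where Y: "\<And>i. i \<in> I \<Longrightarrow> finite (Y i)"
      "\<And>i. i \<in> I \<Longrightarrow> real (card (Y i)) \<le> cover_const TYPE('a) (2 * K\<^sup>2)"
      "\<And>i. i \<in> I \<Longrightarrow> cball (x i) (K * u i) \<subseteq> (\<Union>y\<in>Y i. cball y (v i / 2))"
    by metis
  define \<U> where "\<U> = (\<lambda>(i, y). cball y (v i / 2)) ` Sigma I Y"
  have fin: "finite (Sigma I Y)" using I Y(1) by auto
  have diam: "diameter (cball y (v i / 2)) = v i" if "i \<in> I" for i and y :: 'a using v(1)[OF that] by auto
  have "(\<Sum>U\<in>\<U>. diameter U powr s) \<le> (\<Sum>p\<in>Sigma I Y. diameter (case p of (i, y) \<Rightarrow> cball y (v i / 2)) powr s)"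
    unfolding \<U>_def using sum_image_le [OF fin, of "\<lambda>U. diameter U powr s" "\<lambda>(i, y). cball y (v i / 2)"]
    by (simp add: o_def)
  also have "\<dots> = (\<Sum>i\<in>I. \<Sum>y\<in>Y i. diameter (cball y (v i / 2)) powr s)"
    using I Y(1) by (subst sum.Sigma) (auto simp: case_prod_beta)
  also have "\<dots> = (\<Sum>i\<in>I. real (card (Y i)) * v i powr s)"
    by (intro sum.cong) (auto simp del: diameter_cball simp add: diam)
  also have "\<dots> \<le> (\<Sum>i\<in>I. cover_const TYPE('a) (2 * K\<^sup>2) * u i powr s)"
    using v less_imp_le[OF v(1)] s Y(2) cover_const_ge_1[of "2 * K\<^sup>2", where ?'a='a] one_le_power[OF K, of 2]
    by (intro sum_mono mult_mono powr_mono2) auto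
  also have "\<dots> \<le> \<epsilon>" using \<epsilon> by (simp add: sum_distrib_left)
  finally have sum: "(\<Sum>U\<in>\<U>. diameter U powr s) \<le> \<epsilon>" .
  show ?thesis
  proof (rule intermediate_coverI [of \<U>])
    show "finite \<U>" using fin by (simp add: \<U>_def)
    show "F \<subseteq> \<Union>\<U>"
    proof
      fix z assume "z \<in> F"
      then obtain i where "i \<in> I" "z \<in> cball (x i) (K * u i)" using F by blast
      moreover from this obtain y where "y \<in> Y i" "z \<in> cball y (v i / 2)" using Y(3) by blast
      ultimately show "z \<in> \<Union>\<U>" unfolding \<U>_def by force
    qed
    show "bounded U \<and> \<delta> powr (1 / \<theta>) \<le> diameter U \<and> diameter U \<le> \<delta>" if "U \<in> \<U>" for U
      using that v unfolding \<U>_def by (auto simp del: diameter_cball simp add: diam)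
  qed (rule sum)
qed

text \<open>
  The image of a covering set may have diameter below the admissible range.  It lies in a ball whose radius is
  the diameter of the original set, and such balls can be repaired.
\<close>

lemma intermediate_cover_image:
  fixes F :: "'a::euclidean_space set" and f :: "'a \<Rightarrow> 'b::euclidean_space"
  assumes cov: "intermediate_cover \<theta> s \<delta> \<epsilon> F" and \<delta>: "0 < \<delta>" "\<delta> powr (1 / \<theta>) \<le> \<delta>" and s: "0 \<le> s"
    and f: "\<And>x y. dist (f x) (f y) \<le> dist x y"
  shows "intermediate_cover \<theta> s \<delta> (cover_const TYPE('b) 2 * \<epsilon>) (f ` F)"
proof -
  obtain \<U> where U: "finite \<U>" "F \<subseteq> \<Union>\<U>"
    "\<And>U. U \<in> \<U> \<Longrightarrow> bounded U \<and> \<delta> powr (1 / \<theta>) \<le> diameter U \<and> diameter U \<le> \<delta>"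
    "(\<Sum>U\<in>\<U>. diameter U powr s) \<le> \<epsilon>"
    using intermediate_cover_finiteD [OF cov \<delta>(1) s] by metis
  show ?thesis
  proof (rule intermediate_cover_from_cballs [where K = 1 and I = \<U> and u = diameter and
        x = "\<lambda>U. f (SOME x. x \<in> U)"])
    show "f ` F \<subseteq> (\<Union>U\<in>\<U>. cball (f (SOME x. x \<in> U)) (1 * diameter U))"
    proof clarify
      fix x assume "x \<in> F"
      then obtain V where V: "V \<in> \<U>" "x \<in> V" using U(2) by blast
      then have "(SOME x. x \<in> V) \<in> V" by (metis someI)
      then have "dist (SOME x. x \<in> V) x \<le> diameter V"
        using V U(3) by (intro diameter_bounded_bound) auto
      then have "dist (f (SOME x. x \<in> V)) (f x) \<le> diameter V" by (rule order_trans [OF f])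
      with V show "f x \<in> (\<Union>U\<in>\<U>. cball (f (SOME x. x \<in> U)) (1 * diameter U))" by auto
    qed
    show "cover_const TYPE('b) (2 * 1\<^sup>2) * (\<Sum>i\<in>\<U>. diameter i powr s) \<le> cover_const TYPE('b) 2 * \<epsilon>"
      using U(4) cover_const_ge_1 [of 2, where ?'a = 'b] by (simp add: mult_left_mono)
    show "\<delta> powr (1 / \<theta>) \<le> diameter U \<and> diameter U \<le> 1 * \<delta>" if "U \<in> \<U>" for U
      using U(3) [OF that] by simp
  qed (use U(1) \<delta> s in simp_all)
qed

lemma powr_inverse_le_self:
  fixes \<delta> \<theta> :: real
  assumes "0 < \<theta>" "\<theta> \<le> 1" "0 < \<delta>" "\<delta> \<le> 1"
  shows "\<delta> powr (1 / \<theta>) \<le> \<delta>"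
proof -
  have "\<delta> powr (1 / \<theta>) \<le> \<delta> powr 1" using assms by (intro powr_mono') auto
  then show ?thesis using assms by simp
qed

lemma powr_small_near_0:
  fixes C b \<epsilon> :: real
  assumes "0 < b" "0 < \<epsilon>"
  shows "\<exists>\<delta>\<^sub>0>0. \<forall>\<delta>. 0 < \<delta> \<and> \<delta> \<le> \<delta>\<^sub>0 \<longrightarrow> C * \<delta> powr b \<le> \<epsilon>"
proof -
  define A where "A = \<bar>C\<bar> + 1"
  have A: "A > 0" "C \<le> A" by (auto simp: A_def)
  define \<delta>\<^sub>0 where "\<delta>\<^sub>0 = (\<epsilon> / A) powr (1 / b)"
  have "C * \<delta> powr b \<le> \<epsilon>" if "0 < \<delta>" "\<delta> \<le> \<delta>\<^sub>0" for \<delta>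
  proof -
    have "C * \<delta> powr b \<le> A * \<delta>\<^sub>0 powr b"
      using that assms A by (intro mult_mono powr_mono2) auto
    also have "\<dots> = \<epsilon>" using assms A by (simp add: \<delta>\<^sub>0_def powr_powr)
    finally show ?thesis .
  qed
  moreover have "\<delta>\<^sub>0 > 0" using assms A by (simp add: \<delta>\<^sub>0_def)
  ultimately show ?thesis by blast
qed

section \<open>Intermediate dimensions as thresholds\<close>

text \<open>
  Both intermediate dimensions are the infimum of an upwards closed set of exponents.  The four facts about
  such infima below serve for both.
\<close>

lemma threshold_le:
  fixes s :: real
  assumes "0 \<le> s" "P s" shows "Inf {s. 0 \<le> s \<and> P s} \<le> s"
  using assms by (intro cInf_lower bdd_belowI [of _ 0]) auto

lemma threshold_less:
  fixes s :: real
  assumes mono: "\<And>s s'. P s \<Longrightarrow> 0 \<le> s \<Longrightarrow> s \<le> s' \<Longrightarrow> P s'"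
    and ex: "P b" "0 \<le> b" and less: "Inf {s. 0 \<le> s \<and> P s} < s"
  shows "P s"
proof -
  have "{s. 0 \<le> s \<and> P s} \<noteq> {}" using ex by auto
  then obtain s' where "0 \<le> s'" "P s'" "s' < s" using cInf_lessD [OF _ less] by auto
  then show ?thesis using mono [of s' s] by simp
qed

lemma threshold_ge:
  fixes s :: real
  assumes mono: "\<And>s s'. P s \<Longrightarrow> 0 \<le> s \<Longrightarrow> s \<le> s' \<Longrightarrow> P s'"
    and ex: "P b" "0 \<le> b" and not: "\<not> P s"
  shows "s \<le> Inf {s. 0 \<le> s \<and> P s}"
proof (rule ccontr)
  assume "\<not> s \<le> Inf {s. 0 \<le> s \<and> P s}"
  then have "Inf {s. 0 \<le> s \<and> P s} < s" by simp
  have "P s"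
  proof (rule threshold_less [where P = P and b = b])
    show "P y" if "P x" "0 \<le> x" "x \<le> y" for x y using mono that .
  qed fact+
  with not show False by simp
qed

lemma threshold_nonneg:
  fixes b :: real
  assumes ex: "P b" "0 \<le> b"
  shows "0 \<le> Inf {s. 0 \<le> s \<and> P s}"
  using assms by (intro cInf_greatest) auto

definition upper_coverable :: "real \<Rightarrow> real \<Rightarrow> 'a::metric_space set \<Rightarrow> bool" where
  "upper_coverable \<theta> s F \<longleftrightarrow>
     (\<forall>\<epsilon>>0. \<exists>\<delta>\<^sub>0>0. \<forall>\<delta>. 0 < \<delta> \<and> \<delta> \<le> \<delta>\<^sub>0 \<longrightarrow> intermediate_cover \<theta> s \<delta> \<epsilon> F)"

definition lower_coverable :: "real \<Rightarrow> real \<Rightarrow> 'a::metric_space set \<Rightarrow> bool" where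
  "lower_coverable \<theta> s F \<longleftrightarrow>
     (\<forall>\<epsilon>>0. \<forall>\<delta>\<^sub>0>0. \<exists>\<delta>. 0 < \<delta> \<and> \<delta> \<le> \<delta>\<^sub>0 \<and> intermediate_cover \<theta> s \<delta> \<epsilon> F)"

lemma upper_intermediate_dim_alt:
  "upper_intermediate_dim \<theta> F = Inf {s. 0 \<le> s \<and> upper_coverable \<theta> s F}"
  by (simp add: upper_intermediate_dim_def upper_coverable_def)

lemma lower_intermediate_dim_alt:
  "lower_intermediate_dim \<theta> F = Inf {s. 0 \<le> s \<and> lower_coverable \<theta> s F}"
  by (simp add: lower_intermediate_dim_def lower_coverable_def)

lemma upper_coverable_imp_lower: "upper_coverable \<theta> s F \<Longrightarrow> lower_coverable \<theta> s F"
  unfolding upper_coverable_def lower_coverable_def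
proof (intro allI impI)
  fix \<epsilon> \<delta>\<^sub>0 :: real
  assume *: "\<forall>\<epsilon>>0. \<exists>\<delta>\<^sub>0>0. \<forall>\<delta>. 0 < \<delta> \<and> \<delta> \<le> \<delta>\<^sub>0 \<longrightarrow> intermediate_cover \<theta> s \<delta> \<epsilon> F"
    and "\<epsilon> > 0" "\<delta>\<^sub>0 > 0"
  from * [rule_format, OF \<open>\<epsilon> > 0\<close>] obtain \<delta>\<^sub>1 where "\<delta>\<^sub>1 > 0"
    and "\<forall>\<delta>. 0 < \<delta> \<and> \<delta> \<le> \<delta>\<^sub>1 \<longrightarrow> intermediate_cover \<theta> s \<delta> \<epsilon> F" by (elim exE conjE)
  with \<open>\<delta>\<^sub>0 > 0\<close> show "\<exists>\<delta>. 0 < \<delta> \<and> \<delta> \<le> \<delta>\<^sub>0 \<and> intermediate_cover \<theta> s \<delta> \<epsilon> F"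
    by (intro exI [of _ "min \<delta>\<^sub>0 \<delta>\<^sub>1"]) simp
qed

lemma upper_coverable_mono:
  assumes "upper_coverable \<theta> s F" "0 \<le> s" "s \<le> s'"
  shows "upper_coverable \<theta> s' F"
  unfolding upper_coverable_def
proof (intro allI impI)
  fix \<epsilon> :: real assume "\<epsilon> > 0"
  from assms(1) [unfolded upper_coverable_def, rule_format, OF this] obtain \<delta>\<^sub>1 where "\<delta>\<^sub>1 > 0"
    and "\<forall>\<delta>. 0 < \<delta> \<and> \<delta> \<le> \<delta>\<^sub>1 \<longrightarrow> intermediate_cover \<theta> s \<delta> \<epsilon> F" by (elim exE conjE)
  then show "\<exists>\<delta>\<^sub>0>0. \<forall>\<delta>. 0 < \<delta> \<and> \<delta> \<le> \<delta>\<^sub>0 \<longrightarrow> intermediate_cover \<theta> s' \<delta> \<epsilon> F"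
    by (intro exI [of _ "min 1 \<delta>\<^sub>1"])
       (auto intro: intermediate_cover_weaken [OF _ _ _ assms(2,3) order_refl])
qed

lemma lower_coverable_mono:
  assumes "lower_coverable \<theta> s F" "0 \<le> s" "s \<le> s'"
  shows "lower_coverable \<theta> s' F"
  unfolding lower_coverable_def
proof (intro allI impI)
  fix \<epsilon> \<delta>\<^sub>0 :: real assume "\<epsilon> > 0" "\<delta>\<^sub>0 > 0"
  then have "min 1 \<delta>\<^sub>0 > 0" by simp
  then obtain \<delta> where "0 < \<delta>" "\<delta> \<le> min 1 \<delta>\<^sub>0" "intermediate_cover \<theta> s \<delta> \<epsilon> F"
    using assms(1) \<open>\<epsilon> > 0\<close> unfolding lower_coverable_def by blast
  then show "\<exists>\<delta>. 0 < \<delta> \<and> \<delta> \<le> \<delta>\<^sub>0 \<and> intermediate_cover \<theta> s' \<delta> \<epsilon> F"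
    using intermediate_cover_weaken [OF _ _ _ assms(2,3) order_refl] by (intro exI [of _ \<delta>]) auto
qed

text \<open>
  Sets of diameter exactly \<open>\<delta>\<close> are admissible for every \<open>\<theta> \<le> 1\<close>, so a bound for box-counting numbers is a bound
  for intermediate dimensions.
\<close>

lemma upper_coverable_of_box_count:
  fixes F :: "'a::euclidean_space set"
  assumes \<theta>: "0 < \<theta>" "\<theta> \<le> 1" and s: "0 \<le> s" "e < s" and \<delta>1: "0 < \<delta>\<^sub>1"
    and cov: "\<And>\<delta>. 0 < \<delta> \<Longrightarrow> \<delta> \<le> \<delta>\<^sub>1 \<Longrightarrow> \<exists>\<U>. finite \<U> \<and> real (card \<U>) \<le> C * \<delta> powr (- e) \<and>
                    F \<subseteq> \<Union>\<U> \<and> (\<forall>U\<in>\<U>. bounded U \<and> diameter U = \<delta>)"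
  shows "upper_coverable \<theta> s F"
  unfolding upper_coverable_def
proof (intro allI impI)
  fix \<epsilon> :: real assume "\<epsilon> > 0"
  then obtain \<delta>\<^sub>2 where \<delta>2: "\<delta>\<^sub>2 > 0" "\<And>\<delta>. 0 < \<delta> \<Longrightarrow> \<delta> \<le> \<delta>\<^sub>2 \<Longrightarrow> C * \<delta> powr (s - e) \<le> \<epsilon>"
    using powr_small_near_0 [of "s - e" \<epsilon> C] s by auto
  have "intermediate_cover \<theta> s \<delta> \<epsilon> F" if \<delta>: "0 < \<delta>" "\<delta> \<le> min 1 (min \<delta>\<^sub>1 \<delta>\<^sub>2)" for \<delta>
  proof -
    obtain \<U> where U: "finite \<U>" "real (card \<U>) \<le> C * \<delta> powr (- e)" "F \<subseteq> \<Union>\<U>"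
        "\<And>U. U\<in>\<U> \<Longrightarrow> bounded U \<and> diameter U = \<delta>"
      using cov [of \<delta>] \<delta> by auto
    have "(\<Sum>U\<in>\<U>. diameter U powr s) = real (card \<U>) * \<delta> powr s" using U(4) by simp
    also have "\<dots> \<le> C * \<delta> powr (- e) * \<delta> powr s" using U(2) by (intro mult_right_mono) auto
    also have "\<dots> = C * \<delta> powr (s - e)" by (simp add: powr_add [symmetric] algebra_simps)
    also have "\<dots> \<le> \<epsilon>" using \<delta>2 \<delta> by simp
    finally show ?thesis
      using U \<theta> \<delta> powr_inverse_le_self [OF \<theta>] by (intro intermediate_coverI [of \<U>]) auto
  qed
  then show "\<exists>\<delta>\<^sub>0>0. \<forall>\<delta>. 0 < \<delta> \<and> \<delta> \<le> \<delta>\<^sub>0 \<longrightarrow> intermediate_cover \<theta> s \<delta> \<epsilon> F"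
    using \<delta>1 \<delta>2 by (intro exI [of _ "min 1 (min \<delta>\<^sub>1 \<delta>\<^sub>2)"]) auto
qed

lemma upper_coverable_subspace:
  fixes F :: "'a::euclidean_space set"
  assumes \<theta>: "0 < \<theta>" "\<theta> \<le> 1" and V: "subspace V" and F: "F \<subseteq> V" "bounded F" and s: "real (dim V) < s"
  shows "upper_coverable \<theta> s F"
proof -
  obtain B where B: "B > 0" "F \<subseteq> cball 0 B"
    using bounded_subset_ballD [OF F(2), of 0] ball_subset_cball by (metis order_trans)
  define C where "C = (real (2 * dim V + 5) * (2 * B)) ^ dim V"
  show ?thesis
  proof (rule upper_coverable_of_box_count [OF \<theta> _ s B(1)])
    fix \<delta> assume \<delta>: "0 < \<delta>" "\<delta> \<le> B"
    then obtain Y where Y: "finite Y" "real (card Y) \<le> (real (2 * dim V + 5) * (B / (\<delta> / 2))) ^ dim V"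
             "V \<inter> cball 0 B \<subseteq> (\<Union>y\<in>Y. cball y (\<delta> / 2))"
      using subspace_cball_cover [OF V, of "\<delta> / 2" B] by auto
    have "real (card ((\<lambda>y. cball y (\<delta> / 2)) ` Y)) \<le> real (card Y)"
      using card_image_le [OF Y(1)] by simp
    also note Y(2)
    also have "(real (2 * dim V + 5) * (B / (\<delta> / 2))) ^ dim V = C * \<delta> powr (- real (dim V))"
    proof -
      have eq: "real (2 * dim V + 5) * (B / (\<delta> / 2)) = real (2 * dim V + 5) * (2 * B) / \<delta>" by simp
      show ?thesis
        unfolding eq power_divide C_def powr_minus powr_realpow [OF \<delta>(1)] by (simp only: divide_inverse)
    qed
    finally have "real (card ((\<lambda>y. cball y (\<delta> / 2)) ` Y)) \<le> C * \<delta> powr (- real (dim V))" .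
    moreover have "F \<subseteq> \<Union>((\<lambda>y. cball y (\<delta> / 2)) ` Y)" using Y(3) F(1) B(2) by blast
    ultimately show "\<exists>\<U>. finite \<U> \<and> real (card \<U>) \<le> C * \<delta> powr - real (dim V) \<and>
                F \<subseteq> \<Union>\<U> \<and> (\<forall>U\<in>\<U>. bounded U \<and> diameter U = \<delta>)"
      using Y(1) \<delta> by (intro exI [of _ "(\<lambda>y. cball y (\<delta> / 2)) ` Y"] conjI finite_imageI ballI) auto
  next
    show "0 \<le> s" using s of_nat_0_le_iff [of "dim V"] by linarith
  qed
qed

lemma upper_coverable_DIM_plus_1:
  fixes F :: "'a::euclidean_space set"
  assumes "0 < \<theta>" "\<theta> \<le> 1" "bounded F"
  shows "upper_coverable \<theta> (real DIM('a) + 1) F"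
  using assms by (intro upper_coverable_subspace [of \<theta> UNIV]) auto

lemma upper_coverable_image:
  fixes F :: "'a::euclidean_space set" and f :: "'a \<Rightarrow> 'b::euclidean_space"
  assumes cov: "upper_coverable \<theta> s F" and \<theta>: "0 < \<theta>" "\<theta> \<le> 1" and s: "0 \<le> s"
    and f: "\<And>x y. dist (f x) (f y) \<le> dist x y"
  shows "upper_coverable \<theta> s (f ` F)"
  unfolding upper_coverable_def
proof (intro allI impI)
  fix \<epsilon> :: real assume "\<epsilon> > 0"
  define c where "c = cover_const TYPE('b) 2"
  have c: "c > 0" using cover_const_ge_1 [of 2, where ?'a = 'b] by (simp add: c_def)
  from cov [unfolded upper_coverable_def, rule_format, OF divide_pos_pos [OF \<open>\<epsilon> > 0\<close> c]]
  obtain \<delta>\<^sub>1 where "\<delta>\<^sub>1 > 0"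
    and "\<forall>\<delta>. 0 < \<delta> \<and> \<delta> \<le> \<delta>\<^sub>1 \<longrightarrow> intermediate_cover \<theta> s \<delta> (\<epsilon> / c) F" by (elim exE conjE)
  then show "\<exists>\<delta>\<^sub>0>0. \<forall>\<delta>. 0 < \<delta> \<and> \<delta> \<le> \<delta>\<^sub>0 \<longrightarrow> intermediate_cover \<theta> s \<delta> \<epsilon> (f ` F)"
    using intermediate_cover_image [where \<epsilon> = "\<epsilon> / c" and F = F and f = f, OF _ _ powr_inverse_le_self [OF \<theta>] s f] c
    by (intro exI [of _ "min 1 \<delta>\<^sub>1"]) (auto simp flip: c_def)
qed

lemma lower_coverable_image:
  fixes F :: "'a::euclidean_space set" and f :: "'a \<Rightarrow> 'b::euclidean_space"
  assumes cov: "lower_coverable \<theta> s F" and \<theta>: "0 < \<theta>" "\<theta> \<le> 1" and s: "0 \<le> s"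
    and f: "\<And>x y. dist (f x) (f y) \<le> dist x y"
  shows "lower_coverable \<theta> s (f ` F)"
  unfolding lower_coverable_def
proof (intro allI impI)
  fix \<epsilon> \<delta>\<^sub>0 :: real assume "\<epsilon> > 0" "\<delta>\<^sub>0 > 0"
  define c where "c = cover_const TYPE('b) 2"
  have c: "c > 0" using cover_const_ge_1 [of 2, where ?'a = 'b] by (simp add: c_def)
  have "min 1 \<delta>\<^sub>0 > 0" "\<epsilon> / c > 0" using \<open>\<delta>\<^sub>0 > 0\<close> \<open>\<epsilon> > 0\<close> c by auto
  then obtain \<delta> where "0 < \<delta>" "\<delta> \<le> min 1 \<delta>\<^sub>0" "intermediate_cover \<theta> s \<delta> (\<epsilon> / c) F"
    using cov unfolding lower_coverable_def by blast
  then show "\<exists>\<delta>. 0 < \<delta> \<and> \<delta> \<le> \<delta>\<^sub>0 \<and> intermediate_cover \<theta> s \<delta> \<epsilon> (f ` F)"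
    using intermediate_cover_image [OF _ _ powr_inverse_le_self [OF \<theta>] s f, of \<delta> "\<epsilon> / c"] c
    by (intro exI [of _ \<delta>]) (auto simp flip: c_def)
qed

section \<open>Quasi-Assouad dimension\<close>

definition assouad_admissible :: "real \<Rightarrow> real \<Rightarrow> 'a::metric_space set \<Rightarrow> bool" where
  "assouad_admissible \<alpha> s E \<longleftrightarrow>
     (\<exists>C>0. \<forall>r R. \<forall>x\<in>E. 0 < r \<and> r \<le> R powr (1 / \<alpha>) \<and> R powr (1 / \<alpha>) < R \<and> R < 1 \<longrightarrow>
        real (covering_number r (ball x R \<inter> E)) \<le> C * (R / r) powr s)"

lemma upper_assouad_spectrum_alt: "upper_assouad_spectrum \<alpha> E = Inf {s. assouad_admissible \<alpha> s E}"
  by (simp add: upper_assouad_spectrum_def assouad_admissible_def)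

lemma covering_number_le:
  assumes "finite \<U>" "F \<subseteq> \<Union>\<U>" "\<And>U. U \<in> \<U> \<Longrightarrow> bounded U \<and> diameter U = r"
  shows "covering_number r F \<le> card \<U>"
  unfolding covering_number_def by (rule Least_le) (use assms in blast)

lemma cover_by_sets_of_diameter:
  fixes F :: "'a::euclidean_space set"
  assumes "0 < r" "r \<le> 2 * R" "F \<subseteq> cball x R"
  shows "\<exists>\<U>. finite \<U> \<and> real (card \<U>) \<le> cover_const TYPE('a) (2 * R / r) \<and> F \<subseteq> \<Union>\<U> \<and>
             (\<forall>U\<in>\<U>. bounded U \<and> diameter U = r)"
proof -
  obtain Y where Y: "finite Y" "real (card Y) \<le> cover_const TYPE('a) (R / (r / 2))"
      "cball x R \<subseteq> (\<Union>y\<in>Y. cball y (r / 2))"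
    using cball_cover [of "r / 2" R x] assms by auto
  have "R / (r / 2) = 2 * R / r" by simp
  then have "real (card Y) \<le> cover_const TYPE('a) (2 * R / r)" using Y(2) by (simp only:)
  then have "real (card ((\<lambda>y. cball y (r / 2)) ` Y)) \<le> cover_const TYPE('a) (2 * R / r)"
    using card_image_le [OF Y(1), of "\<lambda>y. cball y (r / 2)"] by linarith
  moreover have "F \<subseteq> \<Union>((\<lambda>y. cball y (r / 2)) ` Y)" using Y(3) assms(3) by blast
  ultimately show ?thesis
    using Y(1) assms(1)
    by (intro exI [of _ "(\<lambda>y. cball y (r / 2)) ` Y"] conjI finite_imageI ballI) auto
qed

lemma covering_number_cover:
  fixes F :: "'a::euclidean_space set"
  assumes "0 < r" "bounded F"
  shows "\<exists>\<U>. finite \<U> \<and> card \<U> = covering_number r F \<and> F \<subseteq> \<Union>\<U> \<and> (\<forall>U\<in>\<U>. bounded U \<and> diameter U = r)"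
proof -
  obtain B where B: "B > 0" "F \<subseteq> cball 0 B"
    using bounded_subset_ballD [OF assms(2), of 0] ball_subset_cball by (metis order_trans)
  have "F \<subseteq> cball 0 (B + r)" using B assms(1) by (auto simp: subset_iff)
  then obtain \<U> where "finite \<U>" "F \<subseteq> \<Union>\<U>" "\<forall>U\<in>\<U>. bounded U \<and> diameter U = r"
    using cover_by_sets_of_diameter [of r "B + r" F 0] assms(1) B(1) by auto
  then have "\<exists>n. \<exists>\<U>. finite \<U> \<and> card \<U> = n \<and> F \<subseteq> \<Union>\<U> \<and> (\<forall>U\<in>\<U>. bounded U \<and> diameter U = r)"
    by blast
  then show ?thesis unfolding covering_number_def by (rule LeastI_ex)
qed

lemma covering_number_ge_1:
  fixes F :: "'a::euclidean_space set"
  assumes "0 < r" "bounded F" "F \<noteq> {}"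
  shows "1 \<le> covering_number r F"
proof -
  obtain \<U> where "finite \<U>" "card \<U> = covering_number r F" "F \<subseteq> \<Union>\<U>"
    using covering_number_cover [OF assms(1,2)] by blast
  then show ?thesis using assms(3) by (cases "\<U> = {}") (auto simp: Suc_le_eq card_gt_0_iff)
qed

lemma assouad_admissible_DIM:
  fixes E :: "'a::euclidean_space set"
  assumes "0 < \<alpha>"
  shows "assouad_admissible \<alpha> (real DIM('a)) E"
  unfolding assouad_admissible_def
proof (intro exI conjI allI ballI impI)
  show "0 < (real (2 * DIM('a) + 5) * 2) ^ DIM('a)" by simp
  fix r R :: real and x :: 'a
  assume r: "0 < r \<and> r \<le> R powr (1 / \<alpha>) \<and> R powr (1 / \<alpha>) < R \<and> R < 1"
  then have R: "r \<le> R" "0 < R" by linarith+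
  have "ball x R \<inter> E \<subseteq> cball x R" by auto
  then obtain \<U> where U: "finite \<U>" "real (card \<U>) \<le> cover_const TYPE('a) (2 * R / r)" "ball x R \<inter> E \<subseteq> \<Union>\<U>"
             "\<forall>U\<in>\<U>. bounded U \<and> diameter U = r"
    using cover_by_sets_of_diameter [of r R "ball x R \<inter> E" x] r R by auto
  have "real (covering_number r (ball x R \<inter> E)) \<le> real (card \<U>)"
    using covering_number_le [OF U(1,3)] U(4) by simp
  also note U(2)
  also have "cover_const TYPE('a) (2 * R / r) = (real (2 * DIM('a) + 5) * 2) ^ DIM('a) * (R / r) powr real DIM('a)"
  proof -
    have "real (2 * DIM('a) + 5) * (2 * R / r) = real (2 * DIM('a) + 5) * 2 * (R / r)" by simp
    moreover have "(R / r) powr real DIM('a) = (R / r) ^ DIM('a)" using r R by (intro powr_realpow) simp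
    ultimately show ?thesis by (simp only: cover_const_def power_mult_distrib)
  qed
  finally show "real (covering_number r (ball x R \<inter> E))
    \<le> (real (2 * DIM('a) + 5) * 2) ^ DIM('a) * (R / r) powr real DIM('a)" .
qed

text \<open>
  The admissible exponents are bounded below, so their infimum is a genuine one.  For fixed \<open>R\<close> and
  \<open>r\<close> tending to \<open>0\<close>, a negative \<open>s\<close> would push the bound for a covering number below \<open>1\<close>.
\<close>

lemma assouad_admissible_nonneg:
  fixes E :: "'a::euclidean_space set"
  assumes adm: "assouad_admissible \<alpha> s E" and \<alpha>: "0 < \<alpha>" "\<alpha> < 1" and E: "E \<noteq> {}"
  shows "0 \<le> s"
proof (rule ccontr)
  assume s: "\<not> 0 \<le> s"
  from adm obtain C where C0: "C > 0" and C1: "\<forall>r R. \<forall>x\<in>E. 0 < r \<and> r \<le> R powr (1 / \<alpha>) \<and>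
      R powr (1 / \<alpha>) < R \<and> R < 1 \<longrightarrow> real (covering_number r (ball x R \<inter> E)) \<le> C * (R / r) powr s"
    unfolding assouad_admissible_def by (elim exE conjE)
  have C2: "real (covering_number r (ball x R \<inter> E)) \<le> C * (R / r) powr s"
    if "x \<in> E" "0 < r" "r \<le> R powr (1 / \<alpha>)" "R powr (1 / \<alpha>) < R" "R < 1" for r R x
    using C1 [rule_format, OF that(1), of r R] that by simp
  note C = C0 C2
  obtain x where x: "x \<in> E" using E by blast
  define R :: real where "R = 1 / 2"
  have R: "0 < R" "R < 1" by (auto simp: R_def)
  have "R powr (1 / \<alpha>) < R powr 1" using R \<alpha> by (intro powr_less_mono') auto
  then have R': "R powr (1 / \<alpha>) < R" using R by simp
  have "((\<lambda>X. X powr s) \<longlongrightarrow> 0) at_top" using s by (intro tendsto_neg_powr filterlim_ident) auto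
  then have "eventually (\<lambda>X. X powr s < 1 / C) at_top" using C(1) by (intro order_tendstoD) auto
  then obtain N where N: "\<And>X. N \<le> X \<Longrightarrow> X powr s < 1 / C" by (auto simp: eventually_at_top_linorder)
  define X where "X = max N (R / R powr (1 / \<alpha>))"
  have X: "X powr s < 1 / C" "X \<ge> R / R powr (1 / \<alpha>)" using N by (auto simp: X_def)
  have X0: "X > 0" using X(2) R by (smt (verit) divide_pos_pos powr_gt_zero)
  define r where "r = R / X"
  have r: "0 < r" "r \<le> R powr (1 / \<alpha>)"
    using X X0 R by (auto simp: r_def field_simps)
  have "1 \<le> real (covering_number r (ball x R \<inter> E))"
  proof -
    have "x \<in> ball x R \<inter> E" using x R by simp
    then have "1 \<le> covering_number r (ball x R \<inter> E)"
      using bounded_Int [OF disjI1, OF bounded_ball] by (intro covering_number_ge_1 r(1)) blast+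
    then show ?thesis by simp
  qed
  also have "\<dots> \<le> C * (R / r) powr s" using C(2) x r R' R by blast
  also have "R / r = X" using R X0 by (simp add: r_def)
  also have "C * X powr s < 1" using X(1) C(1) by (simp add: field_simps)
  finally show False by simp
qed

text \<open>
  A larger parameter admits more pairs of radii, so the spectrum is non-decreasing.
\<close>

lemma assouad_admissible_antimono:
  assumes adm: "assouad_admissible \<beta> s E" and \<alpha>: "0 < \<alpha>" "\<alpha> \<le> \<beta>" "\<beta> < 1"
  shows "assouad_admissible \<alpha> s E"
proof -
  from adm obtain C where C0: "C > 0" and C1: "\<forall>r R. \<forall>x\<in>E. 0 < r \<and> r \<le> R powr (1 / \<beta>) \<and>
      R powr (1 / \<beta>) < R \<and> R < 1 \<longrightarrow> real (covering_number r (ball x R \<inter> E)) \<le> C * (R / r) powr s"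
    unfolding assouad_admissible_def by (elim exE conjE)
  have C2: "real (covering_number r (ball x R \<inter> E)) \<le> C * (R / r) powr s"
    if "x \<in> E" "0 < r" "r \<le> R powr (1 / \<beta>)" "R powr (1 / \<beta>) < R" "R < 1" for r R x
    using C1 [rule_format, OF that(1), of r R] that by simp
  note C = C0 C2
  show ?thesis unfolding assouad_admissible_def
  proof (intro exI [of _ C] conjI C(1) allI ballI impI)
    fix r R :: real and x assume x: "x \<in> E"
      and r: "0 < r \<and> r \<le> R powr (1 / \<alpha>) \<and> R powr (1 / \<alpha>) < R \<and> R < 1"
    then have R: "0 < R" "R < 1" by linarith+
    have "1 / \<beta> \<le> 1 / \<alpha>" using \<alpha> by (simp add: frac_le)
    then have "R powr (1 / \<alpha>) \<le> R powr (1 / \<beta>)" using R by (intro powr_mono') auto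
    moreover have "R powr (1 / \<beta>) < R powr 1" using R \<alpha> by (intro powr_less_mono') auto
    ultimately show "real (covering_number r (ball x R \<inter> E)) \<le> C * (R / r) powr s"
      using r R by (intro C(2) x) auto
  qed
qed

lemma assouad_admissible_mono:
  assumes adm: "assouad_admissible \<alpha> s E" and s: "s \<le> s'"
  shows "assouad_admissible \<alpha> s' E"
proof -
  from adm obtain C where C0: "C > 0" and C1: "\<forall>r R. \<forall>x\<in>E. 0 < r \<and> r \<le> R powr (1 / \<alpha>) \<and>
      R powr (1 / \<alpha>) < R \<and> R < 1 \<longrightarrow> real (covering_number r (ball x R \<inter> E)) \<le> C * (R / r) powr s"
    unfolding assouad_admissible_def by (elim exE conjE)
  have C2: "real (covering_number r (ball x R \<inter> E)) \<le> C * (R / r) powr s"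
    if "x \<in> E" "0 < r" "r \<le> R powr (1 / \<alpha>)" "R powr (1 / \<alpha>) < R" "R < 1" for r R x
    using C1 [rule_format, OF that(1), of r R] that by simp
  note C = C0 C2
  show ?thesis unfolding assouad_admissible_def
  proof (intro exI [of _ C] conjI C(1) allI ballI impI)
    fix r R :: real and x assume x: "x \<in> E"
      and r: "0 < r \<and> r \<le> R powr (1 / \<alpha>) \<and> R powr (1 / \<alpha>) < R \<and> R < 1"
    have "real (covering_number r (ball x R \<inter> E)) \<le> C * (R / r) powr s" using r by (intro C(2) x) auto
    also have "\<dots> \<le> C * (R / r) powr s'" using r s C(1) by (intro mult_left_mono powr_mono) auto
    finally show "real (covering_number r (ball x R \<inter> E)) \<le> C * (R / r) powr s'" .
  qed
qed

text \<open>
  The spectrum is non-decreasing and bounded by the dimension of the space, so its limit at \<open>1\<close> exists and is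
  its supremum.
\<close>

lemma upper_assouad_spectrum_le_quasi:
  fixes E :: "'a::euclidean_space set"
  assumes E: "E \<noteq> {}" and \<alpha>: "0 < \<alpha>" "\<alpha> < 1"
  shows "upper_assouad_spectrum \<alpha> E \<le> quasi_assouad_dim E"
proof -
  define f where "f \<alpha> = upper_assouad_spectrum \<alpha> E" for \<alpha>
  have bdd: "bdd_below {s. assouad_admissible \<alpha> s E}" if "\<alpha> \<in> {0<..<1}" for \<alpha>
    using assouad_admissible_nonneg [OF _ _ _ E] that by (intro bdd_belowI [of _ 0]) auto
  have mono: "f \<alpha> \<le> f \<beta>" if "0 < \<alpha>" "\<alpha> \<le> \<beta>" "\<beta> < 1" for \<alpha> \<beta>
    unfolding f_def upper_assouad_spectrum_alt
  proof (rule cInf_superset_mono)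
    show "{s. assouad_admissible \<beta> s E} \<noteq> {}" using assouad_admissible_DIM [of \<beta> E] that by auto
    show "{s. assouad_admissible \<beta> s E} \<subseteq> {s. assouad_admissible \<alpha> s E}"
      using assouad_admissible_antimono that by blast
  qed (use bdd that in auto)
  have le: "f \<alpha> \<le> real DIM('a)" if "\<alpha> \<in> {0<..<1}" for \<alpha>
    unfolding f_def upper_assouad_spectrum_alt
    using assouad_admissible_DIM [of \<alpha> E] bdd that by (intro cInf_lower) auto
  define L where "L = (SUP \<alpha>\<in>{0<..<1}. f \<alpha>)"
  have bda: "bdd_above (f ` {0<..<1})" using le by (intro bdd_aboveI2) auto
  have fL: "f \<alpha> \<le> L" if "\<alpha> \<in> {0<..<1}" for \<alpha> unfolding L_def using bda that by (intro cSUP_upper)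
  have "(f \<longlongrightarrow> L) (at_left 1)"
  proof (rule increasing_tendsto)
    have "eventually (\<lambda>\<alpha>. \<alpha> \<in> {0<..<1}) (at_left (1::real))" by (rule eventually_at_left_real) simp
    then show "eventually (\<lambda>\<alpha>. f \<alpha> \<le> L) (at_left 1)" using fL by (rule eventually_mono)
    fix y assume "y < L"
    then obtain \<alpha> where \<alpha>: "\<alpha> \<in> {0<..<1}" "y < f \<alpha>"
      unfolding L_def using less_cSUP_iff [OF _ bda, of y] by auto
    have "eventually (\<lambda>\<beta>. \<beta> \<in> {\<alpha><..<1}) (at_left (1::real))" using \<alpha> by (intro eventually_at_left_real) auto
    then show "eventually (\<lambda>\<beta>. y < f \<beta>) (at_left 1)"
    proof eventually_elim
      case (elim \<beta>)
      then have "f \<alpha> \<le> f \<beta>" using \<alpha> by (intro mono) auto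
      then show ?case using \<alpha> by simp
    qed
  qed
  then have "quasi_assouad_dim E = L"
    unfolding quasi_assouad_dim_def f_def by (intro tendsto_Lim) auto
  then show ?thesis using fL \<alpha> by (auto simp: f_def)
qed

lemma quasi_assouad_admissible:
  fixes E :: "'a::euclidean_space set"
  assumes E: "E \<noteq> {}" and q: "quasi_assouad_dim E < q" and \<alpha>: "0 < \<alpha>" "\<alpha> < 1"
  shows "assouad_admissible \<alpha> q E"
proof -
  have "Inf {s. assouad_admissible \<alpha> s E} < q"
    using upper_assouad_spectrum_le_quasi [OF E \<alpha>] q by (simp add: upper_assouad_spectrum_alt)
  moreover have "{s. assouad_admissible \<alpha> s E} \<noteq> {}" using assouad_admissible_DIM [of \<alpha> E] \<alpha> by auto
  ultimately obtain s where s: "s \<in> {s. assouad_admissible \<alpha> s E}" "s < q"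
    by (metis cInf_lessD)
  show ?thesis by (rule assouad_admissible_mono [of \<alpha> s]) (use s in auto)
qed

text \<open>
  The bound has the form in which it is used for large balls.  For every pair \<open>\<Delta> \<le> R\<close> it gives up a factor
  \<open>(1 / \<Delta>) powr \<eta>\<close>, and \<open>R\<close> enters only with the smaller exponent \<open>\<kappa>\<close>.  The spectrum with
  parameter \<open>\<alpha>\<close> close to \<open>1\<close> covers the pairs with \<open>\<Delta> \<le> R powr (1 / \<alpha>)\<close> and \<open>R < 1\<close>.  If \<open>R\<close> is
  closer to \<open>\<Delta>\<close>, it is enlarged to \<open>\<Delta> powr \<alpha>\<close>, and the larger ball still needs only a number of
  sets of order \<open>(1 / \<Delta>) powr \<eta>\<close>.  If \<open>R\<close> is at least \<open>1 / 2\<close>, all of \<open>E\<close> is covered by finitely many balls of radius \<open>1 / 2\<close>.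
\<close>

lemma quasi_assouad_cover:
  fixes E :: "'a::euclidean_space set"
  assumes E: "E \<noteq> {}" "bounded E" and q: "quasi_assouad_dim E < q" "0 < q" and \<kappa>: "0 \<le> \<kappa>" "\<kappa> \<le> q"
    and \<eta>: "0 < \<eta>"
  shows "\<exists>C>0. \<exists>\<Delta>\<^sub>0>0. \<Delta>\<^sub>0 \<le> 1 \<and> (\<forall>\<Delta> R. \<forall>x\<in>E. 0 < \<Delta> \<and> \<Delta> \<le> \<Delta>\<^sub>0 \<and> \<Delta> \<le> R \<longrightarrow>
           (\<exists>\<U>. finite \<U> \<and> real (card \<U>) \<le> C * R powr \<kappa> * \<Delta> powr (- q - \<eta>) \<and>
                 ball x R \<inter> E \<subseteq> \<Union>\<U> \<and> (\<forall>U\<in>\<U>. bounded U \<and> diameter U = \<Delta>)))"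
proof -
  \<comment> \<open>The exponent lost in the range \<open>R < \<Delta> powr \<alpha>\<close> is \<open>(1 - \<alpha>) * q\<close>.\<close>
  define \<alpha> where "\<alpha> = max (1 / 2) (1 - \<eta> / q)"
  have "1 - \<alpha> \<le> \<eta> / q" by (simp add: \<alpha>_def)
  then have "(1 - \<alpha>) * q \<le> \<eta>" using q(2) by (simp add: pos_le_divide_eq)
  moreover have "0 < \<alpha>" "\<alpha> < 1" using q(2) \<eta> by (auto simp: \<alpha>_def)
  ultimately have \<alpha>: "0 < \<alpha>" "\<alpha> < 1" "(1 - \<alpha>) * q \<le> \<eta>" by auto
  from quasi_assouad_admissible [OF E(1) q(1) \<alpha>(1,2)] obtain C where C0: "C > 0" and C1: "\<forall>r R. \<forall>x\<in>E. 0 < r \<and> r \<le> R powr (1 / \<alpha>) \<and>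
      R powr (1 / \<alpha>) < R \<and> R < 1 \<longrightarrow> real (covering_number r (ball x R \<inter> E)) \<le> C * (R / r) powr q"
    unfolding assouad_admissible_def by (elim exE conjE)
  have C2: "real (covering_number r (ball x R \<inter> E)) \<le> C * (R / r) powr q"
    if "x \<in> E" "0 < r" "r \<le> R powr (1 / \<alpha>)" "R powr (1 / \<alpha>) < R" "R < 1" for r R x
    using C1 [rule_format, OF that(1), of r R] that by simp
  note C = C0 C2
  obtain Z where Z: "finite Z" "Z \<subseteq> E" "E \<subseteq> (\<Union>x\<in>Z. ball x (1 / 2))"
    using bounded_finite_net [OF E(2), of "1 / 2"] by auto
  \<comment> \<open>For \<open>\<Delta>\<close> up to this value the pair \<open>\<Delta>\<close> and \<open>R = 1 / 2\<close> is admissible.\<close>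
  define \<Delta>\<^sub>0 :: real where "\<Delta>\<^sub>0 = (1 / 2) powr (1 / \<alpha>)"
  have D0: "0 < \<Delta>\<^sub>0" "\<Delta>\<^sub>0 \<le> 1" using \<alpha> by (auto simp: \<Delta>\<^sub>0_def powr_le1)
  define C' where "C' = C + real (card Z) * C * 2 powr \<kappa>"
  have C': "C' > 0" "C \<le> C'" "real (card Z) * C * 2 powr \<kappa> \<le> C'"
    using C(1) by (auto simp: C'_def intro!: add_pos_nonneg)
  have powr_less: "R powr (1 / \<alpha>) < R" if "0 < R" "R < 1" for R
  proof -
    have "R powr (1 / \<alpha>) < R powr 1" using that \<alpha> by (intro powr_less_mono') auto
    then show ?thesis using that by simp
  qed
  have main: "\<exists>\<U>. finite \<U> \<and> real (card \<U>) \<le> C' * R powr \<kappa> * \<Delta> powr (- q - \<eta>) \<and>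
                 ball x R \<inter> E \<subseteq> \<Union>\<U> \<and> (\<forall>U\<in>\<U>. bounded U \<and> diameter U = \<Delta>)"
    if x: "x \<in> E" and \<Delta>: "0 < \<Delta> \<and> \<Delta> \<le> \<Delta>\<^sub>0 \<and> \<Delta> \<le> R" for \<Delta> R x
  proof -
    have D: "0 < \<Delta>" "\<Delta> \<le> \<Delta>\<^sub>0" "\<Delta> \<le> R" "0 < R" "\<Delta> \<le> 1" using \<Delta> D0 by auto
    let ?G = "\<lambda>F. \<exists>\<U>. finite \<U> \<and> real (card \<U>) \<le> C' * R powr \<kappa> * \<Delta> powr (- q - \<eta>) \<and>
                 F \<subseteq> \<Union>\<U> \<and> (\<forall>U\<in>\<U>. bounded U \<and> diameter U = \<Delta>)"
    have via: "?G F" if F: "bounded F" "real (covering_number \<Delta> F) \<le> C' * R powr \<kappa> * \<Delta> powr (- q - \<eta>)" for F :: "'a set"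
      using covering_number_cover [OF D(1) F(1)] F(2) by metis
    have De: "1 \<le> \<Delta> powr (- \<eta>)"
      using D \<eta> powr_mono' [of "- \<eta>" 0 \<Delta>] by simp
    have split: "\<Delta> powr (- q) * \<Delta> powr (- \<eta>) = \<Delta> powr (- q - \<eta>)" by (simp flip: powr_add)
    consider (small) "R < 1 / 2" "\<Delta> \<le> R powr (1 / \<alpha>)" | (mid) "R < 1 / 2" "R powr (1 / \<alpha>) < \<Delta>" | (large) "1 / 2 \<le> R"
      by linarith
    then show "?G (ball x R \<inter> E)"
    proof cases
      case small
      have "real (covering_number \<Delta> (ball x R \<inter> E)) \<le> C * (R / \<Delta>) powr q"
        using small D powr_less [of R] by (intro C(2) x) auto
      also have "(R / \<Delta>) powr q = R powr q * \<Delta> powr (- q)" using D by (simp add: powr_divide powr_minus_divide)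
      also have "C * (R powr q * \<Delta> powr (- q)) \<le> C' * (R powr \<kappa> * \<Delta> powr (- q - \<eta>))"
      proof (intro mult_mono)
        show "R powr q \<le> R powr \<kappa>" using small D \<kappa> by (intro powr_mono') auto
        show "\<Delta> powr (- q) \<le> \<Delta> powr (- q - \<eta>)" using D \<eta> by (intro powr_mono') auto
      qed (use C(1) C' in auto)
      finally show ?thesis by (intro via) (auto simp: mult_ac bounded_Int)
    next
      case mid
      define R' where "R' = \<Delta> powr \<alpha>"
      have R'D: "R' powr (1 / \<alpha>) = \<Delta>" using \<alpha> D by (simp add: R'_def powr_powr)
      have "R = (R powr (1 / \<alpha>)) powr \<alpha>" using \<alpha> D by (simp add: powr_powr)
      also have "\<dots> \<le> R'" unfolding R'_def using mid \<alpha> by (intro powr_mono2) auto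
      finally have RR': "R \<le> R'" .
      have "R' \<le> \<Delta>\<^sub>0 powr \<alpha>" unfolding R'_def using D \<alpha> by (intro powr_mono2) auto
      also have "\<dots> = 1 / 2" using \<alpha> by (simp add: \<Delta>\<^sub>0_def powr_powr)
      finally have R': "0 < R'" "R' < 1" using D by (auto simp: R'_def)
      have "real (covering_number \<Delta> (ball x R' \<inter> E)) \<le> C * (R' / \<Delta>) powr q"
        using D R' powr_less [of R'] R'D by (intro C(2) x) auto
      also have "(R' / \<Delta>) powr q = \<Delta> powr (- ((1 - \<alpha>) * q))"
      proof -
        have "R' / \<Delta> = \<Delta> powr (\<alpha> - 1)" using D by (simp add: R'_def powr_diff)
        then show ?thesis by (simp add: powr_powr algebra_simps)
      qed
      also have "\<dots> \<le> \<Delta> powr (- \<eta>)" using D \<alpha>(3) by (intro powr_mono') auto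
      also have "\<Delta> powr (- \<eta>) \<le> R powr \<kappa> * \<Delta> powr (- q - \<eta>)"
      proof -
        have "\<Delta> powr q \<le> \<Delta> powr \<kappa>" using D \<kappa> by (intro powr_mono') auto
        also have "\<dots> \<le> R powr \<kappa>" using D \<kappa> by (intro powr_mono2) auto
        finally have "\<Delta> powr q * \<Delta> powr (- q - \<eta>) \<le> R powr \<kappa> * \<Delta> powr (- q - \<eta>)"
          by (rule mult_right_mono) simp
        then show ?thesis by (simp flip: powr_add)
      qed
      also have "C * (R powr \<kappa> * \<Delta> powr (- q - \<eta>)) \<le> C' * (R powr \<kappa> * \<Delta> powr (- q - \<eta>))"
        using C' by (intro mult_right_mono) auto
      finally have "?G (ball x R' \<inter> E)"
        using C(1) by (intro via) (auto simp: mult_ac bounded_Int mult_left_mono)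
      then obtain \<U> where "finite \<U>" "real (card \<U>) \<le> C' * R powr \<kappa> * \<Delta> powr (- q - \<eta>)"
          "ball x R' \<inter> E \<subseteq> \<Union>\<U>" "\<forall>U\<in>\<U>. bounded U \<and> diameter U = \<Delta>" by (elim exE conjE)
      moreover have "ball x R \<inter> E \<subseteq> ball x R' \<inter> E" using RR' by auto
      ultimately show ?thesis by (intro exI [of _ \<U>]) auto
    next
      case large
      have half: "\<exists>\<U>. finite \<U> \<and> real (card \<U>) \<le> C * \<Delta> powr (- q) \<and> ball z (1 / 2) \<inter> E \<subseteq> \<Union>\<U> \<and>
             (\<forall>U\<in>\<U>. bounded U \<and> diameter U = \<Delta>)" if z: "z \<in> Z" for z
      proof -
        have "real (covering_number \<Delta> (ball z (1 / 2) \<inter> E)) \<le> C * ((1 / 2) / \<Delta>) powr q"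
          using D powr_less [of "1 / 2"] z Z(2) by (intro C(2)) (auto simp: \<Delta>\<^sub>0_def)
        also have "\<dots> \<le> C * (1 / \<Delta>) powr q"
          using D q C(1) by (intro mult_left_mono powr_mono2) (auto simp: field_simps)
        also have "(1 / \<Delta>) powr q = \<Delta> powr (- q)" using D by (simp add: powr_divide powr_minus_divide)
        finally show ?thesis
          using covering_number_cover [OF D(1), of "ball z (1 / 2) \<inter> E"] by (metis bounded_Int bounded_ball)
      qed
      obtain U where U: "\<And>z. z \<in> Z \<Longrightarrow> finite (U z)" "\<And>z. z \<in> Z \<Longrightarrow> real (card (U z)) \<le> C * \<Delta> powr (- q)"
          "\<And>z. z \<in> Z \<Longrightarrow> ball z (1 / 2) \<inter> E \<subseteq> \<Union>(U z)" "\<And>z A. z \<in> Z \<Longrightarrow> A \<in> U z \<Longrightarrow> bounded A \<and> diameter A = \<Delta>"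
        using half by metis
      have "real (card (\<Union>z\<in>Z. U z)) \<le> real (\<Sum>z\<in>Z. card (U z))"
        using card_UN_le [OF Z(1), of U] by (simp only: of_nat_le_iff)
      also have "\<dots> \<le> (\<Sum>z\<in>Z. C * \<Delta> powr (- q))" unfolding of_nat_sum by (intro sum_mono U(2))
      also have "\<dots> = real (card Z) * C * \<Delta> powr (- q)" by simp
      also have "\<dots> \<le> real (card Z) * C * ((2 * R) powr \<kappa> * (\<Delta> powr (- q) * \<Delta> powr (- \<eta>)))"
      proof (rule mult_left_mono)
        have "1 \<le> (2 * R) powr \<kappa>" using large \<kappa> by (simp add: ge_one_powr_ge_zero)
        then have "1 * (\<Delta> powr (- q) * 1) \<le> (2 * R) powr \<kappa> * (\<Delta> powr (- q) * \<Delta> powr (- \<eta>))"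
          using De by (intro mult_mono) auto
        then show "\<Delta> powr (- q) \<le> (2 * R) powr \<kappa> * (\<Delta> powr (- q) * \<Delta> powr (- \<eta>))" by simp
      qed (use C(1) in simp)
      also have "\<dots> = real (card Z) * C * 2 powr \<kappa> * (R powr \<kappa> * \<Delta> powr (- q - \<eta>))"
        using D by (simp add: split powr_mult)
      also have "\<dots> \<le> C' * (R powr \<kappa> * \<Delta> powr (- q - \<eta>))" using C'(3) by (intro mult_right_mono) auto
      finally have 1: "real (card (\<Union>z\<in>Z. U z)) \<le> C' * R powr \<kappa> * \<Delta> powr (- q - \<eta>)" by (simp add: mult_ac)
      have 2: "ball x R \<inter> E \<subseteq> \<Union>(\<Union>z\<in>Z. U z)" using Z(3) U(3) by blast
      have 3: "finite (\<Union>z\<in>Z. U z)" using Z(1) U(1) by blast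
      have 4: "\<forall>A\<in>(\<Union>z\<in>Z. U z). bounded A \<and> diameter A = \<Delta>" using U(4) by blast
      show ?thesis using 1 2 3 4 by (intro exI [of _ "\<Union>z\<in>Z. U z"] conjI)
    qed
  qed
  show ?thesis
    by (rule exI [of _ C'], rule conjI [OF C'(1)], rule exI [of _ \<Delta>\<^sub>0], intro conjI D0 allI ballI impI)
       (rule main)
qed

text \<open>
  With exponent \<open>0\<close> on the radius of a ball that contains \<open>E\<close>, the preceding bound is a box-counting bound.
\<close>

lemma upper_coverable_quasi_assouad:
  fixes E :: "'a::euclidean_space set"
  assumes E: "E \<noteq> {}" "bounded E" and \<theta>: "0 < \<theta>" "\<theta> \<le> 1" and s: "quasi_assouad_dim E < s" "0 < s"
  shows "upper_coverable \<theta> s E"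
proof -
  define q where "q = (max 0 (quasi_assouad_dim E) + s) / 2"
  have q: "quasi_assouad_dim E < q" "0 < q" "q < s" using s by (auto simp: q_def)
  define \<eta> where "\<eta> = (s - q) / 2"
  have \<eta>: "0 < \<eta>" "q + \<eta> < s" using q by (auto simp: \<eta>_def field_simps)
  from quasi_assouad_cover [OF E q(1,2) order_refl less_imp_le [OF q(2)] \<eta>(1)]
  obtain C \<Delta>\<^sub>0 where D0: "0 < \<Delta>\<^sub>0" "\<Delta>\<^sub>0 \<le> 1"
    and C: "\<forall>\<Delta> R. \<forall>x\<in>E. 0 < \<Delta> \<and> \<Delta> \<le> \<Delta>\<^sub>0 \<and> \<Delta> \<le> R \<longrightarrow>
           (\<exists>\<U>. finite \<U> \<and> real (card \<U>) \<le> C * R powr 0 * \<Delta> powr (- q - \<eta>) \<and>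
                 ball x R \<inter> E \<subseteq> \<Union>\<U> \<and> (\<forall>U\<in>\<U>. bounded U \<and> diameter U = \<Delta>))"
    by (elim exE conjE)
  obtain x where x: "x \<in> E" using E by blast
  obtain B where B: "B > 0" "E \<subseteq> ball x B" using bounded_subset_ballD [OF E(2)] by blast
  show ?thesis
  proof (rule upper_coverable_of_box_count [OF \<theta> _ \<eta>(2) D0(1)])
    show "0 \<le> s" using s by simp
    fix \<delta> assume \<delta>: "0 < \<delta>" "\<delta> \<le> \<Delta>\<^sub>0"
    have BE: "ball x (max 1 B) \<inter> E = E" using B by auto
    have "\<delta> \<le> max 1 B" using \<delta> D0(2) by simp
    from C [rule_format, OF x conjI [OF \<delta>(1) conjI [OF \<delta>(2) this]]] show "\<exists>\<U>. finite \<U> \<and> real (card \<U>) \<le> C * \<delta> powr - (q + \<eta>) \<and>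
        E \<subseteq> \<Union>\<U> \<and> (\<forall>U\<in>\<U>. bounded U \<and> diameter U = \<delta>)"
      unfolding BE by (simp add: max_def split: if_splits)
  qed
qed

section \<open>Random projections\<close>

lemma orth_proj_pythagoras:
  assumes "subspace V"
  shows "(norm x)\<^sup>2 = (norm (orth_proj V x))\<^sup>2 + (norm (x - orth_proj V x))\<^sup>2"
proof -
  have "orthogonal (orth_proj V x) (x - orth_proj V x)"
    using orth_proj(2) [OF assms orth_proj(1) [OF assms]] by (simp add: orthogonal_commute)
  from norm_add_Pythagorean [OF this] show ?thesis by simp
qed

lemma norm_orth_proj_le:
  assumes "subspace V"
  shows "norm (orth_proj V x) \<le> norm x" "norm (x - orth_proj V x) \<le> norm x"
proof -
  have "(norm (orth_proj V x))\<^sup>2 \<le> (norm x)\<^sup>2" "(norm (x - orth_proj V x))\<^sup>2 \<le> (norm x)\<^sup>2"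
    using orth_proj_pythagoras [OF assms, of x] by auto
  then show "norm (orth_proj V x) \<le> norm x" "norm (x - orth_proj V x) \<le> norm x"
    by (auto intro: power2_le_imp_le)
qed

lemma dist_orth_proj:
  assumes "subspace V"
  shows "dist (orth_proj V x) (orth_proj V y) = norm (orth_proj V (x - y))"
  using linear_diff [OF linear_orth_proj [OF assms], of x y] by (simp add: dist_norm)

lemma dist_orth_proj_le:
  assumes "subspace V"
  shows "dist (orth_proj V x) (orth_proj V y) \<le> dist x y"
  unfolding dist_orth_proj [OF assms] using norm_orth_proj_le(1) [OF assms, of "x - y"]
  by (simp only: dist_norm)

lemma bounded_orth_proj_image:
  assumes "subspace V" "bounded E"
  shows "bounded (orth_proj V ` E)"
  using assms(1)
  by (intro bounded_linear_image [OF assms(2)]) (simp add: linear_orth_proj flip: linear_conv_bounded_linear)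

lemma orth_proj_image:
  assumes g: "orthogonal_transformation g" and V: "subspace V"
  shows "orth_proj (g ` V) (g x) = g (orth_proj V x)"
proof (rule orth_proj_eqI)
  have lin: "linear g" using g by (rule orthogonal_transformation_linear)
  show "subspace (g ` V)" using linear_subspace_image [OF lin V] .
  show "g (orth_proj V x) \<in> g ` V" using orth_proj(1) [OF V] by blast
  fix v assume "v \<in> g ` V"
  then obtain y where y: "y \<in> V" "v = g y" by blast
  have "(g x - g (orth_proj V x)) \<bullet> g y = (x - orth_proj V x) \<bullet> y"
    using g by (simp add: linear_diff [OF lin, symmetric] orthogonal_transformation_def)
  then show "orthogonal (g x - g (orth_proj V x)) v"
    using orth_proj(2) [OF V y(1)] y(2) by (simp add: orthogonal_def)
qed

lemma grassmannian_image:
  fixes V :: "'a::euclidean_space set"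
  assumes g: "orthogonal_transformation g" and V: "V \<in> grassmannian m"
  shows "g ` V \<in> grassmannian m"
proof -
  have lin: "linear g" using g by (rule orthogonal_transformation_linear)
  have "inj g" using g by (rule orthogonal_transformation_inj)
  then have "dim (g ` V) = dim V"
    using dim_image_eq [OF lin] inj_on_subset by blast
  then show ?thesis using V linear_subspace_image [OF lin] by (auto simp: grassmannian_def)
qed

lemma haar_grassmannian_subspace:
  assumes "haar_grassmannian m \<gamma>" "V \<in> space \<gamma>"
  shows "subspace V" "dim V = m"
  using assms by (auto simp: haar_grassmannian_def grassmannian_def)

text \<open>
  Evaluation at a vector is continuous on bounded operators, and the measurable structure of the
  Grassmannian is pulled back from there.
\<close>

lemma measurable_orth_proj:
  fixes \<gamma> :: "'a::euclidean_space set measure"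
  assumes haar: "haar_grassmannian m \<gamma>"
  shows "(\<lambda>V. orth_proj V z) \<in> borel_measurable \<gamma>"
proof -
  have sets: "sets \<gamma> = sets (vimage_algebra (grassmannian m) orth_proj_blinfun borel)"
    using haar by (simp add: haar_grassmannian_def)
  have 1: "orth_proj_blinfun \<in> borel_measurable (vimage_algebra (grassmannian m :: 'a set set) orth_proj_blinfun borel)"
    by (rule measurable_vimage_algebra1) simp
  have 2: "(\<lambda>T. blinfun_apply T z) \<in> borel_measurable (borel :: ('a \<Rightarrow>\<^sub>L 'a) measure)"
    by (intro borel_measurable_continuous_onI continuous_intros)
  have "(\<lambda>V. blinfun_apply (orth_proj_blinfun V) z) \<in> borel_measurable \<gamma>"
    using measurable_compose [OF 1 2] measurable_cong_sets [OF sets refl] by blast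
  moreover have "(\<lambda>V. blinfun_apply (orth_proj_blinfun V) z) \<in> borel_measurable \<gamma>
      \<longleftrightarrow> (\<lambda>V. orth_proj V z) \<in> borel_measurable \<gamma>"
    using haar_grassmannian_subspace [OF haar]
    by (intro measurable_cong) (simp add: blinfun_apply_orth_proj_blinfun)
  ultimately show ?thesis by simp
qed

lemma sets_small_projection:
  assumes "haar_grassmannian m \<gamma>"
  shows "{V \<in> space \<gamma>. norm (orth_proj V z) \<le> r} \<in> sets \<gamma>"
  using measurable_orth_proj [OF assms, measurable] by measurable

text \<open>
  The projection of \<open>g z\<close> to \<open>g V\<close> is the image under \<open>g\<close> of the projection of \<open>z\<close> to \<open>V\<close>, so rotating the
  vector rotates the set of subspaces.
\<close>

lemma emeasure_small_projection_rotate: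
  fixes \<gamma> :: "'a::euclidean_space set measure"
  assumes haar: "haar_grassmannian m \<gamma>" and g: "orthogonal_transformation g"
  shows "emeasure \<gamma> {V \<in> space \<gamma>. norm (orth_proj V (g z)) \<le> r}
       = emeasure \<gamma> {V \<in> space \<gamma>. norm (orth_proj V z) \<le> r}"
proof -
  have sp: "space \<gamma> = grassmannian m" using haar by (simp add: haar_grassmannian_def)
  have "bij g" using g by (rule orthogonal_transformation_bij)
  have inv: "orthogonal_transformation (inv g)" using g by (rule orthogonal_transformation_inv)
  have ng: "norm (g y) = norm y" for y using g by (rule orthogonal_transformation_norm)
  have "{V \<in> space \<gamma>. norm (orth_proj V (g z)) \<le> r}
      = (\<lambda>V. g ` V) ` {V \<in> space \<gamma>. norm (orth_proj V z) \<le> r}" (is "?A = ?B")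
  proof
    show "?B \<subseteq> ?A"
      using grassmannian_image [OF g] orth_proj_image [OF g]
      by (auto simp: sp ng) (auto simp: grassmannian_def ng)
    show "?A \<subseteq> ?B"
    proof
      fix W assume W: "W \<in> ?A"
      define V where "V = inv g ` W"
      have V: "V \<in> grassmannian m" using grassmannian_image [OF inv] W by (simp add: V_def sp)
      have gV: "g ` V = W" using \<open>bij g\<close> by (simp add: V_def image_f_inv_f bij_is_surj)
      have "norm (orth_proj V z) = norm (orth_proj W (g z))"
        using orth_proj_image [OF g, of V z] V by (simp add: gV ng grassmannian_def)
      then show "W \<in> ?B" using W V gV by (auto simp: sp)
    qed
  qed
  moreover have "emeasure \<gamma> ?B = emeasure \<gamma> {V \<in> space \<gamma>. norm (orth_proj V z) \<le> r}"
    using haar g sets_small_projection [OF haar] unfolding haar_grassmannian_def by blast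
  ultimately show ?thesis by simp
qed

lemma emeasure_small_projection_const:
  fixes \<gamma> :: "(real ^ 'd) set measure"
  assumes haar: "haar_grassmannian m \<gamma>" and "u \<noteq> 0" "v \<noteq> 0"
  shows "emeasure \<gamma> {V \<in> space \<gamma>. norm (orth_proj V u) \<le> r * norm u}
       = emeasure \<gamma> {V \<in> space \<gamma>. norm (orth_proj V v) \<le> r * norm v}"
proof -
  define c where "c = norm v / norm u"
  have c: "c > 0" using assms by (simp add: c_def)
  have "norm (c *\<^sub>R u) = norm v" using assms by (simp add: c_def)
  then obtain g where g: "orthogonal_transformation g" "g (c *\<^sub>R u) = v"
    by (rule orthogonal_transformation_exists)
  have "{V \<in> space \<gamma>. norm (orth_proj V u) \<le> r * norm u}
      = {V \<in> space \<gamma>. norm (orth_proj V (c *\<^sub>R u)) \<le> r * norm v}"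
  proof (rule Collect_cong, rule conj_cong [OF refl])
    fix V assume "V \<in> space \<gamma>"
    then have "orth_proj V (c *\<^sub>R u) = c *\<^sub>R orth_proj V u"
      using linear_orth_proj [OF haar_grassmannian_subspace(1) [OF haar]] by (simp add: linear_scale)
    moreover have rv: "r * norm v = c * (r * norm u)" using assms by (simp add: c_def)
    ultimately show "norm (orth_proj V u) \<le> r * norm u \<longleftrightarrow> norm (orth_proj V (c *\<^sub>R u)) \<le> r * norm v"
      unfolding rv using c by simp
  qed
  then show ?thesis using emeasure_small_projection_rotate [OF haar g(1), of "c *\<^sub>R u"] by (simp add: g(2))
qed

text \<open>
  The component of such a vector \<open>u\<close> orthogonal to \<open>V\<close> lies in the unit ball of a space of codimension
  \<open>dim V\<close>, which is covered by a number of \<open>r\<close>-balls of order \<open>(1 / r) ^ (DIM('a) - dim V)\<close>.  Doubling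
  their radii absorbs the component in \<open>V\<close>, and each ball has volume of order \<open>r ^ DIM('a)\<close>.
\<close>

lemma emeasure_slab_le:
  fixes V :: "'a::euclidean_space set"
  assumes V: "subspace V" and r: "0 < r" "r \<le> 1"
  shows "emeasure lborel {u \<in> cball 0 1. norm (orth_proj V u) \<le> r}
       \<le> ennreal (real (2 * DIM('a) + 5) ^ DIM('a) * (unit_ball_vol DIM('a) * 2 ^ DIM('a)) * r ^ dim V)"
proof -
  define W where "W = {y \<in> UNIV. \<forall>x\<in>V. orthogonal x y}"
  have W: "subspace W" using subspace_orthogonal_to_vectors [of V] by (simp add: W_def)
  have dimW: "dim W + dim V = DIM('a)"
    unfolding W_def using dim_subspace_orthogonal_to_vectors [OF V subspace_UNIV] by simp
  obtain Y where Y: "finite Y" "real (card Y) \<le> (real (2 * dim W + 5) * (1 / r)) ^ dim W"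
      "W \<inter> cball 0 1 \<subseteq> (\<Union>y\<in>Y. cball y r)"
    using subspace_cball_cover [OF W r] by blast
  have "{u \<in> cball 0 1. norm (orth_proj V u) \<le> r} \<subseteq> (\<Union>y\<in>Y. cball y (2 * r))"
  proof safe
    fix u :: 'a assume u: "u \<in> cball 0 1" "norm (orth_proj V u) \<le> r"
    have "u - orth_proj V u \<in> W"
      using orth_proj(2) [OF V, of _ u] by (auto simp: W_def orthogonal_commute)
    moreover have "norm (u - orth_proj V u) \<le> 1" using norm_orth_proj_le [OF V, of u] u by simp
    ultimately obtain y where y: "y \<in> Y" "dist y (u - orth_proj V u) \<le> r" using Y(3) by fastforce
    have "dist y u \<le> dist y (u - orth_proj V u) + dist (u - orth_proj V u) u" by (rule dist_triangle)
    also have "dist (u - orth_proj V u) u = norm (orth_proj V u)" by (simp add: dist_norm)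
    finally have "dist y u \<le> 2 * r" using y(2) u(2) by linarith
    then show "u \<in> (\<Union>y\<in>Y. cball y (2 * r))" using y(1) by auto
  qed
  then have "emeasure lborel {u \<in> cball 0 1. norm (orth_proj V u) \<le> r}
      \<le> emeasure lborel (\<Union>y\<in>Y. cball y (2 * r))"
    using Y(1) by (intro emeasure_mono) (auto intro!: sets.finite_UN)
  also have "\<dots> \<le> (\<Sum>y\<in>Y. emeasure lborel (cball y (2 * r)))"
    using Y(1) by (intro emeasure_subadditive_finite) auto
  also have "\<dots> = (\<Sum>y\<in>Y. ennreal (unit_ball_vol DIM('a) * (2 * r) ^ DIM('a)))"
    using r by (intro sum.cong) (auto simp: emeasure_cball)
  also have "\<dots> = ennreal (real (card Y) * (unit_ball_vol DIM('a) * (2 * r) ^ DIM('a)))"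
    using r by (simp add: ennreal_mult ennreal_of_nat_eq_real_of_nat)
  also have "\<dots> \<le> ennreal (real (2 * DIM('a) + 5) ^ DIM('a) * (unit_ball_vol DIM('a) * 2 ^ DIM('a)) * r ^ dim V)"
  proof (rule ennreal_leI)
    have "real (card Y) \<le> (real (2 * dim W + 5) * (1 / r)) ^ dim W" by (rule Y(2))
    also have "\<dots> = real (2 * dim W + 5) ^ dim W * (1 / r) ^ dim W" by (rule power_mult_distrib)
    also have "real (2 * dim W + 5) ^ dim W \<le> real (2 * DIM('a) + 5) ^ DIM('a)"
      using dimW by (intro order_trans [OF power_mono power_increasing]) auto
    finally have "real (card Y) \<le> real (2 * DIM('a) + 5) ^ DIM('a) * (1 / r) ^ dim W"
      using r by (simp add: mult_right_mono)
    then have "real (card Y) * (unit_ball_vol DIM('a) * (2 * r) ^ DIM('a))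
       \<le> real (2 * DIM('a) + 5) ^ DIM('a) * (1 / r) ^ dim W * (unit_ball_vol DIM('a) * (2 * r) ^ DIM('a))"
      using r by (intro mult_right_mono) auto
    also have "\<dots> = real (2 * DIM('a) + 5) ^ DIM('a) * (unit_ball_vol DIM('a) * 2 ^ DIM('a))
                   * ((1 / r) ^ dim W * r ^ DIM('a))"
      by (simp add: power_mult_distrib)
    also have "(1 / r) ^ dim W * r ^ DIM('a) = r ^ dim V"
      using r by (simp add: dimW [symmetric] power_add power_divide)
    finally show "real (card Y) * (unit_ball_vol DIM('a) * (2 * r) ^ DIM('a))
       \<le> real (2 * DIM('a) + 5) ^ DIM('a) * (unit_ball_vol DIM('a) * 2 ^ DIM('a)) * r ^ dim V" .
  qed
  finally show ?thesis .
qed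

text \<open>
  By invariance the probability that \<open>norm (P\<^sub>V u) \<le> r * norm u\<close> is the same for all \<open>u \<noteq> 0\<close>.  It can be
  averaged over \<open>u\<close> in the unit ball with respect to Lebesgue measure, and after exchanging the
  integrals the slab estimate applies to each fixed \<open>V\<close>.
\<close>

lemma prob_small_projection_le:
  fixes \<gamma> :: "(real ^ 'd) set measure"
  assumes haar: "haar_grassmannian m \<gamma>"
  shows "\<exists>C>0. \<forall>z r. 0 < r \<and> r \<le> norm z \<longrightarrow>
           measure \<gamma> {V \<in> space \<gamma>. norm (orth_proj V z) \<le> r} \<le> C * (r / norm z) ^ m"
proof -
  define d where "d = DIM(real ^ 'd)"
  define C where "C = real (2 * d + 5) ^ d * (unit_ball_vol d * 2 ^ d)"
  have vol: "unit_ball_vol d > 0" by simp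
  have C: "C > 0" by (simp add: C_def)
  interpret prob_space \<gamma> using haar by (simp add: haar_grassmannian_def)
  interpret pair_sigma_finite "lborel :: (real ^ 'd) measure" \<gamma> ..
  have main: "measure \<gamma> {V \<in> space \<gamma>. norm (orth_proj V v) \<le> r * norm v} \<le> C / unit_ball_vol d * r ^ m"
    if v: "v \<noteq> 0" and r: "0 < r" "r \<le> 1" for v r
  proof -
    define p where "p = measure \<gamma> {V \<in> space \<gamma>. norm (orth_proj V v) \<le> r * norm v}"
    \<comment> \<open>Expanding \<open>u\<close> in coordinates makes the projection jointly measurable in \<open>u\<close> and \<open>V\<close>.\<close>
    define q where "q u V = (\<Sum>b\<in>Basis. (u \<bullet> b) *\<^sub>R orth_proj V b)" for u :: "real ^ 'd" and V
    have q: "q u V = orth_proj V u" if "V \<in> space \<gamma>" for u V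
    proof -
      have lin: "linear (orth_proj V)" using linear_orth_proj haar_grassmannian_subspace(1) [OF haar that] by blast
      have "orth_proj V u = orth_proj V (\<Sum>b\<in>Basis. (u \<bullet> b) *\<^sub>R b)" by (simp add: euclidean_representation)
      also have "\<dots> = q u V" by (simp add: q_def linear_sum [OF lin] linear_scale [OF lin])
      finally show ?thesis by simp
    qed
    define h :: "real ^ 'd \<Rightarrow> (real ^ 'd) set \<Rightarrow> ennreal"
      where "h u V = (if norm (q u V) \<le> r * norm u \<and> norm u \<le> 1 then 1 else 0)" for u V
    have [measurable]: "(\<lambda>V. orth_proj V b) \<in> borel_measurable \<gamma>" for b
      by (rule measurable_orth_proj [OF haar])
    have h: "case_prod h \<in> borel_measurable (lborel \<Otimes>\<^sub>M \<gamma>)"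
      unfolding h_def q_def by measurable
    have inner: "(\<integral>\<^sup>+V. h u V \<partial>\<gamma>) = ennreal p * indicator (cball 0 1) u" if "u \<noteq> 0" for u
    proof -
      have "(\<integral>\<^sup>+V. h u V \<partial>\<gamma>) = (\<integral>\<^sup>+V. indicator {V \<in> space \<gamma>. norm (orth_proj V u) \<le> r * norm u} V
              * indicator (cball 0 1) u \<partial>\<gamma>)"
        by (intro nn_integral_cong) (auto simp: h_def q indicator_def)
      also have "\<dots> = emeasure \<gamma> {V \<in> space \<gamma>. norm (orth_proj V u) \<le> r * norm u} * indicator (cball 0 1) u"
        using sets_small_projection [OF haar] by (subst nn_integral_multc) auto
      also have "emeasure \<gamma> {V \<in> space \<gamma>. norm (orth_proj V u) \<le> r * norm u} = ennreal p"
        unfolding p_def emeasure_small_projection_const [OF haar that v] by (rule emeasure_eq_measure)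
      finally show ?thesis .
    qed
    have "AE u in lborel. u \<noteq> (0 :: real ^ 'd)" by (rule AE_lborel_singleton)
    then have "AE u in lborel. (\<integral>\<^sup>+V. h u V \<partial>\<gamma>) = ennreal p * indicator (cball 0 1) u"
      by eventually_elim (rule inner)
    then have "(\<integral>\<^sup>+u. \<integral>\<^sup>+V. h u V \<partial>\<gamma> \<partial>lborel) = (\<integral>\<^sup>+(u :: real ^ 'd). ennreal p * indicator (cball 0 1) u \<partial>lborel)"
      by (rule nn_integral_cong_AE)
    also have "\<dots> = ennreal p * emeasure lborel (cball 0 1 :: (real ^ 'd) set)"
      by (rule nn_integral_cmult_indicator) simp
    also have "\<dots> = ennreal (p * unit_ball_vol d)"
      by (simp add: emeasure_cball d_def ennreal_mult p_def)
    finally have 1: "(\<integral>\<^sup>+u. \<integral>\<^sup>+V. h u V \<partial>\<gamma> \<partial>lborel) = ennreal (p * unit_ball_vol d)" .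
    have "(\<integral>\<^sup>+u. \<integral>\<^sup>+V. h u V \<partial>\<gamma> \<partial>lborel) = (\<integral>\<^sup>+V. \<integral>\<^sup>+u. h u V \<partial>lborel \<partial>\<gamma>)"
      using Fubini [OF h] by simp
    also have "\<dots> \<le> (\<integral>\<^sup>+V. ennreal (C * r ^ m) \<partial>\<gamma>)"
    proof (rule nn_integral_mono)
      fix V assume V: "V \<in> space \<gamma>"
      note sub = haar_grassmannian_subspace [OF haar V]
      have cl: "{u \<in> cball 0 1. norm (orth_proj V u) \<le> r} \<in> sets borel"
      proof -
        have "continuous_on UNIV (orth_proj V)"
          using linear_orth_proj [OF sub(1)] by (simp add: linear_continuous_on linear_conv_bounded_linear)
        then have [measurable]: "orth_proj V \<in> borel_measurable borel" by (rule borel_measurable_continuous_onI)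
        show ?thesis by measurable
      qed
      have "(\<integral>\<^sup>+u. h u V \<partial>lborel) \<le> (\<integral>\<^sup>+u. indicator {u \<in> cball 0 1. norm (orth_proj V u) \<le> r} u \<partial>lborel)"
      proof (rule nn_integral_mono)
        fix u :: "real ^ 'd"
        have "norm (orth_proj V u) \<le> r" if "norm u \<le> 1" "norm (orth_proj V u) \<le> r * norm u"
          using that r mult_left_le [of "norm u" r] by linarith
        then show "h u V \<le> indicator {u \<in> cball 0 1. norm (orth_proj V u) \<le> r} u"
          using r by (auto simp: h_def q [OF V] indicator_def)
      qed
      also have "\<dots> = emeasure lborel {u \<in> cball 0 1. norm (orth_proj V u) \<le> r}"
        using cl by simp
      also have "\<dots> \<le> ennreal (C * r ^ m)"
        using emeasure_slab_le [OF sub(1) r] by (simp only: C_def d_def sub(2))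
      finally show "(\<integral>\<^sup>+u. h u V \<partial>lborel) \<le> ennreal (C * r ^ m)" .
    qed
    also have "\<dots> = ennreal (C * r ^ m)" by (simp add: emeasure_space_1)
    finally have "ennreal (p * unit_ball_vol d) \<le> ennreal (C * r ^ m)" using 1 by simp
    then have "p * unit_ball_vol d \<le> C * r ^ m" using C r by (subst (asm) ennreal_le_iff) auto
    then show ?thesis using vol by (simp add: p_def field_simps)
  qed
  show ?thesis
  proof (intro exI conjI allI impI)
    show "C / unit_ball_vol d > 0" using C by simp
    fix z :: "real ^ 'd" and r assume r: "0 < r \<and> r \<le> norm z"
    then have "z \<noteq> 0" by auto
    then show "measure \<gamma> {V \<in> space \<gamma>. norm (orth_proj V z) \<le> r} \<le> C / unit_ball_vol d * (r / norm z) ^ m"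
      using main [of z "r / norm z"] r by simp
  qed
qed

section \<open>Weights of Frostman type\<close>

text \<open>
  The points receive their weights one after the other, each as much as the constraints still allow.  At
  that moment some constraint through the point becomes tight, and it remains so because later points do
  not lower weights.
\<close>

lemma greedy_weights:
  fixes L :: "'c \<Rightarrow> real"
  assumes "finite X" and K: "finite K" and L: "\<And>c. c \<in> K \<Longrightarrow> 0 \<le> L c"
    and "\<And>x. x \<in> X \<Longrightarrow> \<exists>c\<in>K. x \<in> A c"
  shows "\<exists>w. (\<forall>x. 0 \<le> w x) \<and> (\<forall>c\<in>K. sum w (X \<inter> A c) \<le> L c) \<and>
             (\<forall>x\<in>X. \<exists>c\<in>K. x \<in> A c \<and> sum w (X \<inter> A c) = L c)"
  using assms(1,4)
proof (induction X)
  case empty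
  show ?case using L by (intro exI [of _ "\<lambda>_. 0"]) auto
next
  case (insert x X)
  have "\<exists>w. (\<forall>x. 0 \<le> w x) \<and> (\<forall>c\<in>K. sum w (X \<inter> A c) \<le> L c) \<and>
             (\<forall>x\<in>X. \<exists>c\<in>K. x \<in> A c \<and> sum w (X \<inter> A c) = L c)"
    by (rule insert.IH) (simp add: insert.prems)
  then obtain w where w: "\<And>x. 0 \<le> w x" "\<And>c. c \<in> K \<Longrightarrow> sum w (X \<inter> A c) \<le> L c"
      "\<And>x. x \<in> X \<Longrightarrow> \<exists>c\<in>K. x \<in> A c \<and> sum w (X \<inter> A c) = L c" by blast
  define S where "S = (\<lambda>c. L c - sum w (X \<inter> A c)) ` {c \<in> K. x \<in> A c}"
  have S: "finite S" "S \<noteq> {}" using K insert.prems by (auto simp: S_def)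
  define m where "m = Min S"
  have m0: "m \<ge> 0" using S w(2) by (auto simp: m_def S_def)
  have m_le: "m \<le> L c - sum w (X \<inter> A c)" if "c \<in> K" "x \<in> A c" for c
    using S that unfolding m_def by (intro Min_le) (auto simp: S_def)
  have "m \<in> S" unfolding m_def using S by (rule Min_in)
  then obtain c0 where c0: "c0 \<in> K" "x \<in> A c0" "m = L c0 - sum w (X \<inter> A c0)"
    by (auto simp: S_def)
  define w' where "w' = w(x := m)"
  have sum': "sum w' (insert x X \<inter> A c) = sum w (X \<inter> A c) + (if x \<in> A c then m else 0)" for c
  proof -
    have "sum w' (X \<inter> A c) = sum w (X \<inter> A c)"
      using insert.hyps by (intro sum.cong) (auto simp: w'_def)
    then show ?thesis using insert.hyps by (auto simp: w'_def)
  qed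
  show ?case
  proof (intro exI [of _ w'] conjI allI ballI)
    show "0 \<le> w' y" for y using w(1) m0 by (auto simp: w'_def)
    show le: "sum w' (insert x X \<inter> A c) \<le> L c" if "c \<in> K" for c
      using m_le [OF that] w(2) [OF that] by (auto simp: sum')
    show "\<exists>c\<in>K. y \<in> A c \<and> sum w' (insert x X \<inter> A c) = L c" if y: "y \<in> insert x X" for y
    proof (cases "y = x")
      case True
      have "sum w' (insert x X \<inter> A c0) = L c0" unfolding sum' using c0 by simp
      then show ?thesis using c0 True by blast
    next
      case False
      then obtain c where c: "c \<in> K" "y \<in> A c" "sum w (X \<inter> A c) = L c" using w(3) y by auto
      have "L c \<le> sum w' (insert x X \<inter> A c)" using c m0 by (simp add: sum')
      then show ?thesis using le [OF c(1)] c by (intro bexI [of _ c]) auto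
    qed
  qed
qed

text \<open>
  Frostman's lemma in finite form.  Greedy weights with the constraint \<open>r powr t\<close> on the ball of radius \<open>r\<close>
  leave every point in a tight ball.  Vitali's covering lemma selects disjoint tight balls, so the total
  mass dominates their sum of \<open>t\<close>-th powers, while their enlargements cover.
\<close>

lemma frostman_cballs:
  fixes X :: "'a::euclidean_space set"
  assumes X: "finite X" and J: "finite J" "J \<noteq> {}" "\<And>r. r \<in> J \<Longrightarrow> 0 < r"
  shows "\<exists>w P. (\<forall>x. 0 \<le> w x) \<and> (\<forall>x\<in>X. \<forall>r\<in>J. sum w (X \<inter> cball x r) \<le> r powr t) \<and>
           P \<subseteq> X \<times> J \<and> (\<Sum>(x, r)\<in>P. r powr t) \<le> sum w X \<and> X \<subseteq> (\<Union>(x, r)\<in>P. cball x (5 * r))"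
proof -
  define A where "A c = cball (fst c) (snd c)" for c :: "'a \<times> real"
  obtain r0 where r0: "r0 \<in> J" using J by blast
  have "\<exists>w. (\<forall>x. 0 \<le> w x) \<and> (\<forall>c\<in>X \<times> J. sum w (X \<inter> A c) \<le> snd c powr t) \<and>
             (\<forall>x\<in>X. \<exists>c\<in>X \<times> J. x \<in> A c \<and> sum w (X \<inter> A c) = snd c powr t)"
  proof (rule greedy_weights)
    show "\<exists>c\<in>X \<times> J. x \<in> A c" if "x \<in> X" for x
      using that r0 J(3) [OF r0] by (intro bexI [of _ "(x, r0)"]) (auto simp: A_def)
  qed (use X J in auto)
  then obtain w where w: "\<And>x. 0 \<le> w x" "\<And>c. c\<in>X \<times> J \<Longrightarrow> sum w (X \<inter> A c) \<le> snd c powr t"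
     "\<And>x. x \<in> X \<Longrightarrow> \<exists>c\<in>X \<times> J. x \<in> A c \<and> sum w (X \<inter> A c) = snd c powr t" by blast
  define T where "T = {c \<in> X \<times> J. sum w (X \<inter> A c) = snd c powr t}"
  have finT: "finite T" using X J by (auto simp: T_def)
  have TX: "X \<subseteq> (\<Union>c\<in>T. cball (fst c) (snd c))"
    using w(3) unfolding T_def A_def by blast
  have TJ: "0 < snd c \<and> snd c \<le> Max J" if "c \<in> T" for c using that J by (auto simp: T_def)
  obtain C where C: "C \<subseteq> T"
     "pairwise (\<lambda>i j. disjnt (cball (fst i) (snd i)) (cball (fst j) (snd j))) C"
     "X \<subseteq> (\<Union>i\<in>C. cball (fst i) (5 * snd i))"
    by (rule Vitali_covering_lemma_cballs [OF TX TJ])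
  have finC: "finite C" using C(1) finT finite_subset by blast
  have "(\<Sum>c\<in>C. snd c powr t) = (\<Sum>c\<in>C. sum w (X \<inter> A c))"
    using C(1) by (intro sum.cong) (auto simp: T_def)
  also have "\<dots> = sum w (\<Union>c\<in>C. X \<inter> A c)"
  proof (rule sum.UNION_disjoint [symmetric])
    show "\<forall>i\<in>C. \<forall>j\<in>C. i \<noteq> j \<longrightarrow> (X \<inter> A i) \<inter> (X \<inter> A j) = {}"
      using C(2) unfolding pairwise_def disjnt_def A_def by blast
  qed (use X finC in auto)
  also have "\<dots> \<le> sum w X" using X w(1) by (intro sum_mono2) auto
  finally have 1: "(\<Sum>(x, r)\<in>C. r powr t) \<le> sum w X" by (simp add: case_prod_beta)
  have 2: "X \<subseteq> (\<Union>(x, r)\<in>C. cball x (5 * r))" using C(3) by (simp add: case_prod_beta)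
  have 3: "\<forall>x\<in>X. \<forall>r\<in>J. sum w (X \<inter> cball x r) \<le> r powr t"
    using w(2) by (auto simp: A_def)
  have 4: "C \<subseteq> X \<times> J" using C(1) by (auto simp: T_def)
  show ?thesis
    by (rule exI [of _ w], rule exI [of _ C]) (use w(1) 1 2 3 4 in simp)
qed

text \<open>
  The enlarged tight balls yield a cover of \<open>E\<close>.  As cheap covers do not exist, the total mass is bounded
  below, and normalising it costs a constant.
\<close>

lemma frostman_weights:
  fixes E :: "'a::euclidean_space set"
  assumes not: "\<not> intermediate_cover \<theta> t \<delta> \<epsilon> E" and \<epsilon>: "0 < \<epsilon>"
    and \<delta>: "0 < \<delta>" "\<delta> powr (1 / \<theta>) \<le> \<delta>" and t: "0 \<le> t"
    and X: "finite X" "E \<subseteq> (\<Union>x\<in>X. cball x (\<delta> powr (1 / \<theta>)))"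
    and J: "finite J" "J \<noteq> {}" "\<And>r. r \<in> J \<Longrightarrow> \<delta> powr (1 / \<theta>) \<le> r \<and> r \<le> 2 * \<delta>"
  shows "\<exists>w. (\<forall>x. 0 \<le> w x) \<and> sum w X = 1 \<and>
           (\<forall>x\<in>X. \<forall>r\<in>J. sum w (X \<inter> cball x r) \<le> cover_const TYPE('a) 72 / \<epsilon> * r powr t)"
proof -
  define c where "c = cover_const TYPE('a) 72"
  have c: "c > 0" using cover_const_ge_1 [of 72, where ?'a = 'a] by (simp add: c_def)
  have J0: "0 < r" if "r \<in> J" for r using J(3) [OF that] \<delta> by (smt (verit) powr_gt_zero)
  obtain w P where w: "\<And>x. 0 \<le> w x" "\<And>x r. x \<in> X \<Longrightarrow> r \<in> J \<Longrightarrow> sum w (X \<inter> cball x r) \<le> r powr t"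
     and P: "P \<subseteq> X \<times> J" "(\<Sum>(x, r)\<in>P. r powr t) \<le> sum w X" "X \<subseteq> (\<Union>(x, r)\<in>P. cball x (5 * r))"
    using frostman_cballs [OF X(1) J(1,2) J0, of t] by blast
  have finP: "finite P" using P(1) X(1) J(1) by (meson finite_SigmaI finite_subset)
  have "\<epsilon> < c * (\<Sum>i\<in>P. snd i powr t)"
  proof (rule ccontr)
    assume *: "\<not> \<epsilon> < c * (\<Sum>i\<in>P. snd i powr t)"
    have "intermediate_cover \<theta> t \<delta> \<epsilon> E"
    \<comment> \<open>The factor is \<open>5\<close> from Vitali's lemma and \<open>1\<close> for passing from the net to \<open>E\<close>.\<close>
    proof (rule intermediate_cover_from_cballs [where K = 6 and I = P and x = fst and u = snd])
      show "E \<subseteq> (\<Union>i\<in>P. cball (fst i) (6 * snd i))"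
      proof
        fix z assume "z \<in> E"
        then obtain x where x: "x \<in> X" "dist x z \<le> \<delta> powr (1 / \<theta>)" using X(2) by auto
        then obtain i where i: "i \<in> P" "dist (fst i) x \<le> 5 * snd i" using P(3) by fastforce
        then have "\<delta> powr (1 / \<theta>) \<le> snd i" using P(1) J(3) by auto
        then have "dist (fst i) z \<le> 6 * snd i" using x i dist_triangle [of "fst i" z x] by linarith
        with i show "z \<in> (\<Union>i\<in>P. cball (fst i) (6 * snd i))" by auto
      qed
      show "\<delta> powr (1 / \<theta>) \<le> snd i \<and> snd i \<le> 6 * \<delta>" if "i \<in> P" for i
        using that P(1) J(3) [of "snd i"] \<delta> by auto
    qed (use * finP \<delta> t in \<open>auto simp: c_def\<close>)
    with not show False by simp
  qed
  also have "\<dots> \<le> c * sum w X" using P(2) c by (simp add: case_prod_beta)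
  finally have M: "\<epsilon> / c < sum w X" using c by (simp add: field_simps)
  define M where "M = sum w X"
  have "\<epsilon> / c > 0" using \<epsilon> c by simp
  then have M0: "M > 0" using M by (simp add: M_def)
  have "sum (\<lambda>y. w y / M) (X \<inter> cball x r) \<le> c / \<epsilon> * r powr t" if "x \<in> X" "r \<in> J" for x r
  proof -
    have "sum (\<lambda>y. w y / M) (X \<inter> cball x r) = sum w (X \<inter> cball x r) / M"
      by (simp add: sum_divide_distrib)
    also have "\<dots> \<le> r powr t / M" using w(2) [OF that] M0 by (intro divide_right_mono) auto
    also have "\<dots> \<le> r powr t / (\<epsilon> / c)"
      using M \<epsilon> c M0 by (intro divide_left_mono) (auto simp: M_def)
    finally show ?thesis by (simp add: field_simps)
  qed
  moreover have "sum (\<lambda>y. w y / M) X = 1" using M0 by (simp add: M_def flip: sum_divide_distrib)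
  ultimately show ?thesis
    using w(1) M0 by (intro exI [of _ "\<lambda>y. w y / M"]) (auto simp: c_def)
qed

lemma sum_UN_le:
  fixes w :: "'a \<Rightarrow> real"
  assumes "finite I" "\<And>i. i \<in> I \<Longrightarrow> finite (A i)" "\<And>x. 0 \<le> w x"
  shows "sum w (\<Union>i\<in>I. A i) \<le> (\<Sum>i\<in>I. sum w (A i))"
  using assms(1,2)
proof (induction I)
  case (insert i I)
  have "sum w (A i \<union> (\<Union>i\<in>I. A i)) \<le> sum w (A i) + sum w (\<Union>i\<in>I. A i)"
    using insert by (subst sum_Un) (auto intro!: sum_nonneg assms(3))
  with insert show ?case by simp
qed simp

text \<open>
  The mass of a ball of radius \<open>R = 2 ^ j * r\<close>, where \<open>r = 2 ^ k * \<rho>\<close>.  Up to the largest scale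
  \<open>\<Delta> = 2 ^ L * \<rho>\<close> the Frostman condition controls it.  Beyond, the ball is covered by sets of diameter \<open>\<Delta>\<close>,
  and each of these carries mass of order at most \<open>\<Delta> powr t\<close>.  In both cases the exponents can be traded
  because \<open>r \<le> R\<close> and \<open>r \<le> \<Delta> \<le> 1\<close>.
\<close>

lemma frostman_weight_growth:
  fixes E :: "'a::euclidean_space set"
  assumes X: "finite X" "X \<subseteq> E" "x \<in> X" and w: "\<And>y. 0 \<le> w y"
    and \<rho>: "0 < \<rho>" "2 ^ L * \<rho> \<le> 1" and k: "k \<le> L"
    and C0: "0 < C\<^sub>0" "\<And>y j. y \<in> X \<Longrightarrow> j \<le> L \<Longrightarrow> sum w (X \<inter> cball y (2 ^ j * \<rho>)) \<le> C\<^sub>0 * (2 ^ j * \<rho>) powr t"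
    and C1: "0 < C\<^sub>1" "\<And>R. 2 ^ L * \<rho> \<le> R \<Longrightarrow> \<exists>\<U>. finite \<U> \<and>
               real (card \<U>) \<le> C\<^sub>1 * R powr \<kappa> * (2 ^ L * \<rho>) powr (- q - \<eta>) \<and>
               ball x R \<inter> E \<subseteq> \<Union>\<U> \<and> (\<forall>U\<in>\<U>. bounded U \<and> diameter U = 2 ^ L * \<rho>)"
    and \<kappa>: "0 \<le> \<kappa>" "\<kappa> \<le> q" and t: "t \<le> q" and \<eta>: "0 \<le> \<eta>"
  shows "sum w (X \<inter> cball x (2 ^ j * (2 ^ k * \<rho>)))
       \<le> C\<^sub>0 * (1 + C\<^sub>1 * 2 powr \<kappa>) * (2 ^ k * \<rho>) powr (t - q + \<kappa> - \<eta>) * (2 ^ j) powr \<kappa>"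
proof -
  define r where "r = 2 ^ k * \<rho>"
  define R where "R = 2 ^ j * r"
  define \<Delta> where "\<Delta> = 2 ^ L * \<rho>"
  define \<tau> where "\<tau> = t - q + \<kappa> - \<eta>"
  have r0: "0 < r" "0 < R" "0 < \<Delta>" using \<rho> by (auto simp: r_def R_def \<Delta>_def)
  have rD: "r \<le> \<Delta>" using k \<rho> by (simp add: r_def \<Delta>_def power_increasing)
  have rR: "r \<le> R" using r0 one_le_power [of "2::real" j] by (simp add: R_def)
  have \<tau>: "\<tau> \<le> \<kappa>" "\<tau> \<le> t" using t \<kappa> \<eta> by (auto simp: \<tau>_def)
  have Rr: "R powr \<kappa> * r powr (\<tau> - \<kappa>) = r powr \<tau> * (2 ^ j) powr \<kappa>"
    using r0 by (simp add: R_def powr_mult mult.assoc flip: powr_add)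
  have C: "C\<^sub>0 \<le> C\<^sub>0 * (1 + C\<^sub>1 * 2 powr \<kappa>)" "C\<^sub>0 * (C\<^sub>1 * 2 powr \<kappa>) \<le> C\<^sub>0 * (1 + C\<^sub>1 * 2 powr \<kappa>)"
    using C0(1) C1(1) by (auto simp: algebra_simps)
  have "sum w (X \<inter> cball x R) \<le> C\<^sub>0 * (1 + C\<^sub>1 * 2 powr \<kappa>) * (R powr \<kappa> * r powr (\<tau> - \<kappa>))"
  proof (cases "j + k \<le> L")
    case True
    have R_alt: "R = 2 ^ (j + k) * \<rho>" by (simp add: R_def r_def power_add)
    have "R \<le> \<Delta>" unfolding R_alt \<Delta>_def using True \<rho> by (intro mult_right_mono power_increasing) auto
    then have "R \<le> 1" using \<rho> by (simp add: \<Delta>_def)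
    have "sum w (X \<inter> cball x R) \<le> C\<^sub>0 * R powr t" unfolding R_alt by (rule C0(2) [OF X(3) True])
    also have "R powr t = R powr \<kappa> * R powr (t - \<kappa>)" by (simp flip: powr_add)
    also have "R powr (t - \<kappa>) \<le> R powr (\<tau> - \<kappa>)" using r0 \<open>R \<le> 1\<close> \<tau> by (intro powr_mono') auto
    also have "R powr (\<tau> - \<kappa>) \<le> r powr (\<tau> - \<kappa>)" using r0 rR \<tau> by (intro powr_mono2') auto
    finally have "sum w (X \<inter> cball x R) \<le> C\<^sub>0 * (R powr \<kappa> * r powr (\<tau> - \<kappa>))"
      using C0(1) by (simp add: mult_left_mono)
    also have "\<dots> \<le> C\<^sub>0 * (1 + C\<^sub>1 * 2 powr \<kappa>) * (R powr \<kappa> * r powr (\<tau> - \<kappa>))"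
      using C(1) by (intro mult_right_mono) auto
    finally show ?thesis .
  next
    case False
    have "\<Delta> \<le> R"
    proof -
      have "(2::real) ^ L \<le> 2 ^ (j + k)" using False by (intro power_increasing) auto
      then show ?thesis using \<rho> by (simp add: R_def r_def \<Delta>_def power_add)
    qed
    \<comment> \<open>Radius \<open>2 * R\<close>, because the covering bound is for open balls.\<close>
    then have "2 ^ L * \<rho> \<le> 2 * R" using r0 by (simp add: \<Delta>_def)
    from C1(2) [OF this] obtain \<U> where U: "finite \<U>" "real (card \<U>) \<le> C\<^sub>1 * (2 * R) powr \<kappa> * \<Delta> powr (- q - \<eta>)"
        "ball x (2 * R) \<inter> E \<subseteq> \<Union>\<U>" "\<forall>U\<in>\<U>. bounded U \<and> diameter U = \<Delta>"
      unfolding \<Delta>_def by (elim exE conjE)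
    have wU: "sum w (X \<inter> U) \<le> C\<^sub>0 * \<Delta> powr t" if "U \<in> \<U>" for U
    proof (cases "X \<inter> U = {}")
      case True
      then show ?thesis using C0(1) by simp
    next
      case False
      then obtain y where y: "y \<in> X" "y \<in> U" by blast
      have "U \<subseteq> cball y \<Delta>"
        using diameter_bounded_bound [OF _ y(2)] U(4) that by fastforce
      then have "sum w (X \<inter> U) \<le> sum w (X \<inter> cball y \<Delta>)"
        using X(1) w by (intro sum_mono2) auto
      also have "\<dots> \<le> C\<^sub>0 * \<Delta> powr t" unfolding \<Delta>_def using y(1) by (intro C0(2)) auto
      finally show ?thesis .
    qed
    have "X \<inter> cball x R \<subseteq> (\<Union>U\<in>\<U>. X \<inter> U)"
    proof
      fix y assume y: "y \<in> X \<inter> cball x R"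
      then have "y \<in> ball x (2 * R) \<inter> E" using X(2) r0 by auto
      then show "y \<in> (\<Union>U\<in>\<U>. X \<inter> U)" using U(3) y by blast
    qed
    then have "sum w (X \<inter> cball x R) \<le> sum w (\<Union>U\<in>\<U>. X \<inter> U)"
      using X(1) U(1) w by (intro sum_mono2) auto
    also have "\<dots> \<le> (\<Sum>U\<in>\<U>. sum w (X \<inter> U))"
      using U(1) X(1) w by (intro sum_UN_le) auto
    also have "\<dots> \<le> (\<Sum>U\<in>\<U>. C\<^sub>0 * \<Delta> powr t)" by (intro sum_mono wU)
    also have "\<dots> = real (card \<U>) * (C\<^sub>0 * \<Delta> powr t)" by simp
    also have "\<dots> \<le> C\<^sub>1 * (2 * R) powr \<kappa> * \<Delta> powr (- q - \<eta>) * (C\<^sub>0 * \<Delta> powr t)"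
      using U(2) C0(1) by (intro mult_right_mono) auto
    also have "\<dots> = C\<^sub>0 * (C\<^sub>1 * 2 powr \<kappa>) * (R powr \<kappa> * (\<Delta> powr (- q - \<eta>) * \<Delta> powr t))"
      using r0 by (simp add: powr_mult)
    also have "\<Delta> powr (- q - \<eta>) * \<Delta> powr t = \<Delta> powr (\<tau> - \<kappa>)"
      by (simp add: \<tau>_def algebra_simps flip: powr_add)
    also have "C\<^sub>0 * (C\<^sub>1 * 2 powr \<kappa>) * (R powr \<kappa> * \<Delta> powr (\<tau> - \<kappa>))
            \<le> C\<^sub>0 * (1 + C\<^sub>1 * 2 powr \<kappa>) * (R powr \<kappa> * r powr (\<tau> - \<kappa>))"
    proof (rule mult_mono [OF C(2) mult_left_mono])
      show "\<Delta> powr (\<tau> - \<kappa>) \<le> r powr (\<tau> - \<kappa>)" using r0 rD \<tau> by (intro powr_mono2') auto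
    qed (use C0(1) C1(1) in auto)
    finally show ?thesis .
  qed
  then have "sum w (X \<inter> cball x R) \<le> C\<^sub>0 * (1 + C\<^sub>1 * 2 powr \<kappa>) * (r powr \<tau> * (2 ^ j) powr \<kappa>)"
    unfolding Rr .
  then show ?thesis unfolding R_def r_def \<tau>_def by (simp only: mult.assoc)
qed

section \<open>Energies at dyadic scales\<close>

lemma dyadic_scale:
  fixes u r :: real
  assumes "u \<le> 2 ^ L * r"
  shows "\<exists>k\<le>L. u \<le> 2 ^ k * r \<and> (k = 0 \<or> 2 ^ k * r < 2 * u)"
proof -
  define k where "k = (LEAST k. u \<le> 2 ^ k * r)"
  have 1: "u \<le> 2 ^ k * r" unfolding k_def by (rule LeastI [of _ L]) fact
  have 2: "k \<le> L" unfolding k_def by (rule Least_le) fact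
  have "k = 0 \<or> 2 ^ k * r < 2 * u"
  proof (cases k)
    case (Suc j)
    then have "\<not> u \<le> 2 ^ j * r" using not_less_Least [of j "\<lambda>k. u \<le> 2 ^ k * r"] by (simp add: k_def)
    then show ?thesis by (simp add: Suc)
  qed simp
  with 1 2 show ?thesis by blast
qed

text \<open>
  A dyadic version of the kernel \<open>max z \<rho> powr (- a)\<close> cut off above \<open>2 ^ L * \<rho>\<close>.  Written as a combination of
  indicators, its expectation reduces to probabilities of small projections.
\<close>

definition scale_kernel :: "real \<Rightarrow> real \<Rightarrow> nat \<Rightarrow> real \<Rightarrow> real" where
  "scale_kernel a \<rho> L z = (\<Sum>k\<le>L. (2 ^ k * \<rho>) powr (- a) * (if z \<le> 2 ^ k * \<rho> then 1 else 0))"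

definition energy :: "real \<Rightarrow> real \<Rightarrow> nat \<Rightarrow> 'x set \<Rightarrow> ('x \<Rightarrow> real) \<Rightarrow> ('x \<Rightarrow> 'b::metric_space) \<Rightarrow> real" where
  "energy a \<rho> L X w f = (\<Sum>x\<in>X. \<Sum>y\<in>X. w x * w y * scale_kernel a \<rho> L (dist (f x) (f y)))"

lemma scale_kernel_nonneg: "0 \<le> scale_kernel a \<rho> L z"
  unfolding scale_kernel_def by (intro sum_nonneg) auto

text \<open>
  The kernel exceeds \<open>u powr (- a)\<close>, up to a constant, for all \<open>z \<le> u\<close>.  The scales \<open>u\<close> may undershoot \<open>\<rho>\<close> by the
  factor \<open>c\<close>, which later gives room to treat all scales between \<open>\<delta> / 2\<close> and \<open>\<delta>\<close> with one set of
  weights.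
\<close>

lemma scale_kernel_lower:
  assumes c: "0 < c" "c \<le> 1" and \<rho>: "0 < \<rho>" and u: "c * \<rho> \<le> u" "u \<le> 2 ^ L * \<rho>" and z: "z \<le> u"
    and a: "0 \<le> a"
  shows "u powr (- a) \<le> (2 / c) powr a * scale_kernel a \<rho> L z"
proof -
  obtain k where k: "k \<le> L" "u \<le> 2 ^ k * \<rho>" "k = 0 \<or> 2 ^ k * \<rho> < 2 * u"
    using dyadic_scale [OF u(2)] by blast
  define R where "R = 2 ^ k * \<rho>"
  have R: "R > 0" "u \<le> R" using \<rho> k by (auto simp: R_def)
  have "c * R \<le> 2 * u"
  proof (cases "k = 0")
    case True
    moreover have "0 < c * \<rho>" using c \<rho> by simp
    ultimately show ?thesis using u by (simp add: R_def)
  next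
    case False
    then have "R \<le> 2 * u" using k by (simp add: R_def)
    moreover have "c * R \<le> R" using c R by simp
    ultimately show ?thesis by linarith
  qed
  then have cR: "c / 2 * R \<le> u" "0 < c / 2 * R" using c R by auto
  have "u powr (- a) \<le> (c / 2 * R) powr (- a)"
    using cR a by (intro powr_mono2') auto
  also have "\<dots> = (2 / c) powr a * R powr (- a)"
    using c R by (simp add: powr_mult powr_minus powr_divide field_simps)
  also have "R powr (- a) \<le> scale_kernel a \<rho> L z"
  proof -
    have "R powr (- a) = (2 ^ k * \<rho>) powr (- a) * (if z \<le> 2 ^ k * \<rho> then 1 else 0)"
      using z R(2) by (simp add: R_def)
    also have "\<dots> \<le> scale_kernel a \<rho> L z"
      unfolding scale_kernel_def using k(1) by (intro member_le_sum) auto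
    finally show ?thesis .
  qed
  finally show ?thesis by (simp add: mult_left_mono)
qed

text \<open>
  Split the unit mass according to the covering set that contains the image of a point.  By the
  Cauchy-Schwarz inequality, the sum of the \<open>a\<close>-th powers of the diameters times the sum of
  \<open>diameter U powr (- a)\<close> times the squared mass assigned to \<open>U\<close> is at least \<open>1\<close>.  A squared mass is a
  sum over pairs of points with images in one \<open>U\<close>, hence at distance at most \<open>diameter U\<close>, and for these
  the kernel dominates \<open>diameter U powr (- a)\<close>.
\<close>

lemma cover_sum_energy:
  fixes f :: "'x \<Rightarrow> 'b::metric_space"
  assumes X: "finite X" and w: "\<And>x. 0 \<le> w x" "sum w X = 1"
    and \<U>: "finite \<U>" "f ` X \<subseteq> \<Union>\<U>"
      "\<And>U. U \<in> \<U> \<Longrightarrow> bounded U \<and> c * \<rho> \<le> diameter U \<and> diameter U \<le> 2 ^ L * \<rho>"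
    and c: "0 < c" "c \<le> 1" and \<rho>: "0 < \<rho>" and a: "0 \<le> a"
  shows "1 \<le> (\<Sum>U\<in>\<U>. diameter U powr a) * ((2 / c) powr a * energy a \<rho> L X w f)"
proof -
  define r where "r U = diameter U" for U :: "'b set"
  have r0: "0 < r U" if "U \<in> \<U>" for U
  proof -
    have "0 < c * \<rho>" using c \<rho> by simp
    then show ?thesis using \<U>(3) [OF that] by (simp add: r_def)
  qed
  have "\<exists>U\<in>\<U>. f x \<in> U" if "x \<in> X" for x using that \<U>(2) by blast
  then obtain u where u: "\<And>x. x \<in> X \<Longrightarrow> u x \<in> \<U> \<and> f x \<in> u x" by metis
  define G where "G U = {x \<in> X. u x = U}" for U
  define W where "W U = sum w (G U)" for U
  have finG: "finite (G U)" for U using X by (simp add: G_def)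
  have "(\<Sum>U\<in>\<U>. W U) = 1"
    using sum.group [OF X \<U>(1), of u w] u w(2) by (auto simp: W_def G_def image_subset_iff)
  moreover have "(\<Sum>U\<in>\<U>. r U powr (a / 2) * (r U powr (- a / 2) * W U)) = (\<Sum>U\<in>\<U>. W U)"
  proof (rule sum.cong [OF refl])
    fix U assume "U \<in> \<U>"
    then show "r U powr (a / 2) * (r U powr (- a / 2) * W U) = W U"
      using r0 [of U] by (simp add: mult.assoc [symmetric] flip: powr_add)
  qed
  ultimately have "1 = (\<Sum>U\<in>\<U>. (r U powr (a / 2)) * (r U powr (- a / 2) * W U))\<^sup>2"
    by simp
  also have "\<dots> \<le> (\<Sum>U\<in>\<U>. (r U powr (a / 2))\<^sup>2) * (\<Sum>U\<in>\<U>. (r U powr (- a / 2) * W U)\<^sup>2)"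
    by (rule Cauchy_Schwarz_ineq_sum)
  also have "(\<Sum>U\<in>\<U>. (r U powr (a / 2))\<^sup>2) = (\<Sum>U\<in>\<U>. r U powr a)"
    by (simp add: power2_eq_square flip: powr_add)
  also have "(\<Sum>U\<in>\<U>. (r U powr (- a / 2) * W U)\<^sup>2) = (\<Sum>U\<in>\<U>. r U powr (- a) * (W U)\<^sup>2)"
  proof (rule sum.cong [OF refl])
    fix U
    have "(r U powr (- a / 2))\<^sup>2 = r U powr (- a)" by (simp add: power2_eq_square flip: powr_add)
    then show "(r U powr (- a / 2) * W U)\<^sup>2 = r U powr (- a) * (W U)\<^sup>2"
      by (simp only: power_mult_distrib)
  qed
  also have "(\<Sum>U\<in>\<U>. r U powr a) * (\<Sum>U\<in>\<U>. r U powr (- a) * (W U)\<^sup>2)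
     \<le> (\<Sum>U\<in>\<U>. r U powr a) * ((2 / c) powr a * energy a \<rho> L X w f)"
  proof (rule mult_left_mono)
    define kk where "kk x y = scale_kernel a \<rho> L (dist (f x) (f y))" for x y
    have "r U powr (- a) * (W U)\<^sup>2 \<le> (2 / c) powr a * (\<Sum>x\<in>G U. \<Sum>y\<in>X. w x * w y * kk x y)"
      if U: "U \<in> \<U>" for U
    proof -
      have "r U powr (- a) * (W U)\<^sup>2 = (\<Sum>x\<in>G U. \<Sum>y\<in>G U. w x * w y * r U powr (- a))"
        by (simp add: W_def power2_eq_square sum_product sum_distrib_left mult_ac)
      also have "\<dots> \<le> (\<Sum>x\<in>G U. \<Sum>y\<in>G U. w x * w y * ((2 / c) powr a * kk x y))"
      proof (intro sum_mono mult_left_mono)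
        fix x y assume "x \<in> G U" "y \<in> G U"
        then have "f x \<in> U" "f y \<in> U" using u by (auto simp: G_def)
        then have "dist (f x) (f y) \<le> r U"
          using \<U>(3) [OF U] by (auto simp: r_def intro: diameter_bounded_bound)
        then show "r U powr (- a) \<le> (2 / c) powr a * kk x y"
          unfolding kk_def using \<U>(3) [OF U] c \<rho> a by (intro scale_kernel_lower) (auto simp: r_def)
      qed (use w in auto)
      also have "\<dots> \<le> (\<Sum>x\<in>G U. \<Sum>y\<in>X. w x * w y * ((2 / c) powr a * kk x y))"
        using X w(1) by (intro sum_mono sum_mono2) (auto simp: G_def kk_def scale_kernel_nonneg)
      finally show ?thesis by (simp add: sum_distrib_left mult_ac)
    qed
    then have "(\<Sum>U\<in>\<U>. r U powr (- a) * (W U)\<^sup>2)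
      \<le> (\<Sum>U\<in>\<U>. (2 / c) powr a * (\<Sum>x\<in>G U. \<Sum>y\<in>X. w x * w y * kk x y))" by (rule sum_mono)
    also have "\<dots> = (2 / c) powr a * (\<Sum>U\<in>\<U>. \<Sum>x\<in>G U. \<Sum>y\<in>X. w x * w y * kk x y)"
      by (simp add: sum_distrib_left)
    also have "(\<Sum>U\<in>\<U>. \<Sum>x\<in>G U. \<Sum>y\<in>X. w x * w y * kk x y) = energy a \<rho> L X w f"
      using sum.group [OF X \<U>(1), of u "\<lambda>x. \<Sum>y\<in>X. w x * w y * kk x y"] u
      by (auto simp: G_def energy_def kk_def image_subset_iff)
    finally show "(\<Sum>U\<in>\<U>. r U powr (- a) * (W U)\<^sup>2) \<le> (2 / c) powr a * energy a \<rho> L X w f" .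
  qed (intro sum_nonneg, simp)
  finally show ?thesis by (simp add: r_def)
qed

text \<open>
  Decompose into the dyadic annuli around \<open>x\<close>.  The \<open>j\<close>-th one contributes at most a constant times
  \<open>(2 ^ j) powr (\<kappa> - m)\<close>, and \<open>\<kappa> < m\<close> makes the series geometric.
\<close>

lemma weighted_kernel_sum_le:
  fixes x :: "'a::metric_space"
  assumes X: "finite X" and w: "\<And>x. 0 \<le> w x" and r: "0 < r" and c: "0 < c" and D: "0 \<le> D"
    and p: "\<And>y. y \<in> X \<Longrightarrow> p y \<le> 1" "\<And>y. y \<in> X \<Longrightarrow> r < dist x y \<Longrightarrow> p y \<le> c * (r / dist x y) ^ m"
    and H: "\<And>j. sum w (X \<inter> cball x (2 ^ j * r)) \<le> D * (2 ^ j) powr \<kappa>" and \<kappa>: "\<kappa> < real m"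
  shows "(\<Sum>y\<in>X. w y * p y) \<le> max 1 (c * 2 ^ m) / (1 - 2 powr (\<kappa> - m)) * D"
proof -
  define c' where "c' = max 1 (c * 2 ^ m)"
  have c': "1 \<le> c'" "c * 2 ^ m \<le> c'" by (auto simp: c'_def)
  define z :: real where "z = 2 powr (\<kappa> - m)"
  have z: "0 < z" "z < 1" using \<kappa> by (auto simp: z_def powr_less_one)
  obtain B where B: "\<And>y. y \<in> X \<Longrightarrow> dist x y \<le> B"
    using finite_imp_bounded [OF X] by (metis bounded_any_center)
  obtain N where "B / r < 2 ^ N" using real_arch_pow [of 2 "B / r"] by auto
  then have "B \<le> 2 ^ N * r" using r by (simp add: field_simps)
  then have N: "dist x y \<le> 2 ^ N * r" if "y \<in> X" for y using B [OF that] by linarith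
  have py: "p y \<le> c' * (\<Sum>j\<le>N. (1 / 2 ^ m) ^ j * (if y \<in> cball x (2 ^ j * r) then 1 else 0))" if y: "y \<in> X" for y
  proof -
    obtain k where k: "k \<le> N" "dist x y \<le> 2 ^ k * r" "k = 0 \<or> 2 ^ k * r < 2 * dist x y"
      using dyadic_scale [OF N [OF y]] by blast
    have "p y \<le> c' * (1 / 2 ^ m) ^ k"
    proof (cases "k = 0 \<or> dist x y \<le> r")
      case True
      then have "k = 0"
      proof
        assume d: "dist x y \<le> r"
        show "k = 0"
        proof (rule ccontr)
          assume "k \<noteq> 0"
          then have "2 ^ k * r < 2 * r" using k d by linarith
          then have "(2::real) ^ k < 2 ^ 1" using r by simp
          with \<open>k \<noteq> 0\<close> show False using power_increasing [of 1 k "2::real"] by simp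
        qed
      qed
      then show ?thesis using p(1) [OF y] c' by simp
    next
      case False
      then have d: "r < dist x y" "2 ^ k * r < 2 * dist x y" using k by auto
      have "0 < dist x y" using d r by linarith
      then have "r / dist x y \<le> 2 / 2 ^ k" using d r by (simp add: field_simps)
      then have "p y \<le> c * (2 / 2 ^ k) ^ m"
        using p(2) [OF y d(1)] c r d(1)
        by (smt (verit, ccfv_SIG) divide_nonneg_nonneg mult_left_mono power_mono zero_le_dist)
      also have "\<dots> = (c * 2 ^ m) * (1 / 2 ^ m) ^ k"
        by (simp add: power_divide mult.commute flip: power_mult)
      also have "\<dots> \<le> c' * (1 / 2 ^ m) ^ k" using c' by (intro mult_right_mono) auto
      finally show ?thesis .
    qed
    also have "(1 / 2 ^ m) ^ k \<le> (\<Sum>j\<le>N. (1 / 2 ^ m) ^ j * (if y \<in> cball x (2 ^ j * r) then 1 else 0 :: real))"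
      using member_le_sum [of k "{..N}" "\<lambda>j. (1 / 2 ^ m) ^ j * (if y \<in> cball x (2 ^ j * r) then 1 else 0 :: real)"]
        k(1,2) by simp
    finally show ?thesis using c' by simp
  qed
  have "(\<Sum>y\<in>X. w y * p y)
     \<le> (\<Sum>y\<in>X. w y * (c' * (\<Sum>j\<le>N. (1 / 2 ^ m) ^ j * (if y \<in> cball x (2 ^ j * r) then 1 else 0))))"
    using py w by (intro sum_mono mult_left_mono) auto
  also have "\<dots> = c' * (\<Sum>y\<in>X. \<Sum>j\<le>N. (1 / 2 ^ m) ^ j * (if y \<in> cball x (2 ^ j * r) then w y else 0))"
    by (simp add: sum_distrib_left mult_ac if_distrib cong: if_cong)
  also have "\<dots> = c' * (\<Sum>j\<le>N. (1 / 2 ^ m) ^ j * sum w (X \<inter> cball x (2 ^ j * r)))"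
    by (subst sum.swap) (simp add: sum.inter_restrict [OF X] sum_distrib_left)
  also have "\<dots> \<le> c' * (\<Sum>j\<le>N. z ^ j * D)"
  proof (intro mult_left_mono sum_mono)
    fix j
    have "(1 / 2 ^ m) ^ j * sum w (X \<inter> cball x (2 ^ j * r)) \<le> (1 / 2 ^ m) ^ j * (D * (2 ^ j) powr \<kappa>)"
      by (intro mult_left_mono H) auto
    also have "\<dots> = z ^ j * D"
    proof -
      have "z = 2 powr \<kappa> / 2 ^ m" by (simp add: z_def powr_diff powr_realpow)
      moreover have "(2 ^ j) powr \<kappa> = (2 powr \<kappa>) ^ j"
        by (simp add: powr_powr mult.commute flip: powr_realpow)
      ultimately show ?thesis by (simp add: power_divide)
    qed
    finally show "(1 / 2 ^ m) ^ j * sum w (X \<inter> cball x (2 ^ j * r)) \<le> z ^ j * D" .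
  qed (use c' in auto)
  also have "\<dots> = c' * ((\<Sum>j\<le>N. z ^ j) * D)" by (simp add: sum_distrib_right)
  also have "\<dots> \<le> c' * (1 / (1 - z) * D)"
  proof -
    have "(\<Sum>j\<le>N. z ^ j) = (1 - z ^ Suc N) / (1 - z)" using z sum_gp0 [of z N] by simp
    also have "\<dots> \<le> 1 / (1 - z)" using z by (intro divide_right_mono) auto
    finally show ?thesis using c' D by (intro mult_left_mono mult_right_mono) auto
  qed
  finally show ?thesis by (simp add: c'_def z_def)
qed

lemma sum_dyadic_powr_le:
  fixes \<rho> b :: real
  assumes "0 < \<rho>" "0 < b"
  shows "(\<Sum>k\<le>L. (2 ^ k * \<rho>) powr b) \<le> 1 / (1 - 2 powr (- b)) * (2 ^ L * \<rho>) powr b"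
proof -
  define z :: real where "z = 2 powr (- b)"
  have z: "0 < z" "z < 1" using assms by (auto simp: z_def powr_less_one)
  have "(\<Sum>k\<le>L. (2 ^ k * \<rho>) powr b) = (\<Sum>k\<le>L. z ^ (L - k) * (2 ^ L * \<rho>) powr b)"
  proof (rule sum.cong)
    fix k assume "k \<in> {..L}"
    then have "(2::real) ^ L = 2 ^ (L - k) * 2 ^ k" by (simp flip: power_add)
    then have "(2 ^ L * \<rho>) powr b = (2 ^ (L - k)) powr b * (2 ^ k * \<rho>) powr b"
      using assms by (simp add: powr_mult)
    moreover have "z ^ (L - k) * (2 ^ (L - k)) powr b = 1"
    proof -
      have "z ^ (L - k) = 2 powr (- (b * real (L - k)))"
        using powr_realpow [OF z(1), of "L - k"] by (simp add: z_def powr_powr)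
      moreover have "((2::real) ^ (L - k)) powr b = 2 powr (b * real (L - k))"
        using powr_realpow [of 2 "L - k"] powr_powr [of 2 "real (L - k)" b] by (simp add: mult.commute)
      ultimately show ?thesis by (simp flip: powr_add)
    qed
    ultimately show "(2 ^ k * \<rho>) powr b = z ^ (L - k) * (2 ^ L * \<rho>) powr b" by simp
  qed simp
  also have "\<dots> = (\<Sum>k\<le>L. z ^ k) * (2 ^ L * \<rho>) powr b"
  proof -
    have "(\<Sum>k\<le>L. z ^ (L - k)) = (\<Sum>k\<le>L. z ^ k)"
      by (rule sum.reindex_bij_witness [of _ "\<lambda>k. L - k" "\<lambda>k. L - k"]) auto
    then show ?thesis by (simp flip: sum_distrib_right)
  qed
  also have "(\<Sum>k\<le>L. z ^ k) \<le> 1 / (1 - z)"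
  proof -
    have "(\<Sum>j\<le>L. z ^ j) = (1 - z ^ Suc L) / (1 - z)" using z sum_gp0 [of z L] by simp
    also have "\<dots> \<le> 1 / (1 - z)" using z by (intro divide_right_mono) auto
    finally show ?thesis .
  qed
  finally show ?thesis by (simp add: z_def mult_right_mono)
qed

text \<open>
  Integrating the energy over all subspaces turns each indicator in the kernel into a probability.  The bound
  for the potentials makes the sum over the scales geometric and dominated by the largest scale, and
  Markov's inequality converts the expectation into the measure of an exceptional set.
\<close>

lemma expected_energy_bound:
  fixes \<gamma> :: "'a::euclidean_space set measure"
  assumes haar: "haar_grassmannian m \<gamma>" and X: "finite X" and w: "\<And>x. 0 \<le> w x" "sum w X = 1"
    and \<rho>: "0 < \<rho>" and D: "0 \<le> D" and b: "a < \<tau>"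
    and p: "\<And>x k. x \<in> X \<Longrightarrow> k \<le> L \<Longrightarrow>
      (\<Sum>y\<in>X. w y * measure \<gamma> {V \<in> space \<gamma>. norm (orth_proj V (x - y)) \<le> 2 ^ k * \<rho>}) \<le> D * (2 ^ k * \<rho>) powr \<tau>"
    and h: "0 < h"
  shows "\<exists>A\<in>sets \<gamma>. measure \<gamma> A \<le> D / (1 - 2 powr (a - \<tau>)) / h * (2 ^ L * \<rho>) powr (\<tau> - a) \<and>
           (\<forall>V\<in>space \<gamma> - A. energy a \<rho> L X w (orth_proj V) < h)"
proof -
  interpret prob_space \<gamma> using haar by (simp add: haar_grassmannian_def)
  define S where "S x y k = {V \<in> space \<gamma>. norm (orth_proj V (x - y)) \<le> 2 ^ k * \<rho>}" for x y :: 'a and k :: nat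
  have S [measurable]: "S x y k \<in> sets \<gamma>" for x y k
    unfolding S_def by (rule sets_small_projection [OF haar])
  define g where "g V = (\<Sum>x\<in>X. \<Sum>y\<in>X. w x * w y * (\<Sum>k\<le>L. (2 ^ k * \<rho>) powr (- a) * indicator (S x y k) V))" for V
  have g_eq: "g V = energy a \<rho> L X w (orth_proj V)" if V: "V \<in> space \<gamma>" for V
    unfolding g_def energy_def scale_kernel_def using V dist_orth_proj [OF haar_grassmannian_subspace(1) [OF haar V]]
    by (intro sum.cong refl arg_cong2 [where f = "(*)"]) (auto simp: S_def)
  have "has_bochner_integral \<gamma> g
      (\<Sum>x\<in>X. \<Sum>y\<in>X. w x * w y * (\<Sum>k\<le>L. (2 ^ k * \<rho>) powr (- a) * measure \<gamma> (S x y k)))"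
    unfolding g_def
    by (intro has_bochner_integral_sum has_bochner_integral_mult_right has_bochner_integral_real_indicator S)
       (simp add: less_top [symmetric])
  then have int: "integrable \<gamma> g" and Eg0: "(\<integral>V. g V \<partial>\<gamma>)
      = (\<Sum>x\<in>X. \<Sum>y\<in>X. w x * w y * (\<Sum>k\<le>L. (2 ^ k * \<rho>) powr (- a) * measure \<gamma> (S x y k)))"
    by (simp_all add: has_bochner_integral_iff)
  have g0: "0 \<le> g V" for V unfolding g_def using w(1) by (intro sum_nonneg mult_nonneg_nonneg) auto
  have "(\<integral>V. g V \<partial>\<gamma>)
      = (\<Sum>x\<in>X. \<Sum>y\<in>X. w x * w y * (\<Sum>k\<le>L. (2 ^ k * \<rho>) powr (- a) * measure \<gamma> (S x y k)))"
    by (rule Eg0)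
  also have "\<dots> = (\<Sum>k\<le>L. (2 ^ k * \<rho>) powr (- a) * (\<Sum>x\<in>X. w x * (\<Sum>y\<in>X. w y * measure \<gamma> (S x y k))))"
  proof -
    have "(\<Sum>x\<in>X. \<Sum>y\<in>X. w x * w y * (\<Sum>k\<le>L. (2 ^ k * \<rho>) powr (- a) * measure \<gamma> (S x y k)))
        = (\<Sum>x\<in>X. \<Sum>y\<in>X. \<Sum>k\<le>L. (2 ^ k * \<rho>) powr (- a) * (w x * (w y * measure \<gamma> (S x y k))))"
      by (simp add: sum_distrib_left mult_ac)
    also have "\<dots> = (\<Sum>x\<in>X. \<Sum>k\<le>L. \<Sum>y\<in>X. (2 ^ k * \<rho>) powr (- a) * (w x * (w y * measure \<gamma> (S x y k))))"
      by (intro sum.cong refl sum.swap)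
    also have "\<dots> = (\<Sum>k\<le>L. \<Sum>x\<in>X. \<Sum>y\<in>X. (2 ^ k * \<rho>) powr (- a) * (w x * (w y * measure \<gamma> (S x y k))))"
      by (rule sum.swap)
    finally show ?thesis by (simp add: sum_distrib_left)
  qed
  also have "\<dots> \<le> (\<Sum>k\<le>L. (2 ^ k * \<rho>) powr (- a) * (\<Sum>x\<in>X. w x * (D * (2 ^ k * \<rho>) powr \<tau>)))"
    using p w(1) unfolding S_def by (intro sum_mono mult_left_mono) auto
  also have "\<dots> = (\<Sum>k\<le>L. D * (2 ^ k * \<rho>) powr (\<tau> - a))"
    using w(2) by (intro sum.cong refl) (simp add: powr_diff powr_minus_divide flip: sum_distrib_right)
  also have "\<dots> = D * (\<Sum>k\<le>L. (2 ^ k * \<rho>) powr (\<tau> - a))" by (simp add: sum_distrib_left)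
  also have "\<dots> \<le> D * (1 / (1 - 2 powr (- (\<tau> - a))) * (2 ^ L * \<rho>) powr (\<tau> - a))"
    using D \<rho> b by (intro mult_left_mono sum_dyadic_powr_le) auto
  finally have Eg: "(\<integral>V. g V \<partial>\<gamma>) \<le> D / (1 - 2 powr (a - \<tau>)) * (2 ^ L * \<rho>) powr (\<tau> - a)" by simp
  define A where "A = {V \<in> space \<gamma>. h \<le> g V}"
  have [measurable]: "g \<in> borel_measurable \<gamma>" using int by simp
  have A: "A \<in> sets \<gamma>" unfolding A_def by measurable
  have "measure \<gamma> A \<le> (\<integral>V. g V \<partial>\<gamma>) / h"
    unfolding A_def using int g0 h by (intro integral_Markov_inequality_measure [where A = "{}"]) auto
  also have "\<dots> \<le> D / (1 - 2 powr (a - \<tau>)) * (2 ^ L * \<rho>) powr (\<tau> - a) / h"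
    using Eg h by (intro divide_right_mono) auto
  finally have "measure \<gamma> A \<le> D / (1 - 2 powr (a - \<tau>)) / h * (2 ^ L * \<rho>) powr (\<tau> - a)" by simp
  then show ?thesis using A g_eq by (intro bexI [of _ A] conjI) (auto simp: A_def)
qed

section \<open>Exceptional sets of subspaces\<close>

text \<open>
  The argument at a single scale: weights of Frostman type, their growth, the expected energy of the
  projected weights and the comparison of covers with energies.  The constants are independent of
  \<open>\<delta>\<close>.
\<close>

lemma exceptional_set_at_scale:
  fixes E :: "(real ^ 'd) set" and \<gamma> :: "(real ^ 'd) set measure"
  assumes E: "E \<noteq> {}" "bounded E" and haar: "haar_grassmannian m \<gamma>"
    and \<theta>: "0 < \<theta>" "\<theta> \<le> 1" and t: "0 \<le> t" "t \<le> q" and \<epsilon>: "0 < \<epsilon>"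
    and q: "quasi_assouad_dim E < q" "0 < q" and \<kappa>: "0 \<le> \<kappa>" "\<kappa> \<le> q" "\<kappa> < real m" and \<eta>: "0 < \<eta>"
    and a: "0 \<le> a" "a < t - q + \<kappa> - \<eta>"
  shows "\<exists>C>0. \<exists>\<delta>\<^sub>1>0. \<forall>\<delta>. 0 < \<delta> \<and> \<delta> \<le> \<delta>\<^sub>1 \<and> \<not> intermediate_cover \<theta> t \<delta> \<epsilon> E \<longrightarrow>
           (\<exists>A\<in>sets \<gamma>. measure \<gamma> A \<le> C * \<delta> powr (t - q + \<kappa> - \<eta> - a) \<and>
              (\<forall>V\<in>space \<gamma> - A. \<forall>\<delta>'. \<delta> / 2 \<le> \<delta>' \<and> \<delta>' \<le> \<delta> \<longrightarrow>
                 \<not> intermediate_cover \<theta> a \<delta>' 1 (orth_proj V ` E)))"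
proof -
  define \<tau> where "\<tau> = t - q + \<kappa> - \<eta>"
  define C0 where "C0 = cover_const TYPE(real ^ 'd) 72 / \<epsilon>"
  have C0: "C0 > 0" using cover_const_ge_1 [of 72, where ?'a = "real ^ 'd"] \<epsilon> by (simp add: C0_def)
  from quasi_assouad_cover [OF E q \<kappa>(1,2) \<eta>]
  obtain C1 \<Delta>\<^sub>0 where C1: "C1 > 0" and D0: "0 < \<Delta>\<^sub>0" "\<Delta>\<^sub>0 \<le> 1"
    and cov: "\<forall>\<Delta> R. \<forall>x\<in>E. 0 < \<Delta> \<and> \<Delta> \<le> \<Delta>\<^sub>0 \<and> \<Delta> \<le> R \<longrightarrow>
           (\<exists>\<U>. finite \<U> \<and> real (card \<U>) \<le> C1 * R powr \<kappa> * \<Delta> powr (- q - \<eta>) \<and>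
                 ball x R \<inter> E \<subseteq> \<Union>\<U> \<and> (\<forall>U\<in>\<U>. bounded U \<and> diameter U = \<Delta>))"
    by (elim exE conjE)
  obtain C2 where C2: "C2 > 0" "\<And>z r. 0 < r \<Longrightarrow> r \<le> norm z \<Longrightarrow>
           measure \<gamma> {V \<in> space \<gamma>. norm (orth_proj V z) \<le> r} \<le> C2 * (r / norm z) ^ m"
    using prob_small_projection_le [OF haar] by auto
  define D1 where "D1 = C0 * (1 + C1 * 2 powr \<kappa>)"
  have D1: "D1 > 0" using C0 C1 by (auto simp: D1_def intro!: mult_pos_pos add_pos_pos)
  define C3 where "C3 = max 1 (C2 * 2 ^ m) / (1 - 2 powr (\<kappa> - m))"
  have "2 powr (\<kappa> - m) < 1" using \<kappa>(3) by (simp add: powr_less_one)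
  then have C3: "C3 > 0" by (auto simp: C3_def intro!: divide_pos_pos)
  \<comment> \<open>For \<open>\<delta>' \<ge> \<delta> / 2\<close> the smallest admissible diameter is at least \<open>c * \<rho>\<close>.\<close>
  define c where "c = (1 / 2) powr (1 / \<theta>)"
  have c: "0 < c" "c \<le> 1" using \<theta> by (auto simp: c_def powr_le1)
  \<comment> \<open>An energy below \<open>h\<close> makes the sum over every admissible cover of the projection larger than \<open>1\<close>.\<close>
  define h where "h = (c / 2) powr a"
  have h: "h > 0" using c by (simp add: h_def)
  define C4 where "C4 = C3 * D1 / (1 - 2 powr (a - \<tau>)) / h"
  have "2 powr (a - \<tau>) < 1" using a(2) by (simp add: powr_less_one \<tau>_def)
  then have C4: "C4 > 0" using C3 D1 h by (auto simp: C4_def)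
  interpret prob_space \<gamma> using haar by (simp add: haar_grassmannian_def)
  have main: "\<exists>A\<in>sets \<gamma>. measure \<gamma> A \<le> C4 * 2 powr (\<tau> - a) * \<delta> powr (\<tau> - a) \<and>
              (\<forall>V\<in>space \<gamma> - A. \<forall>\<delta>'. \<delta> / 2 \<le> \<delta>' \<and> \<delta>' \<le> \<delta> \<longrightarrow>
                 \<not> intermediate_cover \<theta> a \<delta>' 1 (orth_proj V ` E))"
    if \<delta>: "0 < \<delta>" "\<delta> \<le> \<Delta>\<^sub>0 / 2" and not: "\<not> intermediate_cover \<theta> t \<delta> \<epsilon> E" for \<delta>
  proof -
    define \<rho> where "\<rho> = \<delta> powr (1 / \<theta>)"
    have \<rho>: "0 < \<rho>" "\<rho> \<le> \<delta>" using \<delta> D0 \<theta> powr_inverse_le_self [OF \<theta>, of \<delta>] by (auto simp: \<rho>_def)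
    obtain N where "\<delta> / \<rho> < 2 ^ N" using real_arch_pow [of 2 "\<delta> / \<rho>"] by auto
    then have "\<delta> \<le> 2 ^ N * \<rho>" using \<rho> by (simp add: field_simps)
    then obtain L where L: "\<delta> \<le> 2 ^ L * \<rho>" "L = 0 \<or> 2 ^ L * \<rho> < 2 * \<delta>"
      using dyadic_scale [of \<delta> N \<rho>] by blast
    define \<Delta> where "\<Delta> = 2 ^ L * \<rho>"
    have \<Delta>: "\<delta> \<le> \<Delta>" "\<Delta> \<le> 2 * \<delta>" using L \<rho> by (auto simp: \<Delta>_def)
    then have \<Delta>1: "0 < \<Delta>" "\<Delta> \<le> \<Delta>\<^sub>0" "\<Delta> \<le> 1" using \<delta> D0 by auto
    define J where "J = (\<lambda>k. 2 ^ k * \<rho>) ` {..L}"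
    have Jb: "\<rho> \<le> r \<and> r \<le> 2 * \<delta>" if r: "r \<in> J" for r
    proof -
      obtain k where k: "k \<le> L" "r = 2 ^ k * \<rho>" using r by (auto simp: J_def)
      have "2 ^ k * \<rho> \<le> \<Delta>" unfolding \<Delta>_def using k(1) \<rho> by (intro mult_right_mono power_increasing) auto
      moreover have "1 * \<rho> \<le> 2 ^ k * \<rho>" using \<rho> by (intro mult_right_mono) auto
      ultimately show ?thesis using \<Delta> k(2) by simp
    qed
    obtain X where X: "finite X" "X \<subseteq> E" "E \<subseteq> (\<Union>x\<in>X. ball x \<rho>)"
      using bounded_finite_net [OF E(2) \<rho>(1)] by auto
    have X': "E \<subseteq> (\<Union>x\<in>X. cball x (\<delta> powr (1 / \<theta>)))" using X(3) ball_subset_cball unfolding \<rho>_def by blast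
    have "\<exists>w. (\<forall>x. 0 \<le> w x) \<and> sum w X = 1 \<and> (\<forall>x\<in>X. \<forall>r\<in>J. sum w (X \<inter> cball x r) \<le> C0 * r powr t)"
      unfolding C0_def
      by (rule frostman_weights [OF not \<epsilon> \<delta>(1) _ t(1) X(1) X']) (use Jb \<rho> in \<open>auto simp: J_def \<rho>_def\<close>)
    then obtain w where w: "\<And>x. 0 \<le> w x" "sum w X = 1"
        and wJ: "\<And>x r. x \<in> X \<Longrightarrow> r \<in> J \<Longrightarrow> sum w (X \<inter> cball x r) \<le> C0 * r powr t" by blast
    have growth: "sum w (X \<inter> cball x (2 ^ j * (2 ^ k * \<rho>))) \<le> D1 * (2 ^ k * \<rho>) powr \<tau> * (2 ^ j) powr \<kappa>"
      if x: "x \<in> X" and k: "k \<le> L" for x j k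
      unfolding D1_def \<tau>_def
    proof (rule frostman_weight_growth [where L = L and E = E])
      show "\<exists>\<U>. finite \<U> \<and> real (card \<U>) \<le> C1 * R powr \<kappa> * (2 ^ L * \<rho>) powr (- q - \<eta>) \<and>
               ball x R \<inter> E \<subseteq> \<Union>\<U> \<and> (\<forall>U\<in>\<U>. bounded U \<and> diameter U = 2 ^ L * \<rho>)"
        if "2 ^ L * \<rho> \<le> R" for R
        using cov [rule_format, of x \<Delta> R] that \<Delta>1 x X(2) by (auto simp: \<Delta>_def)
      show "sum w (X \<inter> cball y (2 ^ i * \<rho>)) \<le> C0 * (2 ^ i * \<rho>) powr t" if "y \<in> X" "i \<le> L" for y i
        using that by (intro wJ) (auto simp: J_def)
      show "2 ^ L * \<rho> \<le> 1" using \<Delta>1(3) by (simp add: \<Delta>_def)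
    qed (use X w(1) x k \<rho> C0 C1 \<kappa> t \<eta> in auto)
    have pot: "(\<Sum>y\<in>X. w y * measure \<gamma> {V \<in> space \<gamma>. norm (orth_proj V (x - y)) \<le> 2 ^ k * \<rho>})
         \<le> C3 * D1 * (2 ^ k * \<rho>) powr \<tau>" if x: "x \<in> X" and k: "k \<le> L" for x k
    proof -
      have "(\<Sum>y\<in>X. w y * measure \<gamma> {V \<in> space \<gamma>. norm (orth_proj V (x - y)) \<le> 2 ^ k * \<rho>})
         \<le> C3 * (D1 * (2 ^ k * \<rho>) powr \<tau>)"
        unfolding C3_def
      proof (rule weighted_kernel_sum_le [where r = "2 ^ k * \<rho>"])
        show "measure \<gamma> {V \<in> space \<gamma>. norm (orth_proj V (x - y)) \<le> 2 ^ k * \<rho>}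
            \<le> C2 * (2 ^ k * \<rho> / dist x y) ^ m" if "2 ^ k * \<rho> < dist x y" for y
          using C2(2) [of "2 ^ k * \<rho>" "x - y"] that \<rho> by (simp add: dist_norm)
        show "sum w (X \<inter> cball x (2 ^ j * (2 ^ k * \<rho>))) \<le> D1 * (2 ^ k * \<rho>) powr \<tau> * (2 ^ j) powr \<kappa>" for j
          by (rule growth [OF x k])
      qed (use X(1) w(1) \<rho> C2(1) D1 \<kappa>(3) in auto)
      then show ?thesis by simp
    qed
    have "a < \<tau>" using a(2) by (simp add: \<tau>_def)
    have CD: "0 \<le> C3 * D1" using C3 D1 by simp
    from expected_energy_bound [where L = L, OF haar X(1) w \<rho>(1) CD \<open>a < \<tau>\<close> pot h]
    obtain A where A: "A \<in> sets \<gamma>" "measure \<gamma> A \<le> C4 * \<Delta> powr (\<tau> - a)"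
        and AE: "\<And>V. V \<in> space \<gamma> - A \<Longrightarrow> energy a \<rho> L X w (orth_proj V) < h"
      unfolding C4_def \<Delta>_def by blast
    note A(2)
    also have "C4 * \<Delta> powr (\<tau> - a) \<le> C4 * (2 * \<delta>) powr (\<tau> - a)"
      using C4 \<Delta> \<Delta>1 \<open>a < \<tau>\<close> by (intro mult_left_mono powr_mono2) auto
    finally have A2: "measure \<gamma> A \<le> C4 * 2 powr (\<tau> - a) * \<delta> powr (\<tau> - a)"
      using \<delta> by (simp add: powr_mult)
    have "\<not> intermediate_cover \<theta> a \<delta>' 1 (orth_proj V ` E)"
      if V: "V \<in> space \<gamma> - A" and \<delta>': "\<delta> / 2 \<le> \<delta>'" "\<delta>' \<le> \<delta>" for V \<delta>'
    proof
      assume ic: "intermediate_cover \<theta> a \<delta>' 1 (orth_proj V ` E)"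
      have \<delta>'0: "0 < \<delta>'" using \<delta> \<delta>' by linarith
      obtain \<U> where U: "finite \<U>" "orth_proj V ` E \<subseteq> \<Union>\<U>"
        "\<And>U. U \<in> \<U> \<Longrightarrow> bounded U \<and> \<delta>' powr (1 / \<theta>) \<le> diameter U \<and> diameter U \<le> \<delta>'"
        "(\<Sum>U\<in>\<U>. diameter U powr a) \<le> 1"
        using intermediate_cover_finiteD [OF ic \<delta>'0 a(1)] by metis
      have "c * \<rho> = (\<delta> / 2) powr (1 / \<theta>)" using \<delta> powr_mult [of "1 / 2" \<delta> "1 / \<theta>"] by (simp add: c_def \<rho>_def)
      also have "\<dots> \<le> \<delta>' powr (1 / \<theta>)" using \<delta>' \<delta> \<theta> by (intro powr_mono2) auto
      finally have c\<rho>: "c * \<rho> \<le> \<delta>' powr (1 / \<theta>)" .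
      have "1 \<le> (\<Sum>U\<in>\<U>. diameter U powr a) * ((2 / c) powr a * energy a \<rho> L X w (orth_proj V))"
      proof (rule cover_sum_energy [OF X(1) w U(1)])
        show "orth_proj V ` X \<subseteq> \<Union>\<U>" using U(2) X(2) by blast
        show "bounded U \<and> c * \<rho> \<le> diameter U \<and> diameter U \<le> 2 ^ L * \<rho>" if "U \<in> \<U>" for U
          using U(3) [OF that] c\<rho> \<delta>' \<Delta>(1) by (auto simp: \<Delta>_def)
      qed (use c \<rho> a in auto)
      also have "\<dots> \<le> 1 * ((2 / c) powr a * energy a \<rho> L X w (orth_proj V))"
        using U(4) w(1) by (intro mult_right_mono)
          (auto simp: energy_def intro!: mult_nonneg_nonneg sum_nonneg scale_kernel_nonneg)
      also have "\<dots> < (2 / c) powr a * h" using AE [OF V] c by simp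
      also have "\<dots> = 1" using c by (simp add: h_def flip: powr_mult)
      finally show False by simp
    qed
    with A(1) A2 show ?thesis by blast
  qed
  have "C4 * 2 powr (\<tau> - a) > 0" "\<Delta>\<^sub>0 / 2 > 0" using C4 D0 by auto
  then show ?thesis unfolding \<tau>_def [symmetric]
    by (intro exI [of _ "C4 * 2 powr (\<tau> - a)"] conjI exI [of _ "\<Delta>\<^sub>0 / 2"] allI impI)
       (assumption | elim conjE, rule main)+
qed

text \<open>
  The measures of the exceptional sets at the scales \<open>\<delta> n\<close> are bounded by a geometric series, so almost every
  subspace lies in only finitely many of them.
\<close>

lemma AE_eventually_not_cover:
  fixes E :: "(real ^ 'd) set" and \<gamma> :: "(real ^ 'd) set measure"
  assumes E: "E \<noteq> {}" "bounded E" and haar: "haar_grassmannian m \<gamma>"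
    and \<theta>: "0 < \<theta>" "\<theta> \<le> 1" and t: "0 \<le> t" "t \<le> q" and \<epsilon>: "0 < \<epsilon>"
    and q: "quasi_assouad_dim E < q" "0 < q" and \<kappa>: "0 \<le> \<kappa>" "\<kappa> \<le> q" "\<kappa> < real m" and \<eta>: "0 < \<eta>"
    and a: "0 \<le> a" "a < t - q + \<kappa> - \<eta>"
    and \<delta>: "\<And>n. 0 < \<delta> n" "\<And>n. \<delta> n \<le> (1 / 2) ^ n"
    and not: "\<And>n. \<not> intermediate_cover \<theta> t (\<delta> n) \<epsilon> E"
  shows "AE V in \<gamma>. eventually (\<lambda>n. \<forall>\<delta>'. \<delta> n / 2 \<le> \<delta>' \<and> \<delta>' \<le> \<delta> n \<longrightarrow>
           \<not> intermediate_cover \<theta> a \<delta>' 1 (orth_proj V ` E)) sequentially"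
proof -
  define b where "b = t - q + \<kappa> - \<eta> - a"
  have b: "b > 0" using a by (simp add: b_def)
  interpret prob_space \<gamma> using haar by (simp add: haar_grassmannian_def)
  from exceptional_set_at_scale [OF E haar \<theta> t \<epsilon> q \<kappa> \<eta> a]
  obtain C \<delta>\<^sub>1 where C: "C > 0" and \<delta>1: "\<delta>\<^sub>1 > 0"
    and ex: "\<forall>\<delta>. 0 < \<delta> \<and> \<delta> \<le> \<delta>\<^sub>1 \<and> \<not> intermediate_cover \<theta> t \<delta> \<epsilon> E \<longrightarrow>
           (\<exists>A\<in>sets \<gamma>. measure \<gamma> A \<le> C * \<delta> powr b \<and>
              (\<forall>V\<in>space \<gamma> - A. \<forall>\<delta>'. \<delta> / 2 \<le> \<delta>' \<and> \<delta>' \<le> \<delta> \<longrightarrow>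
                 \<not> intermediate_cover \<theta> a \<delta>' 1 (orth_proj V ` E)))"
    unfolding b_def [symmetric] by (elim exE conjE)
  define bad where "bad n V \<longleftrightarrow> \<not> (\<forall>\<delta>'. \<delta> n / 2 \<le> \<delta>' \<and> \<delta>' \<le> \<delta> n \<longrightarrow>
           \<not> intermediate_cover \<theta> a \<delta>' 1 (orth_proj V ` E))" for n V
  obtain N where N: "(1 / 2) ^ N < \<delta>\<^sub>1" using real_arch_pow_inv [OF \<delta>1, of "1 / 2"] by auto
  have small: "\<delta> n \<le> \<delta>\<^sub>1" if "N \<le> n" for n
  proof -
    have "\<delta> n \<le> (1 / 2) ^ n" by (rule \<delta>(2))
    also have "\<dots> \<le> (1 / 2) ^ N" using that by (intro power_decreasing) auto
    finally show ?thesis using N by simp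
  qed
  define z where "z = (1 / 2 :: real) powr b"
  have z: "0 < z" "z < 1" using b powr_less_mono' [of "1 / 2" 0 b] by (auto simp: z_def)
  have "\<exists>A. A \<in> sets \<gamma> \<and> measure \<gamma> A \<le> C * z ^ n \<and> (\<forall>V\<in>space \<gamma> - A. \<not> bad (n + N) V)" for n
  proof -
    have *: "0 < \<delta> (n + N) \<and> \<delta> (n + N) \<le> \<delta>\<^sub>1 \<and> \<not> intermediate_cover \<theta> t (\<delta> (n + N)) \<epsilon> E"
      using \<delta>(1) small not by simp
    from ex [rule_format, OF *] obtain A where A: "A \<in> sets \<gamma>" "measure \<gamma> A \<le> C * \<delta> (n + N) powr b"
       "\<forall>V\<in>space \<gamma> - A. \<not> bad (n + N) V" unfolding bad_def not_not by (elim bexE conjE)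
    have "\<delta> (n + N) \<le> (1 / 2) ^ (n + N)" by (rule \<delta>(2))
    also have "\<dots> \<le> (1 / 2) ^ n" by (intro power_decreasing) auto
    finally have "\<delta> (n + N) powr b \<le> ((1 / 2) ^ n) powr b"
      using b \<delta>(1) [of "n + N"] by (intro powr_mono2) auto
    also have "\<dots> = z ^ n"
      by (simp add: z_def powr_powr mult.commute flip: powr_realpow)
    finally have "C * \<delta> (n + N) powr b \<le> C * z ^ n" using C by (intro mult_left_mono) auto
    with A show ?thesis by (intro exI [of _ A]) auto
  qed
  then obtain A where A: "\<And>n. A n \<in> sets \<gamma>" "\<And>n. measure \<gamma> (A n) \<le> C * z ^ n"
      "\<And>n V. V \<in> space \<gamma> - A n \<Longrightarrow> \<not> bad (n + N) V" by metis
  have "summable (\<lambda>n. measure \<gamma> (A n))"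
  proof (rule summable_comparison_test')
    show "summable (\<lambda>n. C * z ^ n)" using z by (intro summable_mult summable_geometric) auto
    show "norm (measure \<gamma> (A n)) \<le> C * z ^ n" for n using A(2) [of n] by simp
  qed
  then have "AE V in \<gamma>. eventually (\<lambda>n. V \<in> space \<gamma> - A n) sequentially"
    using A(1) by (intro borel_cantelli_AE1) (auto simp: less_top [symmetric])
  then show ?thesis
  proof eventually_elim
    case (elim V)
    then have "eventually (\<lambda>n. \<not> bad (n + N) V) sequentially"
      by eventually_elim (rule A(3))
    then have "eventually (\<lambda>n. \<not> bad n V) sequentially"
      using eventually_sequentially_seg [of "\<lambda>n. \<not> bad n V" N] by blast
    then show ?case unfolding bad_def not_not .
  qed
qed

text \<open>
  Here it suffices to find arbitrarily small scales without cheap covers, so the scales may be thinned out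
  to decrease geometrically.
\<close>

lemma AE_not_upper_coverable:
  fixes E :: "(real ^ 'd) set" and \<gamma> :: "(real ^ 'd) set measure"
  assumes E: "E \<noteq> {}" "bounded E" and haar: "haar_grassmannian m \<gamma>"
    and \<theta>: "0 < \<theta>" "\<theta> \<le> 1" and t: "0 \<le> t" "t \<le> q"
    and q: "quasi_assouad_dim E < q" "0 < q" and \<kappa>: "0 \<le> \<kappa>" "\<kappa> \<le> q" "\<kappa> < real m" and \<eta>: "0 < \<eta>"
    and a: "0 \<le> a" "a < t - q + \<kappa> - \<eta>"
    and not: "\<not> upper_coverable \<theta> t E"
  shows "AE V in \<gamma>. \<not> upper_coverable \<theta> a (orth_proj V ` E)"
proof -
  obtain \<epsilon> where \<epsilon>: "\<epsilon> > 0" "\<And>\<delta>\<^sub>0. \<delta>\<^sub>0 > 0 \<Longrightarrow> \<exists>\<delta>. 0 < \<delta> \<and> \<delta> \<le> \<delta>\<^sub>0 \<and> \<not> intermediate_cover \<theta> t \<delta> \<epsilon> E"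
    using not unfolding upper_coverable_def by meson
  have "\<exists>\<delta>. 0 < \<delta> \<and> \<delta> \<le> (1 / 2) ^ n \<and> \<not> intermediate_cover \<theta> t \<delta> \<epsilon> E" for n
    by (rule \<epsilon>(2)) simp
  then obtain \<delta> where \<delta>: "\<And>n. 0 < \<delta> n" "\<And>n. \<delta> n \<le> (1 / 2) ^ n"
      "\<And>n. \<not> intermediate_cover \<theta> t (\<delta> n) \<epsilon> E" by metis
  show ?thesis
    using AE_eventually_not_cover [OF E haar \<theta> t \<epsilon>(1) q \<kappa> \<eta> a \<delta>]
  proof eventually_elim
    case (elim V)
    show ?case
    proof
      assume "upper_coverable \<theta> a (orth_proj V ` E)"
      from this [unfolded upper_coverable_def, rule_format, of 1] obtain \<delta>\<^sub>0 where "\<delta>\<^sub>0 > 0"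
        and cov: "\<forall>\<delta>. 0 < \<delta> \<and> \<delta> \<le> \<delta>\<^sub>0 \<longrightarrow> intermediate_cover \<theta> a \<delta> 1 (orth_proj V ` E)" by auto
      have "(\<lambda>n. (1 / 2 :: real) ^ n) \<longlonglongrightarrow> 0" by (intro LIMSEQ_power_zero) auto
      then have "eventually (\<lambda>n. (1 / 2 :: real) ^ n < \<delta>\<^sub>0) sequentially"
        using \<open>\<delta>\<^sub>0 > 0\<close> by (rule order_tendstoD)
      with elim have "eventually (\<lambda>n. False) sequentially"
      proof eventually_elim
        case (elim n)
        then have "\<delta> n \<le> \<delta>\<^sub>0" using \<delta>(2) [of n] by linarith
        then show ?case using elim(1) [rule_format, of "\<delta> n"] cov [rule_format, of "\<delta> n"] \<delta>(1) [of n] by simp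
      qed
      then show False by simp
    qed
  qed
qed

text \<open>
  Here all small scales must be excluded.  The scales \<open>c / 2 ^ n\<close> are enough because each exceptional set takes
  care of all \<open>\<delta>'\<close> between \<open>\<delta> n / 2\<close> and \<open>\<delta> n\<close>.
\<close>

lemma AE_not_lower_coverable:
  fixes E :: "(real ^ 'd) set" and \<gamma> :: "(real ^ 'd) set measure"
  assumes E: "E \<noteq> {}" "bounded E" and haar: "haar_grassmannian m \<gamma>"
    and \<theta>: "0 < \<theta>" "\<theta> \<le> 1" and t: "0 \<le> t" "t \<le> q"
    and q: "quasi_assouad_dim E < q" "0 < q" and \<kappa>: "0 \<le> \<kappa>" "\<kappa> \<le> q" "\<kappa> < real m" and \<eta>: "0 < \<eta>"
    and a: "0 \<le> a" "a < t - q + \<kappa> - \<eta>"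
    and not: "\<not> lower_coverable \<theta> t E"
  shows "AE V in \<gamma>. \<not> lower_coverable \<theta> a (orth_proj V ` E)"
proof -
  obtain \<epsilon> \<delta>\<^sub>0 where \<epsilon>: "\<epsilon> > 0" "\<delta>\<^sub>0 > 0" "\<And>\<delta>. 0 < \<delta> \<Longrightarrow> \<delta> \<le> \<delta>\<^sub>0 \<Longrightarrow> \<not> intermediate_cover \<theta> t \<delta> \<epsilon> E"
    using not unfolding lower_coverable_def by meson
  define c where "c = min 1 \<delta>\<^sub>0"
  have c: "0 < c" "c \<le> 1" "c \<le> \<delta>\<^sub>0" using \<epsilon>(2) by (auto simp: c_def)
  define \<delta> where "\<delta> n = c * (1 / 2) ^ n" for n :: nat
  have \<delta>: "0 < \<delta> n" "\<delta> n \<le> (1 / 2) ^ n" "\<delta> n \<le> c" for n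
    using c by (auto simp: \<delta>_def mult_left_le power_le_one)
  have \<delta>t: "\<not> intermediate_cover \<theta> t (\<delta> n) \<epsilon> E" for n using \<delta>(1,3) [of n] c(3) by (intro \<epsilon>(3)) auto
  show ?thesis
    using AE_eventually_not_cover [OF E haar \<theta> t \<epsilon>(1) q \<kappa> \<eta> a \<delta>(1,2) \<delta>t]
  proof eventually_elim
    case (elim V)
    then obtain N where N: "\<And>n \<delta>'. N \<le> n \<Longrightarrow> \<delta> n / 2 \<le> \<delta>' \<Longrightarrow> \<delta>' \<le> \<delta> n \<Longrightarrow>
        \<not> intermediate_cover \<theta> a \<delta>' 1 (orth_proj V ` E)" by (auto simp: eventually_sequentially)
    show ?case
    proof
      assume "lower_coverable \<theta> a (orth_proj V ` E)"
      from this [unfolded lower_coverable_def, rule_format, of 1 "\<delta> N"] \<delta>(1) [of N]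
      obtain \<delta>' where \<delta>': "0 < \<delta>'" "\<delta>' \<le> \<delta> N" and cov: "intermediate_cover \<theta> a \<delta>' 1 (orth_proj V ` E)"
        by auto
      obtain M where "\<delta> N / \<delta>' < 2 ^ M" using real_arch_pow [of 2 "\<delta> N / \<delta>'"] by auto
      then have "\<delta> N \<le> 2 ^ M * \<delta>'" using \<delta>' by (simp add: field_simps)
      then obtain k where k: "\<delta> N \<le> 2 ^ k * \<delta>'" "k = 0 \<or> 2 ^ k * \<delta>' < 2 * \<delta> N"
        using dyadic_scale [of "\<delta> N" M \<delta>'] by blast
      have dk: "\<delta> (N + j) = \<delta> N / 2 ^ j" for j by (simp add: \<delta>_def power_add power_divide)
      \<comment> \<open>Truncated subtraction: \<open>k = 0\<close> occurs only for \<open>\<delta>' = \<delta> N\<close>, where the index is \<open>N\<close> itself.\<close>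
      have "\<delta> (N + (k - 1)) / 2 \<le> \<delta>' \<and> \<delta>' \<le> \<delta> (N + (k - 1))"
      proof (cases k)
        case 0
        then have "\<delta>' = \<delta> N" using k \<delta>' by simp
        then show ?thesis using 0 \<delta>(1) [of N] by simp
      next
        case (Suc j)
        then show ?thesis using k unfolding dk by (simp add: field_simps)
      qed
      then show False using N [of "N + (k - 1)" \<delta>'] cov by simp
    qed
  qed
qed

section \<open>Dimensions of projections\<close>

lemma AE_ge_of_AE_ge_less:
  fixes f :: "'a \<Rightarrow> real"
  assumes "\<And>a. a < T \<Longrightarrow> AE x in M. a \<le> f x"
  shows "AE x in M. T \<le> f x"
proof -
  have "AE x in M. \<forall>n::nat. T - 1 / Suc n \<le> f x"
    unfolding AE_all_countable by (intro allI assms) simp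
  then show ?thesis
  proof eventually_elim
    case (elim x)
    have "(\<lambda>n. T - 1 / real (Suc n)) \<longlonglongrightarrow> T - 0"
      by (intro tendsto_diff tendsto_const LIMSEQ_Suc [OF lim_1_over_n])
    then show ?case using elim by (intro LIMSEQ_le_const2 [of _ T "f x"]) auto
  qed
qed

text \<open>
  The gap between \<open>a\<close> and \<open>D - max 0 (Q - m)\<close> is divided into five parts; \<open>t\<close>, \<open>q\<close>, \<open>\<kappa>\<close> and \<open>\<eta>\<close> use up one
  each, and one remains for the strict inequality.
\<close>

lemma choice_of_exponents:
  fixes D Q a m :: real
  assumes "D \<le> max 0 Q" "0 \<le> a" "a < D - max 0 (Q - m)" "1 \<le> m"
  obtains t q \<kappa> \<eta> where "0 \<le> t" "t < D" "t \<le> q" "Q < q" "0 < q" "0 \<le> \<kappa>" "\<kappa> \<le> q" "\<kappa> < m" "0 < \<eta>"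
    "a < t - q + \<kappa> - \<eta>"
proof
  define g where "g = (D - max 0 (Q - m) - a) / 5"
  have "5 * g = D - max 0 (Q - m) - a" by (simp add: g_def)
  then have g: "g > 0" "D = a + max 0 (Q - m) + 5 * g" using assms(3) by linarith+
  show "0 \<le> D - g" "D - g < D" "D - g \<le> max Q m + g" "Q < max Q m + g" "0 < max Q m + g" "0 \<le> m - g"
    "m - g \<le> max Q m + g" "m - g < m" "0 < g" "a < D - g - (max Q m + g) + (m - g) - g"
    using g assms by (auto simp: max_def split: if_splits)
qed

text \<open>
  The passage from coverability to dimensions, in a form common to both kinds of dimension: \<open>cov s\<close> expresses
  that \<open>s\<close> belongs to the set of exponents whose infimum is the dimension \<open>dm\<close>.
\<close>

lemma AE_threshold_projection:
  fixes E :: "(real ^ 'd) set" and \<gamma> :: "(real ^ 'd) set measure"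
    and cov :: "real \<Rightarrow> (real ^ 'd) set \<Rightarrow> bool" and dm :: "(real ^ 'd) set \<Rightarrow> real"
  assumes E: "E \<noteq> {}" "bounded E" and haar: "haar_grassmannian m \<gamma>" and m: "1 \<le> m"
    and \<theta>: "0 < \<theta>" "\<theta> \<le> 1"
    and dm: "\<And>F. dm F = Inf {s. 0 \<le> s \<and> cov s F}"
    and mono: "\<And>s s' F. cov s F \<Longrightarrow> 0 \<le> s \<Longrightarrow> s \<le> s' \<Longrightarrow> cov s' F"
    and upper: "\<And>s F. upper_coverable \<theta> s F \<Longrightarrow> cov s F"
    and image: "\<And>s V. cov s E \<Longrightarrow> 0 \<le> s \<Longrightarrow> subspace V \<Longrightarrow> cov s (orth_proj V ` E)"
    and AE_not: "\<And>t q \<kappa> \<eta> a. 0 \<le> t \<Longrightarrow> t \<le> q \<Longrightarrow> quasi_assouad_dim E < q \<Longrightarrow> 0 < q \<Longrightarrow> 0 \<le> \<kappa> \<Longrightarrow>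
       \<kappa> \<le> q \<Longrightarrow> \<kappa> < real m \<Longrightarrow> 0 < \<eta> \<Longrightarrow> 0 \<le> a \<Longrightarrow> a < t - q + \<kappa> - \<eta> \<Longrightarrow> \<not> cov t E \<Longrightarrow>
       AE V in \<gamma>. \<not> cov a (orth_proj V ` E)"
  shows "(quasi_assouad_dim E \<le> max (real m) (dm E) \<longrightarrow>
          (AE V in \<gamma>. dm (orth_proj V ` E) = min (real m) (dm E))) \<and>
         (AE V in \<gamma>. dm E - max 0 (quasi_assouad_dim E - real m) \<le> dm (orth_proj V ` E))"
    (is "(_ \<longrightarrow> ?equal) \<and> ?lower")
proof -
  note sub = haar_grassmannian_subspace [OF haar]
  have cov_DIM: "cov (real DIM(real ^ 'd) + 1) F" if "bounded F" for F
    using that by (intro upper upper_coverable_DIM_plus_1 \<theta>)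
  have le: "dm F \<le> s" if "0 \<le> s" "cov s F" for s F
    unfolding dm using that by (rule threshold_le)
  have nonneg: "0 \<le> dm F" if "bounded F" for F
    unfolding dm by (rule threshold_nonneg [where P = "\<lambda>s. cov s F", OF cov_DIM [OF that]]) simp
  have ge: "s \<le> dm F" if F: "bounded F" "\<not> cov s F" for s F
    unfolding dm
    by (rule threshold_ge [where P = "\<lambda>s. cov s F", OF mono cov_DIM [OF F(1)] _ F(2)]) simp_all
  have D: "dm E \<le> max 0 (quasi_assouad_dim E)"
  proof (rule dense_ge)
    fix s assume s: "max 0 (quasi_assouad_dim E) < s"
    then have "upper_coverable \<theta> s E" by (intro upper_coverable_quasi_assouad E \<theta>) auto
    then show "dm E \<le> s" using s by (intro le upper) auto
  qed
  have lower: ?lower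
  proof (rule AE_ge_of_AE_ge_less)
    fix a assume a: "a < dm E - max 0 (quasi_assouad_dim E - real m)"
    show "AE V in \<gamma>. a \<le> dm (orth_proj V ` E)"
    proof (cases "0 \<le> a")
      case False
      have "a \<le> dm (orth_proj V ` E)" if V: "V \<in> space \<gamma>" for V
        using nonneg [OF bounded_orth_proj_image [OF sub(1) [OF V] E(2)]] False by linarith
      then show ?thesis by (rule AE_I2)
    next
      case True
      obtain t q \<kappa> \<eta> where par: "0 \<le> t" "t < dm E" "t \<le> q" "quasi_assouad_dim E < q" "0 < q"
          "0 \<le> \<kappa>" "\<kappa> \<le> q" "\<kappa> < real m" "0 < \<eta>" "a < t - q + \<kappa> - \<eta>"
        using choice_of_exponents [OF D True a] m by (metis of_nat_1 of_nat_le_iff)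
      have "\<not> cov t E" using le [OF par(1)] par(2) by fastforce
      then have "AE V in \<gamma>. \<not> cov a (orth_proj V ` E)"
        by (rule AE_not [OF par(1,3-9) True par(10)])
      then show ?thesis using AE_space
      proof eventually_elim
        case (elim V)
        then show ?case by (intro ge bounded_orth_proj_image sub(1) E(2))
      qed
    qed
  qed
  have proj_le: "dm (orth_proj V ` E) \<le> min (real m) (dm E)" if V: "V \<in> space \<gamma>" for V
  proof (rule min.boundedI; rule dense_ge)
    fix s assume s: "real m < s"
    have "orth_proj V ` E \<subseteq> V" using orth_proj(1) [OF sub(1) [OF V]] by blast
    then have "upper_coverable \<theta> s (orth_proj V ` E)"
      using s sub [OF V] E(2) by (intro upper_coverable_subspace [OF \<theta>, of V] bounded_orth_proj_image) auto
    then show "dm (orth_proj V ` E) \<le> s" using s by (intro le upper) auto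
  next
    fix s assume s: "dm E < s"
    then have s0: "0 \<le> s" using nonneg [OF E(2)] by linarith
    have "cov s E" using ge [OF E(2), of s] s by fastforce
    then show "dm (orth_proj V ` E) \<le> s" by (intro le s0 image sub(1) V)
  qed
  have ?equal if "quasi_assouad_dim E \<le> max (real m) (dm E)"
    using lower AE_space
  proof eventually_elim
    case (elim V)
    then show ?case using proj_le [OF elim(2)] that by (auto simp: min_def max_def split: if_splits)
  qed
  with lower show ?thesis by blast
qed

theorem corollary3p7:
  fixes E :: "(real ^ 'd) set" and m :: nat and \<gamma> :: "(real ^ 'd) set measure"
  assumes "E \<noteq> {}" and "bounded E"
    and "1 \<le> m" and "m \<le> CARD('d)"
    and "haar_grassmannian m \<gamma>"
  shows
    "(\<forall>\<theta>\<in>{0<..1}. quasi_assouad_dim E \<le> max (real m) (upper_intermediate_dim \<theta> E) \<longrightarrow>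
        (AE V in \<gamma>. upper_intermediate_dim \<theta> (orth_proj V ` E)
                      = min (real m) (upper_intermediate_dim \<theta> E))) \<and>
     (\<forall>\<theta>\<in>{0<..1}. AE V in \<gamma>. upper_intermediate_dim \<theta> (orth_proj V ` E)
                      \<ge> upper_intermediate_dim \<theta> E - max 0 (quasi_assouad_dim E - real m)) \<and>
     (\<forall>\<theta>\<in>{0<..1}. quasi_assouad_dim E \<le> max (real m) (lower_intermediate_dim \<theta> E) \<longrightarrow>
        (AE V in \<gamma>. lower_intermediate_dim \<theta> (orth_proj V ` E)
                      = min (real m) (lower_intermediate_dim \<theta> E))) \<and>
     (\<forall>\<theta>\<in>{0<..1}. AE V in \<gamma>. lower_intermediate_dim \<theta> (orth_proj V ` E)
                      \<ge> lower_intermediate_dim \<theta> E - max 0 (quasi_assouad_dim E - real m))"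
proof -
  have upper: "(quasi_assouad_dim E \<le> max (real m) (upper_intermediate_dim \<theta> E) \<longrightarrow>
        (AE V in \<gamma>. upper_intermediate_dim \<theta> (orth_proj V ` E) = min (real m) (upper_intermediate_dim \<theta> E))) \<and>
      (AE V in \<gamma>. upper_intermediate_dim \<theta> (orth_proj V ` E)
         \<ge> upper_intermediate_dim \<theta> E - max 0 (quasi_assouad_dim E - real m))"
    if "\<theta> \<in> {0<..1}" for \<theta>
  proof -
    have \<theta>: "0 < \<theta>" "\<theta> \<le> 1" using that by auto
    show ?thesis
    proof (rule AE_threshold_projection [where cov = "upper_coverable \<theta>", OF assms(1,2,5,3) \<theta> upper_intermediate_dim_alt])
      show "upper_coverable \<theta> s' F" if "upper_coverable \<theta> s F" "0 \<le> s" "s \<le> s'" for s s' and F :: "(real ^ 'd) set"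
        using that by (rule upper_coverable_mono)
      show "upper_coverable \<theta> s (orth_proj V ` E)" if "upper_coverable \<theta> s E" "0 \<le> s" "subspace V" for s V
        by (rule upper_coverable_image [OF that(1) \<theta> that(2) dist_orth_proj_le [OF that(3)]])
      show "AE V in \<gamma>. \<not> upper_coverable \<theta> a (orth_proj V ` E)"
        if "0 \<le> t" "t \<le> q" "quasi_assouad_dim E < q" "0 < q" "0 \<le> \<kappa>" "\<kappa> \<le> q" "\<kappa> < real m" "0 < \<eta>"
          "0 \<le> a" "a < t - q + \<kappa> - \<eta>" "\<not> upper_coverable \<theta> t E" for t q \<kappa> \<eta> a
        by (rule AE_not_upper_coverable [OF assms(1,2,5) \<theta> that])
    qed
  qed
  have lower: "(quasi_assouad_dim E \<le> max (real m) (lower_intermediate_dim \<theta> E) \<longrightarrow>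
        (AE V in \<gamma>. lower_intermediate_dim \<theta> (orth_proj V ` E) = min (real m) (lower_intermediate_dim \<theta> E))) \<and>
      (AE V in \<gamma>. lower_intermediate_dim \<theta> (orth_proj V ` E)
         \<ge> lower_intermediate_dim \<theta> E - max 0 (quasi_assouad_dim E - real m))"
    if "\<theta> \<in> {0<..1}" for \<theta>
  proof -
    have \<theta>: "0 < \<theta>" "\<theta> \<le> 1" using that by auto
    show ?thesis
    proof (rule AE_threshold_projection [where cov = "lower_coverable \<theta>", OF assms(1,2,5,3) \<theta> lower_intermediate_dim_alt])
      show "lower_coverable \<theta> s' F" if "lower_coverable \<theta> s F" "0 \<le> s" "s \<le> s'" for s s' and F :: "(real ^ 'd) set"
        using that by (rule lower_coverable_mono)
      show "lower_coverable \<theta> s (orth_proj V ` E)" if "lower_coverable \<theta> s E" "0 \<le> s" "subspace V" for s V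
        by (rule lower_coverable_image [OF that(1) \<theta> that(2) dist_orth_proj_le [OF that(3)]])
      show "AE V in \<gamma>. \<not> lower_coverable \<theta> a (orth_proj V ` E)"
        if "0 \<le> t" "t \<le> q" "quasi_assouad_dim E < q" "0 < q" "0 \<le> \<kappa>" "\<kappa> \<le> q" "\<kappa> < real m" "0 < \<eta>"
          "0 \<le> a" "a < t - q + \<kappa> - \<eta>" "\<not> lower_coverable \<theta> t E" for t q \<kappa> \<eta> a
        by (rule AE_not_lower_coverable [OF assms(1,2,5) \<theta> that])
    qed (rule upper_coverable_imp_lower)
  qed
  show ?thesis using upper lower by blast
qed

end
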